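(* Let $N^{\Lambda}_{\mathcal{PB}_3}(Y)$, for $Y>0$, denote the number of elements $\mathbf{b}\in \mathcal{PB}_3/\mathcal{Z}_3$ with $0<\Lambda_{tr}(\mathbf{b})\le Y$. Then for all $Y\ge 600\log 8$, $$\tfrac12 \exp\!\big(\tfrac{Y}{900}\big)\le N^{\Lambda}_{\mathcal{PB}_3}(Y)\le \tfrac12 e^{6\pi Y},$$ and the upper bound $N^{\Lambda}_{\mathcal{PB}_3}(Y)\le \tfrac12 e^{6\pi Y}$ holds for all $Y>0$.
   Context: $\mathcal{B}_n$ is the Artin braid group on $n$ strands with standard generators $\sigma_1,\dots,\sigma_{n-1}$, identified with $\pi_1(C_n(\mathbb{C})/\mathcal{S}_n, E_n)$, where $C_n(\mathbb{C})=\{(z_1,\dots,z_n)\in\mathbb{C}^n: z_j\ne z_k \text{ for } j\ne k\}$ and $\mathcal{S}_n$ is the symmetric group acting by permutation; $\mathcal{PB}_n$ is the pure braid group; $\mathcal{Z}_n$ is the center of $\mathcal{B}_n$, generated by $\Delta_n^2$ with $\Delta_n=(\sigma_1\cdots\sigma_{n-1})(\sigma_1\cdots\sigma_{n-2})\cdots(\sigma_1\sigma_2)\sigma_1$. The totally real subspace $C_n(\mathbb{R})/\mathcal{S}_n$ is connected and simply connected; taking the base point $E_n$ in it, $\mathcal{B}_n$ is isomorphic to the relative fundamental group $\pi_1(C_n(\mathbb{C})/\mathcal{S}_n, C_n(\mathbb{R})/\mathcal{S}_n)$ (homotopy classes of arcs with endpoints in $C_n(\mathbb{R})/\mathcal{S}_n$):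 for an arc $\gamma$ take its lift $\tilde\gamma=(\tilde\gamma_1,\dots,\tilde\gamma_n)$ to $C_n(\mathbb{C})$ with $\tilde\gamma_1(0)<\dots<\tilde\gamma_n(0)$; $\sigma_j$ corresponds to the class whose lift moves $\tilde\gamma_j(0),\tilde\gamma_{j+1}(0)$ with uniform speed in the positive direction along a half-circle centered at their midpoint, fixing the other points. Denote by $b_{tr}$ the image of $b\in\mathcal{B}_n$. For an open rectangle $R$ with sides parallel to the axes, horizontal side length $\mathsf b$ and vertical side length $\mathsf a$, put $\lambda(R)=\mathsf a/\mathsf b$. A map $f:R\to C_n(\mathbb{C})/\mathcal{S}_n$ extending continuously to $\bar R$ with open horizontal sides mapped into $C_n(\mathbb{R})/\mathcal{S}_n$ represents $b_{tr}$ if for each maximal vertical segment in $R$ the restriction of $f$ to its closure represents $b_{tr}$. The extremal length with totally real horizontal boundary values is $\Lambda_{tr}(b)=\inf\{\lambda(R): R \text{ admits a holomorphic map to } C_n(\mathbb{C})/\mathcal{S}_n \text{ representing } b_{tr}\}$. $\Lambda_{tr}$ is unchanged under multiplication by $\Delta_n$, hence is well defined on $\mathcal{B}_n/\mathcal{Z}_n$. *)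

theory Defs
  imports "HOL-Complex_Analysis.Complex_Analysis"
begin

text \<open>Points of C_n(C) are modelled as functions nat => complex, of which only the
coordinates j < n matter.  A point of C_n(C)/S_n is represented by any of its lifts.\<close>

definition conf :: "nat \<Rightarrow> (nat \<Rightarrow> complex) \<Rightarrow> bool" where
  "conf n z \<longleftrightarrow> (\<forall>j<n. \<forall>k<n. j \<noteq> k \<longrightarrow> z j \<noteq> z k)"

definition real_conf :: "nat \<Rightarrow> (nat \<Rightarrow> complex) \<Rightarrow> bool" where
  "real_conf n z \<longleftrightarrow> conf n z \<and> (\<forall>j<n. z j \<in> \<real>)"

definition incr_real_conf :: "nat \<Rightarrow> (nat \<Rightarrow> complex) \<Rightarrow> bool" where
  "incr_real_conf n z \<longleftrightarrow> real_conf n z \<and> (\<forall>j k. j < k \<and> k < n \<longrightarrow> Re (z j) < Re (z k))"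

text \<open>Lift (starting at the increasingly ordered real configuration) of an arc in
C_n(C)/S_n with endpoints in the totally real subspace C_n(R)/S_n.\<close>

definition tr_arc :: "nat \<Rightarrow> (real \<Rightarrow> nat \<Rightarrow> complex) \<Rightarrow> bool" where
  "tr_arc n g \<longleftrightarrow>
     (\<forall>j<n. continuous_on {0..1} (\<lambda>t. g t j)) \<and>
     (\<forall>t\<in>{0..1}. conf n (g t)) \<and>
     incr_real_conf n (g 0) \<and> real_conf n (g 1)"

text \<open>Homotopy of arcs with endpoints moving in the totally real subspace
(relative fundamental group pi_1(C_n(C)/S_n, C_n(R)/S_n), i.e. equality in B_n).\<close>

definition tr_homotopic :: "nat \<Rightarrow> (real \<Rightarrow> nat \<Rightarrow> complex) \<Rightarrow> (real \<Rightarrow> nat \<Rightarrow> complex) \<Rightarrow> bool" where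
  "tr_homotopic n g h \<longleftrightarrow>
     (\<exists>H :: real \<times> real \<Rightarrow> nat \<Rightarrow> complex.
        (\<forall>j<n. continuous_on ({0..1} \<times> {0..1}) (\<lambda>p. H p j)) \<and>
        (\<forall>p\<in>{0..1} \<times> {0..1}. conf n (H p)) \<and>
        (\<forall>s\<in>{0..1}. incr_real_conf n (H (s, 0)) \<and> real_conf n (H (s, 1))) \<and>
        (\<forall>t\<in>{0..1}. \<forall>j<n. H (0, t) j = g t j \<and> H (1, t) j = h t j))"

text \<open>The k-th power of the full twist Delta_n^2 (generator of the centre Z_n),
performed at the real end configuration x: rotation of all points about 0.\<close>

definition full_twist :: "int \<Rightarrow> (nat \<Rightarrow> complex) \<Rightarrow> real \<Rightarrow> nat \<Rightarrow> complex" where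
  "full_twist k x = (\<lambda>t j. exp (2 * pi * \<i> * of_int k * of_real t) * x j)"

definition center_equiv :: "nat \<Rightarrow> (real \<Rightarrow> nat \<Rightarrow> complex) \<Rightarrow> (real \<Rightarrow> nat \<Rightarrow> complex) \<Rightarrow> bool" where
  "center_equiv n g h \<longleftrightarrow> (\<exists>k::int. tr_homotopic n h (g +++ full_twist k (g 1)))"

definition represents_tr :: "nat \<Rightarrow> (real \<Rightarrow> nat \<Rightarrow> complex) \<Rightarrow> real \<Rightarrow> real \<Rightarrow> real \<Rightarrow> real
      \<Rightarrow> (complex \<Rightarrow> nat \<Rightarrow> complex) \<Rightarrow> bool" where
  "represents_tr n g x0 y0 b a F \<longleftrightarrow>
     (\<forall>j<n. continuous_on (cbox (Complex x0 y0) (Complex (x0 + b) (y0 + a))) (\<lambda>z. F z j)) \<and>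
     (\<forall>j<n. (\<lambda>z. F z j) holomorphic_on box (Complex x0 y0) (Complex (x0 + b) (y0 + a))) \<and>
     (\<forall>z\<in>cbox (Complex x0 y0) (Complex (x0 + b) (y0 + a)). conf n (F z)) \<and>
     (\<forall>x. x0 < x \<and> x < x0 + b \<longrightarrow>
        incr_real_conf n (F (Complex x y0)) \<and> real_conf n (F (Complex x (y0 + a)))) \<and>
     (\<forall>x. x0 < x \<and> x < x0 + b \<longrightarrow>
        tr_homotopic n (\<lambda>t. F (Complex x (y0 + t * a))) g)"

text \<open>Extremal length with totally real horizontal boundary values
(infimum of the empty set is \<infinity>).\<close>

definition Lambda_tr :: "nat \<Rightarrow> (real \<Rightarrow> nat \<Rightarrow> complex) \<Rightarrow> ereal" where
  "Lambda_tr n g = Inf {ereal (a / b) | a b. a > 0 \<and> b > 0 \<and>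
       (\<exists>x0 y0 F. represents_tr n g x0 y0 b a F)}"

definition PB_mod_Z :: "nat \<Rightarrow> (real \<Rightarrow> nat \<Rightarrow> complex) set set" where
  "PB_mod_Z n = {C. \<exists>g. tr_arc n g \<and> incr_real_conf n (g 1) \<and>
                      C = {h. tr_arc n h \<and> center_equiv n g h}}"

definition Lambda_tr_class :: "nat \<Rightarrow> (real \<Rightarrow> nat \<Rightarrow> complex) set \<Rightarrow> ereal" where
  "Lambda_tr_class n C = Lambda_tr n (SOME g. g \<in> C)"

definition N_Lambda_PB :: "nat \<Rightarrow> real \<Rightarrow> (real \<Rightarrow> nat \<Rightarrow> complex) set set" where
  "N_Lambda_PB n Y = {C \<in> PB_mod_Z n. 0 < Lambda_tr_class n C \<and> Lambda_tr_class n C \<le> ereal Y}"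

end

theory Submission
  imports Defs
begin

text \<open>Dividing out affine maps, a braid in \<open>PB\<^sub>3/Z\<^sub>3\<close> becomes an arc in \<open>\<complex> - {0,1}\<close> with
  end points in \<open>(0,1)\<close>, and a totally real holomorphic representative becomes a map of a rectangle into
  \<open>\<complex> - {0,1}\<close> with horizontal sides in \<open>(0,1)\<close>. The modular function \<open>\<lambda>\<close> is a covering of
  \<open>\<complex> - {0,1}\<close> by the upper half-plane; the preimage of \<open>(0,1)\<close> consists of the images of the imaginary axis
  \<open>A\<close> under matrices \<open>(p,q;r,s)\<close> of determinant 1 with \<open>q\<close>, \<open>r\<close> even. Lifting turns a class into such a
  matrix \<open>\<gamma>\<close>, and its extremal length is \<open>d(A, \<gamma>A)/\<pi>\<close>, where \<open>cosh d = |ps + qr|\<close> if \<open>qr \<noteq> 0\<close> and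
  \<open>d = 0\<close> otherwise. The upper bound follows by counting matrices with \<open>|ps + qr| \<le> e\<^sup>\<pi>\<^sup>Y\<close>, the lower bound
  already from the matrices \<open>(1+4m,2;2m,1)\<close>.

  That \<open>\<lambda>\<close> is a covering is seen by lifting through Landen's transformation \<open>\<lambda>(\<tau>) \<mapsto> \<lambda>(2\<tau>)\<close>: its iterates
  on a disc omit 0 and 1 and tend to 0 at the centre, so by Schottky's theorem they tend to 0 nearby, where
  \<open>\<lambda>\<close> is inverted by its expansion at the cusp.\<close>

section \<open>Theta constants and Landen's transformation\<close>

text \<open>What the affine quotient keeps of a triple is the ratio (z1 - z0)/(z2 - z0); what it
  forgets is the winding of z2 - z0, and this is exactly what full twists change, so classes modulo
  the centre are seen by the lifted ratio alone. The logarithm of a suitable Moebius map opens the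
  half-plane to a strip of width pi in which A and gamma A become cross-cuts at distance d;
  comparing a rectangle with this strip produces d/pi. If qr = 0, the two geodesics share an ideal
  end point and come arbitrarily close, which is why such classes do not have positive length. The
  estimates rest on one matrix per class for the upper bound and on one explicit family of distinct
  classes for the lower bound. The identity lambda(-1/t) = 1 - lambda(t), which supplies the second
  generator of the group, is not read off the theta series: lifting 1 - lambda through the covering
  gives an involution t -> -y^2/t, and an element of order three forces y = 1.\<close>

definition theta3 :: "complex \<Rightarrow> complex" where
  "theta3 q = (\<Sum>\<^sub>\<infinity>n::int. q ^ nat (n\<^sup>2))"

text \<open>The factor q^(1/4) of the classical series is dropped, which keeps the function
  single-valued and holomorphic on the unit disc. The exponent n^2 + n is never negative, so
  \<open>nat\<close> loses nothing.\<close>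

definition theta2 :: "complex \<Rightarrow> complex" where
  "theta2 q = (\<Sum>\<^sub>\<infinity>n::int. q ^ nat (n\<^sup>2 + n))"

text \<open>A common majorant for both series. The exponent |n| - 1 instead of |n| is dictated by
  n^2 + n, which vanishes at n = -1; truncated subtraction makes it 0 at n = 0 as well.\<close>

lemma summable_on_int_power:
  fixes r :: real
  assumes "0 \<le> r" "r < 1"
  shows "(\<lambda>n::int. r ^ (nat \<bar>n\<bar> - 1)) summable_on UNIV"
proof -
  have g: "summable (\<lambda>n. r ^ n)"
    using assms by (simp add: summable_geometric)
  have "summable (\<lambda>n. r ^ (n - 1))"
    using g by (subst summable_Suc_iff[symmetric]) simp
  then have a: "(\<lambda>n. r ^ (n - 1)) summable_on (UNIV::nat set)"
    using assms by (intro norm_summable_imp_summable_on) (simp add: norm_power)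
  have b: "(\<lambda>n. r ^ n) summable_on (UNIV::nat set)"
    using g assms by (intro norm_summable_imp_summable_on) (simp add: norm_power)
  have i: "inj int" "inj (\<lambda>n::nat. - int n - 1)"
    by (auto intro!: injI)
  have "(\<lambda>n::int. r ^ (nat \<bar>n\<bar> - 1)) summable_on range int"
    using a by (subst summable_on_reindex[OF i(1)]) (simp add: o_def)
  moreover have "(\<lambda>n::int. r ^ (nat \<bar>n\<bar> - 1)) summable_on range (\<lambda>n::nat. - int n - 1)"
  proof (subst summable_on_reindex[OF i(2)])
    have "nat \<bar>- int n - 1\<bar> - 1 = n" for n by simp
    then show "(\<lambda>n. r ^ (nat \<bar>n\<bar> - 1)) \<circ> (\<lambda>n. - int n - 1) summable_on UNIV"
      using b by (simp only: o_def)
  qed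
  ultimately have "(\<lambda>n::int. r ^ (nat \<bar>n\<bar> - 1)) summable_on range int \<union> range (\<lambda>n::nat. - int n - 1)"
    by (rule summable_on_union)
  also have "range int \<union> range (\<lambda>n::nat. - int n - 1) = UNIV"
  proof -
    have "x \<in> range (\<lambda>n::nat. - int n - 1)" if "x \<notin> range int" for x
    proof -
      have "x < 0" using that by (metis not_le rangeI zero_le_imp_eq_int)
      then show ?thesis by (intro image_eqI[of _ _ "nat (- x - 1)"]) auto
    qed
    then show ?thesis by blast
  qed
  finally show ?thesis .
qed

context
  fixes e :: "int \<Rightarrow> nat"
  assumes e: "\<And>n. nat \<bar>n\<bar> - 1 \<le> e n"
begin

lemma int_power_abs_summable:
  fixes q :: complex
  assumes "norm q < 1"
  shows "(\<lambda>n. norm (q ^ e n)) summable_on UNIV"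
proof (rule summable_on_comparison_test)
  show "(\<lambda>n::int. norm q ^ (nat \<bar>n\<bar> - 1)) summable_on UNIV"
    using assms by (intro summable_on_int_power) auto
  show "norm (q ^ e n) \<le> norm q ^ (nat \<bar>n\<bar> - 1)" for n
    using assms e[of n] by (simp add: norm_power power_decreasing)
qed auto

lemma int_power_holomorphic: "(\<lambda>q. \<Sum>\<^sub>\<infinity>n. q ^ e n) holomorphic_on ball (0::complex) 1"
proof -
  have "(\<lambda>q. \<Sum>\<^sub>\<infinity>n. q ^ e n) holomorphic_on ball (0::complex) r" if r: "0 < r" "r < 1" for r
  proof -
    have u: "uniform_limit (cball 0 r) (\<lambda>X q. \<Sum>n\<in>X. q ^ e n) (\<lambda>q::complex. \<Sum>\<^sub>\<infinity>n. q ^ e n)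
        (finite_subsets_at_top UNIV)"
    proof (rule Weierstrass_m_test_general[where M = "\<lambda>n. r ^ (nat \<bar>n\<bar> - 1)"])
      show "norm (q ^ e n) \<le> r ^ (nat \<bar>n\<bar> - 1)" if "q \<in> cball 0 r" for n and q :: complex
      proof -
        have "norm (q ^ e n) \<le> r ^ e n"
          using that by (simp add: norm_power power_mono)
        also have "\<dots> \<le> r ^ (nat \<bar>n\<bar> - 1)"
          using r e[of n] by (intro power_decreasing) auto
        finally show ?thesis .
      qed
      show "(\<lambda>n::int. r ^ (nat \<bar>n\<bar> - 1)) summable_on UNIV"
        using r by (intro summable_on_int_power) auto
    qed
    show ?thesis
      by (rule holomorphic_uniform_limit[OF _ u]) (auto intro!: always_eventually continuous_intros holomorphic_intros)
  qed
  note * = this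
  show ?thesis
    unfolding holomorphic_on_open[OF open_ball]
  proof
    fix q :: complex assume q: "q \<in> ball 0 1"
    define r where "r = (1 + norm q) / 2"
    have "0 < r" "r < 1" "q \<in> ball 0 r"
      using q norm_ge_zero[of q] unfolding r_def by (auto simp del: norm_ge_zero)
    then show "\<exists>f'. ((\<lambda>q. \<Sum>\<^sub>\<infinity>n. q ^ e n) has_field_derivative f') (at q)"
      using *[of r] by (auto simp: holomorphic_on_open)
  qed
qed

end

lemma nat_abs_le_square: "nat \<bar>n\<bar> - 1 \<le> nat (n\<^sup>2)" for n :: int
proof -
  have "\<bar>n\<bar> * 1 \<le> \<bar>n\<bar> * \<bar>n\<bar>" if "n \<noteq> 0" using that by (intro mult_left_mono) auto
  then have "\<bar>n\<bar> \<le> n\<^sup>2" by (cases "n = 0") (auto simp: power2_eq_square)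
  then show ?thesis by linarith
qed

lemma nat_abs_le_square_add: "nat \<bar>n\<bar> - 1 \<le> nat (n\<^sup>2 + n)" for n :: int
proof (cases "n \<ge> 0")
  case True
  then show ?thesis using zero_le_power2[of n] by linarith
next
  case False
  then have "(- n - 1) * 1 \<le> (- n - 1) * (- n)" by (intro mult_left_mono) auto
  then have "- n - 1 \<le> n\<^sup>2 + n" by (simp add: power2_eq_square algebra_simps)
  then show ?thesis using False by linarith
qed

lemmas theta3_summable = int_power_abs_summable[OF nat_abs_le_square]
lemmas theta2_summable = int_power_abs_summable[OF nat_abs_le_square_add]

lemma theta3_holomorphic: "theta3 holomorphic_on ball 0 1"
  unfolding theta3_def using int_power_holomorphic[OF nat_abs_le_square] by simp

lemma theta2_holomorphic: "theta2 holomorphic_on ball 0 1"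
  unfolding theta2_def using int_power_holomorphic[OF nat_abs_le_square_add] by simp

section \<open>Products of theta series and the doubling formulas\<close>

lemma abs_summable_on_product:
  fixes f :: "'a \<Rightarrow> complex" and g :: "'b \<Rightarrow> complex"
  assumes f: "(\<lambda>x. norm (f x)) summable_on A" and g: "(\<lambda>x. norm (g x)) summable_on B"
  shows "(\<lambda>p. norm (case p of (x, y) \<Rightarrow> f x * g y)) summable_on (A \<times> B)"
proof (subst Infinite_Sum.abs_summable_on_Sigma_iff, intro conjI ballI)
  show "(\<lambda>y. norm (case (x, y) of (x, y) \<Rightarrow> f x * g y)) summable_on B" if "x \<in> A" for x
    using summable_on_cmult_right[OF g, of "norm (f x)"] by (simp add: norm_mult)
  have "(\<Sum>\<^sub>\<infinity>y\<in>B. norm (case (x, y) of (x, y) \<Rightarrow> f x * g y)) = norm (f x) * (\<Sum>\<^sub>\<infinity>y\<in>B. norm (g y))" for x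
    using g by (simp add: norm_mult infsum_cmult_right)
  moreover have "(\<lambda>x. norm (norm (f x) * (\<Sum>\<^sub>\<infinity>y\<in>B. norm (g y)))) summable_on A"
    using summable_on_cmult_left[OF f, of "\<bar>\<Sum>\<^sub>\<infinity>y\<in>B. norm (g y)\<bar>"] by (simp add: abs_mult)
  ultimately show "(\<lambda>x. norm (\<Sum>\<^sub>\<infinity>y\<in>B. norm (case (x, y) of (x, y) \<Rightarrow> f x * g y))) summable_on A"
    by presburger
qed

lemma infsum_product:
  fixes f :: "'a \<Rightarrow> complex" and g :: "'b \<Rightarrow> complex"
  assumes f: "(\<lambda>x. norm (f x)) summable_on A" and g: "(\<lambda>x. norm (g x)) summable_on B"
  shows "infsum f A * infsum g B = (\<Sum>\<^sub>\<infinity>(x, y)\<in>A \<times> B. f x * g y)"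
proof -
  have "(\<Sum>\<^sub>\<infinity>(x, y)\<in>A \<times> B. f x * g y) = (\<Sum>\<^sub>\<infinity>x\<in>A. \<Sum>\<^sub>\<infinity>y\<in>B. f x * g y)"
    using infsum_Sigma_banach[OF abs_summable_summable[OF abs_summable_on_product[OF f g]]] by simp
  also have "\<dots> = (\<Sum>\<^sub>\<infinity>x\<in>A. f x * infsum g B)"
    using abs_summable_summable[OF g] by (simp add: infsum_cmult_right)
  also have "\<dots> = infsum f A * infsum g B"
    using abs_summable_summable[OF f] by (simp add: infsum_cmult_left)
  finally show ?thesis by simp
qed

text \<open>Lattice points are split by the parity of m + n. In the coordinates a, b the form m^2 +
  n^2 is diagonal again, 2a^2 + 2b^2 or 2(a^2 + a) + 2(b^2 + b) + 1, and this is what produces theta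
  series at q^2.\<close>

lemma infsum_even_odd:
  fixes F :: "int \<times> int \<Rightarrow> complex"
  assumes "(\<lambda>x. norm (F x)) summable_on UNIV"
  shows "infsum F UNIV = (\<Sum>\<^sub>\<infinity>(a, b). F (a + b, a - b)) + (\<Sum>\<^sub>\<infinity>(a, b). F (a + b + 1, a - b))"
proof -
  have half: "(m - n) div 2 + (m + n) div 2 = m" "(m + n) div 2 - (m - n) div 2 = n"
    if "even (m + n)" for m n :: int
    using that by presburger+
  have half': "(m - n) div 2 + (m + n) div 2 + 1 = m" "(m + n) div 2 - (m - n) div 2 = n"
    if "odd (m + n)" for m n :: int
    using that by presburger+
  let ?E = "{(m, n). even (m + n)} :: (int \<times> int) set" and ?O = "{(m, n). odd (m + n)} :: (int \<times> int) set"
  have F: "F summable_on UNIV" using assms by (rule abs_summable_summable)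
  have "infsum F (?E \<union> ?O) = infsum F ?E + infsum F ?O"
    by (rule infsum_Un_disjoint) (auto intro: summable_on_subset_banach[OF F])
  moreover have "?E \<union> ?O = UNIV" by auto
  moreover have "infsum F ?E = (\<Sum>\<^sub>\<infinity>(a, b). F (a + b, a - b))"
    by (rule infsum_reindex_bij_witness[where i = "\<lambda>(a, b). (a + b, a - b)" and j = "\<lambda>(m, n). ((m + n) div 2, (m - n) div 2)"])
       (use half in \<open>auto simp: algebra_simps\<close>)
  moreover have "infsum F ?O = (\<Sum>\<^sub>\<infinity>(a, b). F (a + b + 1, a - b))"
    by (rule infsum_reindex_bij_witness[where i = "\<lambda>(a, b). (a + b + 1, a - b)" and j = "\<lambda>(m, n). ((m + n) div 2, (m - n) div 2)"])
       (use half' in \<open>auto simp: algebra_simps\<close>)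
  ultimately show ?thesis by metis
qed

lemma norm_square_less_one: "norm (q\<^sup>2) < 1" if "norm q < 1" for q :: complex
  using that by (simp add: norm_power power_less_one_iff)

lemma nat_square_add_nonneg: "0 \<le> n\<^sup>2 + n" for n :: int
proof -
  have "0 \<le> (n + 1) * n" by (cases "n \<ge> 0") (auto intro: mult_nonneg_nonneg mult_nonpos_nonpos)
  then show ?thesis by (simp add: power2_eq_square algebra_simps)
qed

lemma theta3_double:
  assumes q: "norm q < 1"
  shows "(theta3 q)\<^sup>2 = (theta3 (q\<^sup>2))\<^sup>2 + q * (theta2 (q\<^sup>2))\<^sup>2"
proof -
  let ?s = "\<lambda>n::int. nat (n\<^sup>2)" and ?p = "\<lambda>n::int. nat (n\<^sup>2 + n)"
  have q2: "norm (q\<^sup>2) < 1" using norm_square_less_one[OF q] .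
  have sp: "int (?s n) = n\<^sup>2" "int (?p n) = n\<^sup>2 + n" for n
    using nat_square_add_nonneg[of n] by auto
  let ?F = "\<lambda>(m, n). q ^ ?s m * q ^ ?s n"
  have F: "(\<lambda>x. norm (?F x)) summable_on UNIV"
    using abs_summable_on_product[OF theta3_summable[OF q] theta3_summable[OF q]] by simp
  have e1: "?F (a + b, a - b) = (q\<^sup>2) ^ ?s a * (q\<^sup>2) ^ ?s b" for a b
  proof -
    have "int (?s (a + b) + ?s (a - b)) = int (2 * ?s a + 2 * ?s b)"
      by (simp only: of_nat_add of_nat_mult of_nat_1 of_nat_numeral sp) (simp add: power2_eq_square algebra_simps)
    then have "?s (a + b) + ?s (a - b) = 2 * ?s a + 2 * ?s b" by (simp only: of_nat_eq_iff)
    then show ?thesis by (simp add: power_add[symmetric] power_mult[symmetric])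
  qed
  have e2: "?F (a + b + 1, a - b) = q * ((q\<^sup>2) ^ ?p a * (q\<^sup>2) ^ ?p b)" for a b
  proof -
    have "int (?s (a + b + 1) + ?s (a - b)) = int (1 + 2 * ?p a + 2 * ?p b)"
      by (simp only: of_nat_add of_nat_mult of_nat_1 of_nat_numeral sp) (simp add: power2_eq_square algebra_simps)
    then have "?s (a + b + 1) + ?s (a - b) = 1 + 2 * ?p a + 2 * ?p b" by (simp only: of_nat_eq_iff)
    then show ?thesis by (simp add: power_add[symmetric] power_mult[symmetric] power_Suc[symmetric] del: power_Suc)
  qed
  have "(theta3 q)\<^sup>2 = infsum ?F UNIV"
    unfolding theta3_def power2_eq_square[of "infsum _ _"] using infsum_product[OF theta3_summable[OF q] theta3_summable[OF q]] by simp
  also have "\<dots> = (\<Sum>\<^sub>\<infinity>(a, b). (q\<^sup>2) ^ ?s a * (q\<^sup>2) ^ ?s b) + (\<Sum>\<^sub>\<infinity>(a, b). q * ((q\<^sup>2) ^ ?p a * (q\<^sup>2) ^ ?p b))"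
    unfolding infsum_even_odd[OF F] e1 e2 ..
  also have "(\<Sum>\<^sub>\<infinity>(a, b). (q\<^sup>2) ^ ?s a * (q\<^sup>2) ^ ?s b) = (theta3 (q\<^sup>2))\<^sup>2"
    using infsum_product[OF theta3_summable[OF q2] theta3_summable[OF q2]]
    by (simp add: theta3_def power2_eq_square)
  also have "(\<Sum>\<^sub>\<infinity>(a, b). q * ((q\<^sup>2) ^ ?p a * (q\<^sup>2) ^ ?p b)) = q * (theta2 (q\<^sup>2))\<^sup>2"
  proof -
    have "(\<Sum>\<^sub>\<infinity>(a, b). q * ((q\<^sup>2) ^ ?p a * (q\<^sup>2) ^ ?p b)) = q * (\<Sum>\<^sub>\<infinity>(a, b). (q\<^sup>2) ^ ?p a * (q\<^sup>2) ^ ?p b)"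
      unfolding case_prod_unfold
      using abs_summable_summable[OF abs_summable_on_product[OF theta2_summable[OF q2] theta2_summable[OF q2]]]
      by (intro infsum_cmult_right) (simp add: case_prod_unfold)
    then show ?thesis
      using infsum_product[OF theta2_summable[OF q2] theta2_summable[OF q2]]
      by (simp add: theta2_def power2_eq_square[of "infsum _ _"])
  qed
  finally show ?thesis .
qed

text \<open>Both parity classes contribute the same product
  \<open>theta2 (q\<^sup>2) * theta3 (q\<^sup>2)\<close>, whence the factor 2.\<close>

lemma theta2_double:
  assumes q: "norm q < 1"
  shows "(theta2 q)\<^sup>2 = 2 * theta2 (q\<^sup>2) * theta3 (q\<^sup>2)"
proof -
  let ?s = "\<lambda>n::int. nat (n\<^sup>2)" and ?p = "\<lambda>n::int. nat (n\<^sup>2 + n)"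
  have q2: "norm (q\<^sup>2) < 1" using norm_square_less_one[OF q] .
  have sp: "int (?s n) = n\<^sup>2" "int (?p n) = n\<^sup>2 + n" for n
    using nat_square_add_nonneg[of n] by auto
  let ?F = "\<lambda>(m, n). q ^ ?p m * q ^ ?p n"
  let ?G = "\<lambda>(a, b). (q\<^sup>2) ^ ?s a * (q\<^sup>2) ^ ?p b"
  have F: "(\<lambda>x. norm (?F x)) summable_on UNIV"
    using abs_summable_on_product[OF theta2_summable[OF q] theta2_summable[OF q]] by simp
  have e1: "?F (a + b, a - b) = (q\<^sup>2) ^ ?p a * (q\<^sup>2) ^ ?s b" for a b
  proof -
    have "int (?p (a + b) + ?p (a - b)) = int (2 * ?p a + 2 * ?s b)"
      by (simp only: of_nat_add of_nat_mult of_nat_1 of_nat_numeral sp) (simp add: power2_eq_square algebra_simps)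
    then have "?p (a + b) + ?p (a - b) = 2 * ?p a + 2 * ?s b" by (simp only: of_nat_eq_iff)
    then show ?thesis by (simp add: power_add[symmetric] power_mult[symmetric])
  qed
  \<comment> \<open>Completing the square moves \<open>a\<close> by one; reindexing absorbs the
    shift below.\<close>
  have e2: "?F (a + b + 1, a - b) = ?G (a + 1, b)" for a b
  proof -
    have "int (?p (a + b + 1) + ?p (a - b)) = int (2 * ?s (a + 1) + 2 * ?p b)"
      by (simp only: of_nat_add of_nat_mult of_nat_1 of_nat_numeral sp) (simp add: power2_eq_square algebra_simps)
    then have "?p (a + b + 1) + ?p (a - b) = 2 * ?s (a + 1) + 2 * ?p b" by (simp only: of_nat_eq_iff)
    then show ?thesis by (simp add: power_add[symmetric] power_mult[symmetric])
  qed
  have "(theta2 q)\<^sup>2 = infsum ?F UNIV"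
    unfolding theta2_def power2_eq_square[of "infsum _ _"]
    using infsum_product[OF theta2_summable[OF q] theta2_summable[OF q]] by simp
  also have "\<dots> = (\<Sum>\<^sub>\<infinity>(a, b). (q\<^sup>2) ^ ?p a * (q\<^sup>2) ^ ?s b) + (\<Sum>\<^sub>\<infinity>(a, b). ?G (a + 1, b))"
    unfolding infsum_even_odd[OF F] e1 e2 ..
  also have "(\<Sum>\<^sub>\<infinity>(a, b). ?G (a + 1, b)) = infsum ?G UNIV"
    by (rule infsum_reindex_bij_witness[where i = "\<lambda>(a, b). (a - 1, b)" and j = "\<lambda>(a, b). (a + 1, b)"]) auto
  also have "\<dots> = theta3 (q\<^sup>2) * theta2 (q\<^sup>2)"
    using infsum_product[OF theta3_summable[OF q2] theta2_summable[OF q2]]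
    by (simp add: theta3_def theta2_def)
  also have "(\<Sum>\<^sub>\<infinity>(a, b). (q\<^sup>2) ^ ?p a * (q\<^sup>2) ^ ?s b) = theta2 (q\<^sup>2) * theta3 (q\<^sup>2)"
    using infsum_product[OF theta2_summable[OF q2] theta3_summable[OF q2]]
    by (simp add: theta3_def theta2_def)
  finally show ?thesis by simp
qed

lemma theta3_0: "theta3 0 = 1"
proof -
  have "theta3 0 = (\<Sum>\<^sub>\<infinity>n\<in>{0::int}. 0 ^ nat (n\<^sup>2))"
    unfolding theta3_def by (rule infsum_cong_neutral) auto
  then show ?thesis by simp
qed

lemma theta2_0: "theta2 0 = 2"
proof -
  have "nat (n\<^sup>2 + n) = 0 \<longleftrightarrow> n = 0 \<or> n = -1" for n :: int
  proof -
    have "nat (n\<^sup>2 + n) = 0 \<longleftrightarrow> n * (n + 1) = 0"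
      using nat_square_add_nonneg[of n] by (simp add: power2_eq_square algebra_simps)
    also have "\<dots> \<longleftrightarrow> n = 0 \<or> n = -1" by auto
    finally show ?thesis .
  qed
  then have "theta2 0 = (\<Sum>\<^sub>\<infinity>n\<in>{0::int, -1}. 0 ^ nat (n\<^sup>2 + n))"
    unfolding theta2_def by (intro infsum_cong_neutral) (auto simp: power_0_left)
  then show ?thesis by simp
qed

text \<open>\<open>theta3 (- q)\<close> is the classical theta_4. With A = theta3(q^2)^2 and B =
  theta2(q^2)^2 the doubling formulas turn the left side into (A + qB)^2 - (A - qB)^2 = 4qAB, and
  the square of \<open>theta2_double\<close> does the same for the right side.\<close>

lemma jacobi_quartic:
  assumes q: "norm q < 1"
  shows "theta3 q ^ 4 - theta3 (- q) ^ 4 = q * theta2 q ^ 4"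
proof -
  have a: "(theta3 q)\<^sup>2 = (theta3 (q\<^sup>2))\<^sup>2 + q * (theta2 (q\<^sup>2))\<^sup>2"
    and b: "(theta3 (-q))\<^sup>2 = (theta3 (q\<^sup>2))\<^sup>2 - q * (theta2 (q\<^sup>2))\<^sup>2"
    and c: "(theta2 q)\<^sup>2 = 2 * theta2 (q\<^sup>2) * theta3 (q\<^sup>2)"
    using theta3_double[of q] theta3_double[of "-q"] theta2_double[of q] q by auto
  have "x ^ 4 = (x\<^sup>2)\<^sup>2" for x :: complex by (simp flip: power_mult)
  then show ?thesis by (simp only: a b c) (simp add: power2_eq_square algebra_simps)
qed

section \<open>Nonvanishing of the theta constants\<close>

lemma tendsto_power_iterate:
  assumes "norm (q::complex) < 1"
  shows "(\<lambda>n. q ^ (2 ^ n)) \<longlonglongrightarrow> 0"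
proof -
  have "filterlim (\<lambda>n::nat. 2 ^ n :: nat) sequentially sequentially"
    by (rule filterlim_subseq) (auto intro!: strict_monoI)
  then show ?thesis
    using filterlim_compose[OF LIMSEQ_power_zero[OF assms], of "\<lambda>n. 2 ^ n"] by simp
qed

lemma norm_power_iterate: "norm (q ^ (2 ^ n)) < 1" if "norm q < 1" for q :: complex
  using that by (simp add: norm_power power_less_one_iff)

text \<open>This is the square of theta_4(q^2)^2 = theta_3(q) theta_4(q); fourth powers avoid the
  choice of a sign. It serves to move a zero of \<open>theta3\<close> towards the origin.\<close>

lemma theta3_neg_square:
  assumes q: "norm q < 1"
  shows "theta3 (- (q\<^sup>2)) ^ 4 = (theta3 q)\<^sup>2 * (theta3 (- q))\<^sup>2"
proof -
  have a: "(theta3 q)\<^sup>2 = (theta3 (q\<^sup>2))\<^sup>2 + q * (theta2 (q\<^sup>2))\<^sup>2"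
    and b: "(theta3 (-q))\<^sup>2 = (theta3 (q\<^sup>2))\<^sup>2 - q * (theta2 (q\<^sup>2))\<^sup>2"
    using theta3_double[of q] theta3_double[of "-q"] q by auto
  have c: "theta3 (- (q\<^sup>2)) ^ 4 = theta3 (q\<^sup>2) ^ 4 - q\<^sup>2 * theta2 (q\<^sup>2) ^ 4"
    using jacobi_quartic[OF norm_square_less_one[OF q]] by (simp add: algebra_simps)
  show ?thesis unfolding a b c by (simp add: power2_eq_square power4_eq_xxxx algebra_simps)
qed

lemma tendsto_at_power_iterate:
  assumes "f holomorphic_on ball 0 1" "norm (q::complex) < 1"
  shows "(\<lambda>n. f (q ^ (2 ^ n))) \<longlonglongrightarrow> f 0"
proof -
  have "isCont f 0"
    using assms(1) by (metis centre_in_ball continuous_on_eq_continuous_at holomorphic_on_imp_continuous_on open_ball zero_less_one)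
  then show ?thesis using tendsto_power_iterate[OF assms(2)] by (rule isCont_tendsto_compose)
qed

text \<open>A zero at q propagates to -q^(2^n) for all n >= 1. These points tend to 0, where the
  value is 1.\<close>

lemma theta3_nonzero:
  assumes q: "norm q < 1"
  shows "theta3 q \<noteq> 0"
proof
  assume z: "theta3 q = 0"
  have "theta3 (- (q ^ (2 ^ Suc n))) = 0" for n
  proof (induction n)
    case 0
    then show ?case using theta3_neg_square[OF q] z by simp
  next
    case (Suc n)
    then show ?case
      using theta3_neg_square[OF norm_power_iterate[OF q, of "Suc n"]]
      by (simp add: power_mult[symmetric] mult.commute)
  qed
  moreover have "(\<lambda>n. theta3 (- (q ^ (2 ^ n)))) \<longlonglongrightarrow> theta3 (- 0)"
    by (rule tendsto_at_power_iterate[OF _ q], rule holomorphic_on_compose_gen[of uminus _ theta3 "ball 0 1", unfolded o_def])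
       (auto intro!: holomorphic_intros theta3_holomorphic)
  then have "(\<lambda>n. theta3 (- (q ^ (2 ^ Suc n)))) \<longlonglongrightarrow> theta3 (- 0)"
    by (rule LIMSEQ_Suc)
  ultimately show False by (simp add: theta3_0 LIMSEQ_const_iff)
qed

lemma theta2_nonzero:
  assumes q: "norm q < 1"
  shows "theta2 q \<noteq> 0"
proof
  assume z: "theta2 q = 0"
  have "theta2 (q ^ (2 ^ n)) = 0" for n
  proof (induction n)
    case 0
    then show ?case using z by simp
  next
    case (Suc n)
    then show ?case
      using theta2_double[OF norm_power_iterate[OF q, of n]] theta3_nonzero[OF norm_power_iterate[OF q, of "Suc n"]]
      by (simp add: power_mult[symmetric] mult.commute)
  qed
  moreover have "(\<lambda>n. theta2 (q ^ (2 ^ n))) \<longlonglongrightarrow> theta2 0"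
    by (rule tendsto_at_power_iterate[OF theta2_holomorphic q])
  ultimately show False by (simp add: theta2_0 LIMSEQ_const_iff)
qed

text \<open>As \<open>theta2\<close> lacks the usual factor \<open>q\<^sup>1\<^sup>/\<^sup>4\<close>, \<open>lamq q\<close> is \<open>\<lambda>\<close> at the nome \<open>q\<close>; \<open>cmodq q\<close> is the
  complementary modulus at \<open>q\<close>, and \<open>kq q\<close> the modulus at \<open>q\<^sup>2\<close>.\<close>

definition lamq :: "complex \<Rightarrow> complex" where
  "lamq q = q * theta2 q ^ 4 / theta3 q ^ 4"

definition cmodq :: "complex \<Rightarrow> complex" where
  "cmodq q = (theta3 (- q))\<^sup>2 / (theta3 q)\<^sup>2"

definition kq :: "complex \<Rightarrow> complex" where
  "kq q = q * (theta2 (q\<^sup>2))\<^sup>2 / (theta3 (q\<^sup>2))\<^sup>2"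

lemma lamq_holomorphic: "lamq holomorphic_on ball 0 1"
  unfolding lamq_def[abs_def]
  by (intro holomorphic_intros theta2_holomorphic theta3_holomorphic) (auto simp: theta3_nonzero)

lemma kq_holomorphic: "kq holomorphic_on ball 0 1"
  unfolding kq_def[abs_def]
  by (intro holomorphic_intros holomorphic_on_compose_gen[of "\<lambda>q. q\<^sup>2" _ theta3 "ball 0 1", unfolded o_def]
      holomorphic_on_compose_gen[of "\<lambda>q. q\<^sup>2" _ theta2 "ball 0 1", unfolded o_def] theta2_holomorphic theta3_holomorphic)
     (auto simp: theta3_nonzero norm_square_less_one)

context
  fixes q :: complex
  assumes q: "norm q < 1"
begin

lemma lamq_eq: "lamq q = 1 - (cmodq q)\<^sup>2"
  using theta3_nonzero[OF q] unfolding lamq_def jacobi_quartic[OF q, symmetric] cmodq_def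
  by (simp add: power_divide power_mult[symmetric] diff_divide_distrib)

lemma cmodq_nonzero: "cmodq q \<noteq> 0"
  using theta3_nonzero[of q] theta3_nonzero[of "-q"] q by (simp add: cmodq_def)

lemma lamq_neq_1: "lamq q \<noteq> 1"
  using lamq_eq cmodq_nonzero by simp

lemma lamq_eq_0_iff: "lamq q = 0 \<longleftrightarrow> q = 0"
  using theta3_nonzero[OF q] theta2_nonzero[OF q] by (simp add: lamq_def)

lemma kq_square: "(kq q)\<^sup>2 = lamq (q\<^sup>2)"
  by (simp add: lamq_def kq_def power_divide power_mult_distrib power_mult[symmetric])

lemma kq_neq_minus_1: "1 + kq q \<noteq> 0"
proof -
  have "(theta3 q)\<^sup>2 = (theta3 (q\<^sup>2))\<^sup>2 * (1 + kq q)"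
    unfolding theta3_double[OF q] kq_def
    using theta3_nonzero[OF norm_square_less_one[OF q]] by (simp add: field_simps)
  then show ?thesis using theta3_nonzero[OF q] by auto
qed

text \<open>Landen's transformation: the complementary modulus at q is the Cayley transform of the
  modulus at q^2.\<close>

lemma cmodq_eq: "cmodq q = (1 - kq q) / (1 + kq q)"
proof -
  have a: "(theta3 q)\<^sup>2 = (theta3 (q\<^sup>2))\<^sup>2 * (1 + kq q)" "(theta3 (-q))\<^sup>2 = (theta3 (q\<^sup>2))\<^sup>2 * (1 - kq q)"
    using theta3_double[of q] theta3_double[of "-q"] q theta3_nonzero[OF norm_square_less_one[OF q]]
    by (simp_all add: kq_def algebra_simps del: theta3_nonzero)
  show ?thesis
    unfolding cmodq_def a using theta3_nonzero[OF norm_square_less_one[OF q]] by simp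
qed

lemma lamq_eq_kq: "lamq q = 4 * kq q / (1 + kq q)\<^sup>2"
  unfolding lamq_eq cmodq_eq using kq_neq_minus_1
  by (simp add: power_divide field_simps) (simp add: power2_eq_square algebra_simps)

end

text \<open>The sign change swaps the two theta constants in \<open>cmodq\<close>, so the
  complementary modulus is inverted. On the half-plane this becomes the translation by 1.\<close>

lemma lamq_minus:
  assumes q: "norm q < 1"
  shows "lamq (- q) = lamq q / (lamq q - 1)"
proof -
  have "cmodq (- q) = 1 / cmodq q" by (simp add: cmodq_def)
  then have "lamq (- q) = 1 - 1 / (cmodq q)\<^sup>2"
    using lamq_eq[of "- q"] q by (simp add: power_divide)
  then show ?thesis
    unfolding lamq_eq[OF q] using cmodq_nonzero[OF q] by (simp add: divide_simps)
qed

lemma lamq_0: "lamq 0 = 0" by (simp add: lamq_def)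

lemma deriv_lamq_0: "deriv lamq 0 = 16"
proof -
  have h: "(\<lambda>q. theta2 q ^ 4 / theta3 q ^ 4) holomorphic_on ball 0 1"
    by (intro holomorphic_intros theta2_holomorphic theta3_holomorphic) (auto simp: theta3_nonzero)
  then have "((\<lambda>q. theta2 q ^ 4 / theta3 q ^ 4) has_field_derivative deriv (\<lambda>q. theta2 q ^ 4 / theta3 q ^ 4) 0) (at 0)"
    by (rule holomorphic_derivI) auto
  from DERIV_mult[OF DERIV_ident this] show ?thesis
    by (intro DERIV_imp_deriv) (simp add: lamq_def[abs_def] theta2_0 theta3_0)
qed

section \<open>Local sections of the modular function\<close>

text \<open>Harnack's inequality for -log |h|, by way of Schwarz's lemma: h = exp g with g mapping
  into the left half-plane, and the Cayley transform centred at g(0) turns g into a self-map of the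
  disc fixing 0. Smallness at the centre thus spreads to compact subdiscs.\<close>

lemma nonvanishing_decay:
  fixes h :: "complex \<Rightarrow> complex"
  assumes h: "h holomorphic_on ball 0 1" "\<And>z. norm z < 1 \<Longrightarrow> h z \<noteq> 0" "\<And>z. norm z < 1 \<Longrightarrow> norm (h z) < 1"
    and z: "norm z < 1"
  shows "norm (h z) \<le> norm (h 0) powr ((1 - norm z) / (1 + norm z))"
proof -
  obtain g where g: "g holomorphic_on ball 0 1" and hg: "\<And>w. w \<in> ball 0 1 \<Longrightarrow> h w = exp (g w)"
    using contractible_imp_holomorphic_log[OF h(1) convex_imp_contractible[OF convex_ball]] h(2) by (metis mem_ball_0)
  have neg: "Re (g w) < 0" if "norm w < 1" for w
  proof -
    have "norm (exp (g w)) < 1" using h(3)[OF that] hg[of w] that by simp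
    then show ?thesis by simp
  qed
  have g0: "Re (g 0) < 0" by (rule neg) simp
  have nz: "g w + cnj (g 0) \<noteq> 0" if "norm w < 1" for w
    using neg[OF that] g0 by (auto simp: complex_eq_iff)
  let ?w = "\<lambda>z. (g z - g 0) / (g z + cnj (g 0))"
  have "norm (?w z) \<le> norm z"
  proof (rule Schwarz_Lemma(1))
    show "?w holomorphic_on ball 0 1"
      using nz by (intro holomorphic_intros g) auto
    show "norm (?w u) < 1" if "norm u < 1" for u
    proof -
      have "Re (g u) * Re (g 0) > 0" using neg[OF that] g0 by (rule mult_neg_neg)
      then have "(norm (g u - g 0))\<^sup>2 < (norm (g u + cnj (g 0)))\<^sup>2"
        unfolding cmod_power2 by (simp add: power2_eq_square algebra_simps)
      then have "norm (g u - g 0) < norm (g u + cnj (g 0))" by (rule power2_less_imp_less) simp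
      then show ?thesis using nz[OF that] by (simp add: norm_divide)
    qed
  qed (use z in auto)
  then have "norm (g z - g 0) \<le> norm z * norm (g z + cnj (g 0))"
    using nz[OF z] by (simp add: norm_divide divide_simps)
  then have "(norm (g z - g 0))\<^sup>2 \<le> (norm z * norm (g z + cnj (g 0)))\<^sup>2" by (rule power_mono) simp
  then have sq: "(Re (g z) - Re (g 0))\<^sup>2 + (Im (g z) - Im (g 0))\<^sup>2
      \<le> (norm z)\<^sup>2 * ((Re (g z) + Re (g 0))\<^sup>2 + (Im (g z) - Im (g 0))\<^sup>2)"
    by (simp add: power_mult_distrib cmod_power2)
  have "(norm z)\<^sup>2 * (Im (g z) - Im (g 0))\<^sup>2 \<le> 1 * (Im (g z) - Im (g 0))\<^sup>2"
    using z by (intro mult_right_mono) (auto simp: power_le_one)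
  with sq have "(Re (g z) - Re (g 0))\<^sup>2 \<le> (norm z)\<^sup>2 * (Re (g z) + Re (g 0))\<^sup>2"
    unfolding distrib_left by linarith
  then have "(Re (g z) - Re (g 0))\<^sup>2 \<le> (norm z * (Re (g z) + Re (g 0)))\<^sup>2"
    by (simp only: power_mult_distrib)
  then have "\<bar>Re (g z) - Re (g 0)\<bar> \<le> \<bar>norm z * (Re (g z) + Re (g 0))\<bar>" by (simp add: abs_le_square_iff)
  also have "\<dots> = - norm z * (Re (g z) + Re (g 0))"
  proof -
    have "norm z * (Re (g z) + Re (g 0)) \<le> 0"
      using neg[OF z] g0 by (intro mult_nonneg_nonpos) auto
    then show ?thesis by simp
  qed
  finally have "(1 + norm z) * Re (g z) \<le> (1 - norm z) * Re (g 0)" by (simp add: algebra_simps)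
  moreover have "0 < 1 + norm z" using norm_ge_zero[of z] by linarith
  ultimately have "Re (g z) \<le> (1 - norm z) / (1 + norm z) * Re (g 0)" by (simp add: field_simps)
  then have "exp (Re (g z)) \<le> exp ((1 - norm z) / (1 + norm z) * Re (g 0))" by simp
  then show ?thesis using hg[of z] hg[of 0] z by (simp add: powr_def)
qed

text \<open>Schottky's theorem bounds every such f by one constant C on a smaller disc once the
  central value is at most 1. Then f/C has no zeros and stays below 1, so
  \<open>nonvanishing_decay\<close> applies. The point is that d is uniform in f.\<close>

lemma omits_01_small:
  assumes r: "0 < r" and e: "0 < e"
  obtains d :: real where "0 < d"
    "\<And>f z. f holomorphic_on ball z0 r \<Longrightarrow> (\<And>w. w \<in> ball z0 r \<Longrightarrow> f w \<noteq> 0 \<and> f w \<noteq> 1) \<Longrightarrow>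
       norm (f z0) < d \<Longrightarrow> z \<in> cball z0 (r / 2) \<Longrightarrow> norm (f z) < e"
proof -
  \<comment> \<open>Schottky's bound for central value at most 1 and radius 8/9; the added 1 makes
    it strict.\<close>
  define C where "C = exp (pi * exp (pi * (2 + 2 * 1 + 12 * (8/9) / (1 - 8/9)))) + 1"
  have C: "C > 1" by (simp add: C_def)
  \<comment> \<open>The disc shrinks by 9/10, to obtain a closed disc, and then by 8/9, so a point
    at distance r/2 has relative distance at most 5/8. As (1 - 5/8)/(1 + 5/8) = 3/13, the power 13/3
    cancels the exponent of the decay.\<close>
  define d where "d = min 1 (C * (e / C) powr (13/3))"
  show ?thesis
  proof
    show "0 < d" using e C by (simp add: d_def)
    fix f z
    assume f: "f holomorphic_on ball z0 r" "\<And>w. w \<in> ball z0 r \<Longrightarrow> f w \<noteq> 0 \<and> f w \<noteq> 1"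
      and fd: "norm (f z0) < d" and z: "z \<in> cball z0 (r / 2)"
    define F where "F w = f (z0 + of_real (9/10 * r) * w)" for w
    have im: "z0 + of_real (9/10 * r) * w \<in> ball z0 r" if "norm w \<le> 1" for w
    proof -
      have "9/10 * r * norm w \<le> 9/10 * r * 1" using that r by (intro mult_left_mono) auto
      then show ?thesis using r by (simp add: dist_norm norm_mult)
    qed
    have Fh: "F holomorphic_on cball 0 1"
      unfolding F_def
      by (rule holomorphic_on_compose_gen[OF _ f(1), unfolded o_def]) (use im in \<open>auto intro!: holomorphic_intros\<close>)
    have Fb: "norm (F w) < C" if "norm w \<le> 8/9" for w
    proof -
      have "norm (F w) \<le> exp (pi * exp (pi * (2 + 2 * 1 + 12 * (8/9) / (1 - 8/9))))"
      proof (rule Schottky[OF Fh])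
        show "norm (F 0) \<le> 1" using fd by (simp add: F_def d_def)
        show "\<not> (F z = 0 \<or> F z = 1)" if "z \<in> cball 0 1" for z
          using f(2)[OF im[of z]] that by (simp add: F_def)
      qed (use that in auto)
      then show ?thesis unfolding C_def by simp
    qed
    define h where "h w = F (of_real (8/9) * w) / C" for w
    define u where "u = (z - z0) / of_real (8/10 * r)"
    have nu: "norm u \<le> 5/8"
    proof -
      have "norm u = norm (z - z0) / (8/10 * r)"
        unfolding u_def norm_divide norm_of_real using r by simp
      moreover have "norm (z - z0) \<le> r / 2" using z by (simp add: dist_norm norm_minus_commute)
      ultimately have "norm u \<le> (r / 2) / (8/10 * r)" using r by (simp only:) (intro divide_right_mono, auto)
      then show ?thesis using r by simp
    qed
    have b89: "norm (of_real (8/9) * w) \<le> 8/9" if "norm w < 1" for w :: complex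
      using that unfolding norm_mult norm_of_real by simp
    have "norm (h u) \<le> norm (h 0) powr ((1 - norm u) / (1 + norm u))"
    proof (rule nonvanishing_decay)
      show "h holomorphic_on ball 0 1"
        unfolding h_def using C b89
        by (intro holomorphic_intros holomorphic_on_compose_gen[OF _ Fh, unfolded o_def])
           (auto simp: less_imp_le intro: order_trans[OF b89])
      show "h w \<noteq> 0" if "norm w < 1" for w
        using f(2)[OF im[of "of_real (8/9) * w"]] b89[OF that] C by (simp add: h_def F_def)
      show "norm (h w) < 1" if "norm w < 1" for w
        using Fb[OF b89[OF that]] C by (simp add: h_def norm_divide)
    qed (use nu in auto)
    also have "\<dots> \<le> norm (h 0) powr (3/13)"
    proof -
      have "norm (h 0) \<le> 1" using Fb[of 0] C by (simp add: h_def norm_divide)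
      moreover have "3/13 \<le> (1 - norm u) / (1 + norm u)"
        using nu norm_ge_zero[of u] by (simp add: divide_simps del: norm_ge_zero)
      ultimately show ?thesis by (intro powr_mono') auto
    qed
    also have "\<dots> < ((e / C) powr (13/3)) powr (3/13)"
    proof (rule powr_less_mono2)
      have "norm (f z0) < C * (e / C) powr (13/3)" using fd by (simp add: d_def)
      then show "norm (h 0) < (e / C) powr (13/3)" using C by (simp add: h_def F_def norm_divide field_simps)
    qed auto
    also have "\<dots> = e / C" using e C by (simp add: powr_powr)
    finally have "norm (h u) < e / C" .
    moreover have "h u = f z / C"
    proof -
      have "of_real (9/10 * r) * (of_real (8/9) * u) = z - z0"
        using r unfolding u_def by (simp add: field_simps)
      then have "z0 + of_real (9/10 * r) * (of_real (8/9) * u) = z" by (simp only: add_diff_cancel_left' diff_add_cancel add.commute[of z0])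
      then show ?thesis by (simp only: h_def F_def)
    qed
    ultimately show "norm (f z) < e" using C by (simp add: norm_divide divide_strict_right_mono field_simps)
  qed
qed

section \<open>Lifting through Landen's transformation\<close>

lemma square_eq_imp_eq_on_connected:
  fixes f g :: "'a::topological_space \<Rightarrow> complex"
  assumes S: "connected S" "continuous_on S f" "continuous_on S g"
    and nz: "\<And>x. x \<in> S \<Longrightarrow> g x \<noteq> 0" and sq: "\<And>x. x \<in> S \<Longrightarrow> (f x)\<^sup>2 = (g x)\<^sup>2"
    and a: "a \<in> S" "f a = g a" and x: "x \<in> S"
  shows "f x = g x"
proof -
  have c: "continuous_on S (\<lambda>x. f x / g x)" using S nz by (intro continuous_intros) auto
  have "(\<lambda>x. f x / g x) ` S \<subseteq> {1, -1}"
  proof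
    fix y assume "y \<in> (\<lambda>x. f x / g x) ` S"
    then have "y\<^sup>2 = 1" using sq nz by (auto simp: power_divide)
    then show "y \<in> {1, -1}" by (auto simp: power2_eq_1_iff)
  qed
  then have "finite ((\<lambda>x. f x / g x) ` S)" by (rule finite_subset) simp
  then have "(\<lambda>x. f x / g x) constant_on S"
    using continuous_finite_range_constant[OF S(1) c] by blast
  then obtain k where k: "\<And>x. x \<in> S \<Longrightarrow> f x / g x = k" by (auto simp: constant_on_def)
  from k[OF a(1)] a nz have "k = 1" by simp
  with k[OF x] nz[OF x] show ?thesis by simp
qed

definition uhp :: "complex set" where "uhp = {t. Im t > 0}"

definition lam :: "complex \<Rightarrow> complex" where "lam t = lamq (exp (\<i> * pi * t))"

lemma norm_nome: "norm (exp (\<i> * pi * t)) < 1 \<longleftrightarrow> t \<in> uhp"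
  by (simp add: uhp_def zero_less_mult_iff)

lemma open_uhp: "open uhp" and convex_uhp: "convex uhp"
  unfolding uhp_def by (simp_all add: open_halfspace_Im_gt convex_halfspace_Im_gt)

lemma lam_holomorphic: "lam holomorphic_on uhp"
  unfolding lam_def[abs_def]
  by (rule holomorphic_on_compose_gen[OF _ lamq_holomorphic, unfolded o_def])
     (use norm_nome in \<open>auto intro!: holomorphic_intros\<close>)

lemma lam_omits: "t \<in> uhp \<Longrightarrow> lam t \<noteq> 0 \<and> lam t \<noteq> 1"
  using norm_nome[of t] by (simp add: lam_def lamq_eq_0_iff lamq_neq_1)

lemma cayley_involution: "(1 - (1 - a) / (1 + a)) / (1 + (1 - a) / (1 + a)) = a" if "1 + a \<noteq> 0" for a :: complex
proof -
  have "1 - (1 - a) / (1 + a) = 2 * a / (1 + a)" "1 + (1 - a) / (1 + a) = 2 / (1 + a)"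
    using that by (simp_all add: diff_divide_eq_iff add_divide_eq_iff)
  then show ?thesis using that by simp
qed

text \<open>\<open>f n z\<close> is what lambda(2^n t) would be along a lift t of z, built before
  any lift is available. On a disc 1 - f n has no zeros and hence a holomorphic square root;
  \<open>x n\<close> is the branch that equals the complementary modulus at the centre, and Landen's
  formula yields the next function.\<close>

lemma landen_sequence:
  assumes r: "0 < r" and z0: "ball z0 r \<subseteq> - {0, 1}" and q: "norm q < 1" "q \<noteq> 0" "lamq q = z0"
  obtains f x :: "nat \<Rightarrow> complex \<Rightarrow> complex" where
    "\<And>z. f 0 z = z"
    "\<And>n. f n holomorphic_on ball z0 r" "\<And>n z. z \<in> ball z0 r \<Longrightarrow> f n z \<noteq> 0 \<and> f n z \<noteq> 1"
    "\<And>n. f n z0 = lamq (q ^ (2 ^ n))"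
    "\<And>n. x n holomorphic_on ball z0 r" "\<And>n z. z \<in> ball z0 r \<Longrightarrow> (x n z)\<^sup>2 = 1 - f n z"
    "\<And>n. x n z0 = cmodq (q ^ (2 ^ n))" "\<And>n z. f (Suc n) z = ((1 - x n z) / (1 + x n z))\<^sup>2"
proof -
  let ?B = "ball z0 r"
  let ?P = "\<lambda>n f. (n = 0 \<longrightarrow> f = (\<lambda>z. z)) \<and> f holomorphic_on ?B \<and> (\<forall>z\<in>?B. f z \<noteq> 0 \<and> f z \<noteq> 1) \<and> f z0 = lamq (q ^ (2 ^ n))"
  let ?Q = "\<lambda>n f f'. \<exists>x. x holomorphic_on ?B \<and> (\<forall>z\<in>?B. (x z)\<^sup>2 = 1 - f z) \<and>
     x z0 = cmodq (q ^ (2 ^ n)) \<and> f' = (\<lambda>z. ((1 - x z) / (1 + x z))\<^sup>2)"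
  have c: "z0 \<in> ?B" using r by simp
  have "\<exists>f. \<forall>n. ?P n (f n) \<and> ?Q n (f n) (f (Suc n))"
  proof (rule dependent_nat_choice)
    show "\<exists>f. ?P 0 f"
      using z0 q by (intro exI[of _ "\<lambda>z. z"]) auto
    fix f n
    assume P: "?P n f"
    have qn: "norm (q ^ (2 ^ n)) < 1" using norm_power_iterate[OF q(1)] .
    have "(\<lambda>z. 1 - f z) holomorphic_on ?B" "\<And>z. z \<in> ?B \<Longrightarrow> 1 - f z \<noteq> 0"
      using P by (auto intro!: holomorphic_intros)
    then obtain y where y: "y holomorphic_on ?B" "\<And>z. z \<in> ?B \<Longrightarrow> 1 - f z = (y z)\<^sup>2"
      using contractible_imp_holomorphic_sqrt[OF _ convex_imp_contractible[OF convex_ball]] by metis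
    have "(y z0)\<^sup>2 = (cmodq (q ^ (2 ^ n)))\<^sup>2"
      using P y(2)[OF c] lamq_eq[OF qn] by simp
    then obtain s where s: "s = 1 \<or> s = -1" "s * y z0 = cmodq (q ^ (2 ^ n))"
      by (metis mult_1 mult_minus1 power2_eq_iff add.inverse_inverse)
    define x where "x z = s * y z" for z
    have s2: "s\<^sup>2 = 1" using s(1) by auto
    have x: "x holomorphic_on ?B" "\<And>z. z \<in> ?B \<Longrightarrow> (x z)\<^sup>2 = 1 - f z" "x z0 = cmodq (q ^ (2 ^ n))"
      using y s s2 unfolding x_def by (auto intro!: holomorphic_intros simp: power_mult_distrib)
    have x1: "1 + x z \<noteq> 0" "1 - x z \<noteq> 0" "x z \<noteq> 0" if "z \<in> ?B" for z
    proof -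
      have "x z \<noteq> 1 \<and> x z \<noteq> -1 \<and> x z \<noteq> 0" using P that x(2)[OF that] by (auto simp: power2_eq_1_iff)
      then show "1 + x z \<noteq> 0" "1 - x z \<noteq> 0" "x z \<noteq> 0"
        by (auto simp: add_eq_0_iff)
    qed
    have sq: "((1 - x z) / (1 + x z))\<^sup>2 \<noteq> 1" if "z \<in> ?B" for z
    proof
      assume "((1 - x z) / (1 + x z))\<^sup>2 = 1"
      then have "(1 - x z)\<^sup>2 = (1 + x z)\<^sup>2" using x1[OF that] by (simp add: power_divide)
      moreover have "(1 + x z)\<^sup>2 - (1 - x z)\<^sup>2 = 4 * x z" by (simp add: power2_eq_square algebra_simps)
      ultimately show False using x1[OF that] by simp
    qed
    define f' where "f' = (\<lambda>z. ((1 - x z) / (1 + x z))\<^sup>2)"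
    have "f' z0 = lamq (q ^ (2 ^ Suc n))"
    proof -
      have "kq (q ^ (2 ^ n)) = (1 - cmodq (q ^ (2 ^ n))) / (1 + cmodq (q ^ (2 ^ n)))"
        unfolding cmodq_eq[OF qn] using cayley_involution[OF kq_neq_minus_1[OF qn]] by simp
      then have "f' z0 = (kq (q ^ (2 ^ n)))\<^sup>2" by (simp add: f'_def x(3))
      also have "\<dots> = lamq (q ^ (2 ^ Suc n))"
        using kq_square[OF qn] by (simp add: power_mult[symmetric] mult.commute)
      finally show ?thesis .
    qed
    moreover have "f' holomorphic_on ?B"
      unfolding f'_def using x1(1) by (intro holomorphic_intros x(1)) auto
    moreover have "\<forall>z\<in>?B. f' z \<noteq> 0 \<and> f' z \<noteq> 1"
      using x1 sq unfolding f'_def by simp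
    ultimately have "?P (Suc n) f'" by simp
    moreover have "?Q n f f'" using x f'_def by blast
    ultimately show "\<exists>f'. ?P (Suc n) f' \<and> ?Q n f f'" by blast
  qed
  then obtain f where f: "\<And>n. ?P n (f n)" "\<And>n. ?Q n (f n) (f (Suc n))" by blast
  let ?R = "\<lambda>n x. x holomorphic_on ?B \<and> (\<forall>z\<in>?B. (x z)\<^sup>2 = 1 - f n z) \<and>
     x z0 = cmodq (q ^ (2 ^ n)) \<and> f (Suc n) = (\<lambda>z. ((1 - x z) / (1 + x z))\<^sup>2)"
  have "\<forall>n. \<exists>x. ?R n x" using f(2) by blast
  then obtain x where x: "\<forall>n. ?R n (x n)" by (rule choice[THEN exE])
  show ?thesis
    by (rule that[of f x]) (use f(1) x in auto)
qed

text \<open>The derivative 16 at 0 makes \<open>lamq\<close> injective on a small disc of nomes, and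
  e is chosen so small that every value below e is attained there.\<close>

lemma lamq_local_inverse:
  obtains d e :: real and Q where "0 < d" "d \<le> 1" "0 < e" "Q holomorphic_on ball 0 e"
    "\<And>q. norm q < d \<Longrightarrow> norm (lamq q) < e \<Longrightarrow> Q (lamq q) = q"
    "\<And>z. norm z < e \<Longrightarrow> norm (Q z) < d \<and> lamq (Q z) = z"
proof -
  have c: "(0::complex) \<in> ball 0 1" and nz: "deriv lamq 0 \<noteq> 0" by (simp_all add: deriv_lamq_0)
  obtain d where d: "d > 0" "ball (0::complex) d \<subseteq> ball 0 1" "open (lamq ` ball 0 d)" "inj_on lamq (ball 0 d)"
    by (rule has_complex_derivative_locally_invertible[OF lamq_holomorphic c open_ball nz]) (rule that)
  obtain Q where Q: "Q holomorphic_on (lamq ` ball 0 d)" "\<And>z. z \<in> ball 0 d \<Longrightarrow> Q (lamq z) = z"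
    using holomorphic_has_inverse[OF holomorphic_on_subset[OF lamq_holomorphic d(2)] open_ball d(4)] by metis
  have "0 \<in> lamq ` ball 0 d" using d(1) lamq_0 by (metis centre_in_ball image_eqI)
  then obtain e where e: "e > 0" "ball 0 e \<subseteq> lamq ` ball 0 d"
    using d(3) open_contains_ball by metis
  show ?thesis
  proof (rule that[of d e Q])
    show "d \<le> 1"
    proof (rule ccontr)
      assume "\<not> d \<le> 1"
      then have "(1::complex) \<in> ball 0 d" by simp
      then have "(1::complex) \<in> ball 0 1" using d(2) by (rule subsetD[rotated])
      then show False by simp
    qed
    show "norm (Q z) < d \<and> lamq (Q z) = z" if "norm z < e" for z
    proof -
      from that e(2) obtain w where "w \<in> ball 0 d" "z = lamq w" by (metis imageE mem_ball_0 subsetD)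
      then show ?thesis using Q(2) by auto
    qed
  qed (use d e Q in \<open>auto intro: holomorphic_on_subset\<close>)
qed

text \<open>Far along the Landen sequence \<open>f N\<close> is uniformly small on the half disc, so
  \<open>Q (f N z)\<close> can serve as the nome of 2^N t. A logarithm divided by 2^N gives the
  candidate \<open>s\<close>, and the relation is carried back from level N to level 0, where it
  says that \<open>s\<close> is a section.\<close>

lemma lam_section:
  assumes r: "0 < r" and z0: "ball z0 r \<subseteq> - {0, 1}" and t: "t \<in> uhp" "lam t = z0"
  obtains s where "s holomorphic_on ball z0 (r / 2)" "s z0 = t"
    "\<And>z. z \<in> ball z0 (r / 2) \<Longrightarrow> s z \<in> uhp \<and> lam (s z) = z"
proof -
  define q where "q = exp (\<i> * pi * t)"
  have q: "norm q < 1" "q \<noteq> 0" "lamq q = z0" using t norm_nome[of t] by (auto simp: q_def lam_def)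
  let ?D = "ball z0 r" and ?E = "ball z0 (r / 2)"
  obtain f x where f: "\<And>z. f 0 z = z"
    "\<And>n. f n holomorphic_on ball z0 r" "\<And>n z. z \<in> ball z0 r \<Longrightarrow> f n z \<noteq> 0 \<and> f n z \<noteq> 1"
    "\<And>n. f n z0 = lamq (q ^ (2 ^ n))"
    "\<And>n. x n holomorphic_on ball z0 r" "\<And>n z. z \<in> ball z0 r \<Longrightarrow> (x n z)\<^sup>2 = 1 - f n z"
    "\<And>n. x n z0 = cmodq (q ^ (2 ^ n))" "\<And>n z. f (Suc n) z = ((1 - x n z) / (1 + x n z))\<^sup>2"
    using landen_sequence[OF r z0 q] by metis
  have sub: "z \<in> ?D" if "z \<in> ?E" for z using that r by simp
  have c: "z0 \<in> ?E" using r by simp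
  obtain d e Q where Q: "0 < d" "d \<le> 1" "0 < e" "Q holomorphic_on ball 0 e"
    "\<And>q. norm q < d \<Longrightarrow> norm (lamq q) < e \<Longrightarrow> Q (lamq q) = q"
    "\<And>z. norm z < e \<Longrightarrow> norm (Q z) < d \<and> lamq (Q z) = z"
    using lamq_local_inverse by metis
  obtain d' where d': "0 < d'"
    "\<And>f z. f holomorphic_on ball z0 r \<Longrightarrow> (\<And>w. w \<in> ball z0 r \<Longrightarrow> f w \<noteq> 0 \<and> f w \<noteq> 1) \<Longrightarrow>
       norm (f z0) < d' \<Longrightarrow> z \<in> cball z0 (r / 2) \<Longrightarrow> norm (f z) < e"
    using omits_01_small[OF r Q(3)] by metis
  have "\<forall>\<^sub>F n in sequentially. norm (q ^ (2 ^ n)) < d"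
    using tendsto_norm[OF tendsto_power_iterate[OF q(1)]] Q(1) by (intro order_tendstoD(2)) auto
  moreover have "\<forall>\<^sub>F n in sequentially. norm (f n z0) < d'"
    using tendsto_norm[OF tendsto_at_power_iterate[OF lamq_holomorphic q(1)]] d'(1)
    unfolding f(4) by (intro order_tendstoD(2)) (auto simp: lamq_0)
  ultimately have "\<forall>\<^sub>F n in sequentially. norm (q ^ (2 ^ n)) < d \<and> norm (f n z0) < d'"
    by (rule eventually_conj)
  from eventually_happens'[OF sequentially_bot this] obtain N where
    N: "norm (q ^ (2 ^ N)) < d" "norm (f N z0) < d'" by blast
  have fN: "norm (f N z) < e" if "z \<in> ?E" for z
    using that by (intro d'(2)[OF f(2) f(3) N(2)]) auto
  have hQ: "(\<lambda>z. Q (f N z)) holomorphic_on ?E"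
    by (rule holomorphic_on_compose_gen[OF holomorphic_on_subset[OF f(2)] Q(4), unfolded o_def])
       (use sub fN in auto)
  have nzQ: "Q (f N z) \<noteq> 0" if "z \<in> ?E" for z
  proof
    assume "Q (f N z) = 0"
    then have "f N z = 0" using Q(6)[OF fN[OF that]] lamq_0 by simp
    then show False using f(3)[OF sub[OF that]] by simp
  qed
  obtain h where h: "h holomorphic_on ?E" "\<And>z. z \<in> ?E \<Longrightarrow> Q (f N z) = exp (h z)"
    using contractible_imp_holomorphic_log[OF hQ convex_imp_contractible[OF convex_ball]] nzQ by metis
  have "exp (h z0) = q ^ (2 ^ N)"
    using h(2)[OF c] Q(5)[OF N(1)] fN[OF c] f(4)[of N] by simp
  also have "\<dots> = exp (2 ^ N * (\<i> * pi * t))"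
    unfolding q_def by (simp add: exp_of_nat_mult[symmetric])
  finally obtain m :: int where m: "h z0 = 2 ^ N * (\<i> * pi * t) + complex_of_real (of_int (2 * m) * pi) * \<i>"
    unfolding exp_eq by auto
  \<comment> \<open>Subtracting the period normalises the logarithm so that
    \<open>s z0 = t\<close>.\<close>
  define s where "s z = (h z - complex_of_real (of_int (2 * m) * pi) * \<i>) / (2 ^ N * (\<i> * pi))" for z
  define E where "E z = exp (\<i> * pi * s z)" for z
  have s: "s holomorphic_on ?E" unfolding s_def by (intro holomorphic_intros h) auto
  have s0: "s z0 = t" by (simp add: s_def m)
  have EN: "E z ^ (2 ^ N) = Q (f N z)" if "z \<in> ?E" for z
  proof -
    have "E z ^ (2 ^ N) = exp (2 ^ N * (\<i> * pi * s z))"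
      unfolding E_def by (simp add: exp_of_nat_mult[symmetric])
    also have "2 ^ N * (\<i> * pi * s z) = h z - complex_of_real (of_int (2 * m) * pi) * \<i>"
      by (simp add: s_def)
    also have "exp \<dots> = exp (h z)"
      unfolding exp_eq by (intro exI[of _ "-m"]) simp
    finally show ?thesis using h(2)[OF that] by simp
  qed
  have E1: "norm (E z) < 1" if "z \<in> ?E" for z
  proof -
    have "norm (E z) ^ (2 ^ N) < 1"
      using Q(6)[OF fN[OF that]] Q(2) EN[OF that] by (simp add: norm_power[symmetric])
    then show ?thesis by (simp add: power_less_one_iff)
  qed
  have Eh: "E holomorphic_on ?E" unfolding E_def by (intro holomorphic_intros s)
  have E0: "E z0 = q" by (simp add: E_def s0 q_def)
  have Enz: "E z \<noteq> 0" for z by (simp add: E_def)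
  \<comment> \<open>Descent from level N, written as an induction on the number k of levels
    descended; once k reaches N the truncated subtraction leaves the level at 0.\<close>
  have P: "\<forall>z\<in>?E. lamq (E z ^ (2 ^ (N - k))) = f (N - k) z" for k
  proof (induction k)
    case 0
    then show ?case using EN Q(6) fN by simp
  next
    case (Suc k)
    show ?case
    proof (cases "k < N")
      case False
      then show ?thesis using Suc by simp
    next
      case True
      define n where "n = N - Suc k"
      have n: "N - k = Suc n" using True by (simp add: n_def)
      have qn: "norm (E z ^ (2 ^ n)) < 1" if "z \<in> ?E" for z using norm_power_iterate[OF E1[OF that]] .
      have ph: "(\<lambda>z. E z ^ (2 ^ n)) holomorphic_on ?E" by (intro holomorphic_intros Eh)
      let ?k = "\<lambda>z. (1 - x n z) / (1 + x n z)"
      have x1: "1 + x n z \<noteq> 0" if "z \<in> ?E" for z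
        using f(3)[OF sub[OF that], of "n"] f(6)[OF sub[OF that], of n] by (auto simp: add_eq_0_iff power2_eq_1_iff)
      \<comment> \<open>Both sides are square roots of \<open>f (Suc n) z\<close>; agreement at the
        centre fixes the sign on the whole disc.\<close>
      have k: "kq (E z ^ (2 ^ n)) = ?k z" if z: "z \<in> ?E" for z
      proof (rule square_eq_imp_eq_on_connected[where S = ?E and a = z0 and f = "\<lambda>z. kq (E z ^ (2 ^ n))" and g = ?k])
        show "continuous_on ?E (\<lambda>z. kq (E z ^ (2 ^ n)))"
        proof (rule holomorphic_on_imp_continuous_on)
          show "(\<lambda>z. kq (E z ^ (2 ^ n))) holomorphic_on ?E"
            by (rule holomorphic_on_compose_gen[OF ph kq_holomorphic, unfolded o_def]) (use qn in auto)
        qed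
        show "continuous_on ?E ?k"
        proof (rule holomorphic_on_imp_continuous_on)
          have "x n holomorphic_on ?E" using sub by (intro holomorphic_on_subset[OF f(5)]) blast
          then show "?k holomorphic_on ?E" using x1 by (intro holomorphic_intros) auto
        qed
        show "(kq (E w ^ (2 ^ n)))\<^sup>2 = (?k w)\<^sup>2" if w: "w \<in> ?E" for w
          using Suc w kq_square[OF qn[OF w]] f(8)[of n w] unfolding n
          by (simp add: power_mult[symmetric] mult.commute)
        show "?k w \<noteq> 0" if w: "w \<in> ?E" for w
          using f(3)[OF sub[OF w], of "Suc n"] unfolding f(8) by auto
        have qq: "norm (q ^ 2 ^ n) < 1" using norm_power_iterate[OF q(1)] .
        show "kq (E z0 ^ (2 ^ n)) = ?k z0"
          unfolding E0 f(7) cmodq_eq[OF qq] using cayley_involution[OF kq_neq_minus_1[OF qq]] by simp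
      qed (use z c in auto)
      have "lamq (E z ^ (2 ^ n)) = f n z" if z: "z \<in> ?E" for z
      proof -
        have "cmodq (E z ^ (2 ^ n)) = x n z"
          unfolding cmodq_eq[OF qn[OF z]] k[OF z] using cayley_involution[OF x1[OF z]] by simp
        then show ?thesis using f(6)[OF sub[OF z], of n] lamq_eq[OF qn[OF z]] by simp
      qed
      then show ?thesis by (simp add: n_def)
    qed
  qed
  have up: "s z \<in> uhp \<and> lam (s z) = z" if "z \<in> ?E" for z
  proof
    show "s z \<in> uhp" using E1[OF that] norm_nome[of "s z"] by (simp add: E_def)
    have "lamq (E z ^ (2 ^ (N - N))) = f (N - N) z" using P[of N] that by (rule bspec)
    then show "lam (s z) = z" by (simp add: E_def lam_def f(1))
  qed
  show thesis by (rule that[OF s s0 up])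
qed

section \<open>The covering of the twice punctured plane\<close>

lemma lam_deriv_nonzero:
  assumes t: "t \<in> uhp"
  shows "deriv lam t \<noteq> 0"
proof -
  have "open (- {0, 1} :: complex set)" by (intro open_Compl finite_imp_closed) simp
  then obtain r where r: "r > 0" "ball (lam t) r \<subseteq> - {0, 1}"
    using lam_omits[OF t] open_contains_ball by (metis ComplI empty_iff insert_iff)
  obtain s where s: "s holomorphic_on ball (lam t) (r / 2)" "s (lam t) = t"
    "\<And>z. z \<in> ball (lam t) (r / 2) \<Longrightarrow> s z \<in> uhp \<and> lam (s z) = z"
    using lam_section[OF r t refl] by metis
  have c: "lam t \<in> ball (lam t) (r / 2)" using r by simp
  have "(s has_field_derivative deriv s (lam t)) (at (lam t))"
    using holomorphic_derivI[OF s(1) open_ball c] .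
  moreover have "(lam has_field_derivative deriv lam t) (at (s (lam t)))"
    using holomorphic_derivI[OF lam_holomorphic open_uhp t] s(2) by simp
  ultimately have "((\<lambda>z. lam (s z)) has_field_derivative deriv lam t * deriv s (lam t)) (at (lam t))"
    using DERIV_chain2 by blast
  moreover have "((\<lambda>z. lam (s z)) has_field_derivative 1) (at (lam t))"
    by (rule has_field_derivative_transform_within_open[OF DERIV_ident open_ball c]) (use s(3) in simp)
  ultimately have "deriv lam t * deriv s (lam t) = 1" by (rule DERIV_unique)
  then show ?thesis by auto
qed

lemma lam_locally_inj:
  assumes t: "t \<in> uhp"
  obtains d where "d > 0" "ball t d \<subseteq> uhp" "inj_on lam (ball t d)" "open (lam ` ball t d)"
  by (rule has_complex_derivative_locally_invertible[OF lam_holomorphic t open_uhp lam_deriv_nonzero[OF t]]) (rule that)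

text \<open>Uniqueness of lifts: the set of agreement is closed, and it is open because
  \<open>lam\<close> is locally injective. It relies on local injectivity alone and therefore
  already helps to prove the covering property.\<close>

lemma lam_sections_agree:
  assumes T: "connected T" "continuous_on T f" "continuous_on T g"
    and f: "\<And>x. x \<in> T \<Longrightarrow> f x \<in> uhp" and g: "\<And>x. x \<in> T \<Longrightarrow> g x \<in> uhp"
    and fg: "\<And>x. x \<in> T \<Longrightarrow> lam (f x) = lam (g x)"
    and a: "a \<in> T" "f a = g a" and x: "x \<in> T"
  shows "f x = g x"
proof -
  let ?S = "{x \<in> T. f x = g x}"
  have cl: "closedin (top_of_set T) ?S"
    using continuous_closedin_preimage_constant[OF continuous_on_diff[OF T(2,3)], of 0]
    by simp
  have "openin (top_of_set T) ?S"
  proof (subst openin_subopen, intro ballI)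
    fix y assume y: "y \<in> ?S"
    then have "f y \<in> uhp" using f by blast
    then obtain d where d: "d > 0" "inj_on lam (ball (f y) d)" using lam_locally_inj by metis
    let ?U = "(T \<inter> f -` ball (f y) d) \<inter> (T \<inter> g -` ball (f y) d)"
    have "openin (top_of_set T) ?U"
      using T by (intro openin_Int continuous_openin_preimage_gen) auto
    moreover have "y \<in> ?U" using y d by auto
    moreover have "?U \<subseteq> ?S"
      using d(2) fg by (auto dest: inj_onD)
    ultimately show "\<exists>U. openin (top_of_set T) U \<and> y \<in> U \<and> U \<subseteq> ?S" by blast
  qed
  with cl T(1) have "?S = {} \<or> ?S = T" unfolding connected_clopen by blast
  then show ?thesis using a x by auto
qed

text \<open>Through every preimage of a point near c there is a section over one and the same disc
  about c. The sheets are the images of these sections, and two sheets that meet coincide by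
  uniqueness of lifts.\<close>

lemma covering_space_lam: "covering_space uhp lam (- {0, 1})"
proof
  have op: "open (- {0, 1} :: complex set)" by (intro open_Compl finite_imp_closed) simp
  show "continuous_on uhp lam" using lam_holomorphic by (rule holomorphic_on_imp_continuous_on)
  \<comment> \<open>If \<open>lam t\<close> lies within r/8 of c, the disc of radius r/2 about
    \<open>lam t\<close> omits 0 and 1, so \<open>lam_section\<close> works on radius r/4 about
    \<open>lam t\<close>, which still contains the disc of radius r/8 about c.\<close>
  have ex: "\<exists>r>0. ball c r \<subseteq> - {0, 1} \<and> (\<forall>t\<in>uhp. lam t \<in> ball c (r / 8) \<longrightarrow>
      (\<exists>s. s holomorphic_on ball c (r / 8) \<and> s (lam t) = t \<and> (\<forall>z\<in>ball c (r / 8). s z \<in> uhp \<and> lam (s z) = z)))"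
    if c: "c \<in> - {0, 1}" for c
  proof -
    obtain r where r: "r > 0" "ball c r \<subseteq> - {0, 1}"
      using op c open_contains_ball by metis
    have "\<exists>s. s holomorphic_on ball c (r / 8) \<and> s (lam t) = t \<and> (\<forall>z\<in>ball c (r / 8). s z \<in> uhp \<and> lam (s z) = z)"
      if t: "t \<in> uhp" "lam t \<in> ball c (r / 8)" for t
    proof -
      have d: "dist c (lam t) < r / 8" using t by simp
      have s1: "z \<in> ball c r" if "z \<in> ball (lam t) (r / 2)" for z
        using d that r dist_triangle[of c z "lam t"] by simp
      have s2: "z \<in> ball (lam t) (r / 2 / 2)" if "z \<in> ball c (r / 8)" for z
        using d that r dist_triangle[of "lam t" z c] by (simp add: dist_commute)
      have "ball (lam t) (r / 2) \<subseteq> - {0, 1}" using s1 r(2) by blast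
      then obtain s where s: "s holomorphic_on ball (lam t) (r / 2 / 2)" "s (lam t) = t"
        "\<And>z. z \<in> ball (lam t) (r / 2 / 2) \<Longrightarrow> s z \<in> uhp \<and> lam (s z) = z"
        using lam_section[of "r / 2" "lam t" t] r t by auto
      then show ?thesis using s2 by (intro exI[of _ s]) (auto intro: holomorphic_on_subset)
    qed
    with r show ?thesis by blast
  qed
  \<comment> \<open>The image is open since the derivative has no zeros, and relatively closed since
    a disc of sections containing one value of \<open>lam\<close> consists of values; the twice
    punctured plane is connected.\<close>
  show "lam ` uhp = - {0, 1}"
  proof -
    have sub: "lam ` uhp \<subseteq> - {0, 1}" using lam_omits by auto
    have con: "connected (- {0, 1} :: complex set)"
      using connected_open_delete_finite[of "UNIV :: complex set" "{0, 1}"] connected_UNIV by (simp add: Compl_eq_Diff_UNIV)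
    have "openin (top_of_set (- {0, 1})) (lam ` uhp)"
    proof (rule open_openin_trans[OF op _ sub])
      show "open (lam ` uhp)"
      proof (subst open_subopen, intro ballI)
        fix z assume "z \<in> lam ` uhp"
        then obtain t where t: "t \<in> uhp" "z = lam t" by blast
        obtain d where "d > 0" "ball t d \<subseteq> uhp" "open (lam ` ball t d)" using lam_locally_inj[OF t(1)] by metis
        then show "\<exists>T. open T \<and> z \<in> T \<and> T \<subseteq> lam ` uhp"
          using t by (intro exI[of _ "lam ` ball t d"]) auto
      qed
    qed
    moreover have "closedin (top_of_set (- {0, 1})) (lam ` uhp)"
    proof -
      have "openin (top_of_set (- {0, 1})) (- {0, 1} - lam ` uhp)"
      proof (rule open_openin_trans[OF op])
        show "open (- {0, 1} - lam ` uhp)"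
        proof (subst open_subopen, intro ballI)
          fix c assume c: "c \<in> - {0, 1} - lam ` uhp"
          then obtain r where r: "r > 0" "ball c r \<subseteq> - {0, 1}" and s: "\<forall>t\<in>uhp. lam t \<in> ball c (r / 8) \<longrightarrow>
            (\<exists>s. s holomorphic_on ball c (r / 8) \<and> s (lam t) = t \<and> (\<forall>z\<in>ball c (r / 8). s z \<in> uhp \<and> lam (s z) = z))"
            using ex[of c] by blast
          have "lam t \<notin> ball c (r / 8)" if "t \<in> uhp" for t
          proof
            assume "lam t \<in> ball c (r / 8)"
            with s that obtain s where "\<forall>z\<in>ball c (r / 8). s z \<in> uhp \<and> lam (s z) = z" by blast
            then have "s c \<in> uhp" "lam (s c) = c" using r by auto
            then show False using c by (metis DiffD2 image_eqI)
          qed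
          moreover have "ball c (r / 8) \<subseteq> ball c r" using r by (intro subset_ball) auto
          ultimately show "\<exists>T. open T \<and> c \<in> T \<and> T \<subseteq> - {0, 1} - lam ` uhp"
            using r by (intro exI[of _ "ball c (r / 8)"]) auto
        qed
      qed auto
      then show ?thesis using sub by (simp add: closedin_def)
    qed
    moreover have "lam ` uhp \<noteq> {}" by (auto simp: uhp_def intro!: exI[of _ \<i>])
    ultimately show ?thesis using con unfolding connected_clopen by blast
  qed
  fix c :: complex assume c: "c \<in> - {0, 1}"
  then obtain r where r: "r > 0" "ball c r \<subseteq> - {0, 1}" and sec: "\<forall>t\<in>uhp. lam t \<in> ball c (r / 8) \<longrightarrow>
      (\<exists>s. s holomorphic_on ball c (r / 8) \<and> s (lam t) = t \<and> (\<forall>z\<in>ball c (r / 8). s z \<in> uhp \<and> lam (s z) = z))"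
    using ex[of c] by blast
  let ?T = "ball c (r / 8)"
  let ?sec = "\<lambda>s. s holomorphic_on ?T \<and> (\<forall>z\<in>?T. s z \<in> uhp \<and> lam (s z) = z)"
  let ?v = "{s ` ?T | s. ?sec s}"
  have TS: "?T \<subseteq> - {0, 1}" using r(2) subset_ball[of "r / 8" r c] r(1) by auto
  show "\<exists>T. c \<in> T \<and> openin (top_of_set (- {0, 1})) T \<and>
           (\<exists>v. \<Union> v = uhp \<inter> lam -` T \<and> (\<forall>u\<in>v. openin (top_of_set uhp) u) \<and>
                pairwise disjnt v \<and> (\<forall>u\<in>v. \<exists>q. homeomorphism u T lam q))"
  proof (intro exI[of _ ?T] exI[of _ ?v] conjI)
    show "c \<in> ?T" using r by simp
    show "openin (top_of_set (- {0, 1})) ?T" using op TS by (simp add: open_openin_trans)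
    show "\<Union> ?v = uhp \<inter> lam -` ?T"
    proof
      show "uhp \<inter> lam -` ?T \<subseteq> \<Union> ?v"
      proof
        fix t assume t: "t \<in> uhp \<inter> lam -` ?T"
        then obtain s where "?sec s" "s (lam t) = t" using sec by blast
        then show "t \<in> \<Union> ?v" using t by (intro UnionI[of "s ` ?T"]) (auto intro!: image_eqI[of _ s "lam t"])
      qed
    qed auto
    show "\<forall>u\<in>?v. openin (top_of_set uhp) u"
    proof
      fix u assume "u \<in> ?v"
      then obtain s where s: "u = s ` ?T" "?sec s" by blast
      have "inj_on s ?T" using s(2) by (metis inj_onI)
      then have "open u" unfolding s(1) using s(2) by (intro open_mapping_thm3) auto
      then show "openin (top_of_set uhp) u"
        using s open_uhp by (auto simp: openin_open_eq)
    qed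
    show "pairwise disjnt ?v"
    proof (rule pairwiseI)
      fix u1 u2 assume "u1 \<in> ?v" "u2 \<in> ?v" "u1 \<noteq> u2"
      then obtain s1 s2 where s: "u1 = s1 ` ?T" "?sec s1" "u2 = s2 ` ?T" "?sec s2" by blast
      show "disjnt u1 u2"
      proof (rule ccontr)
        assume "\<not> disjnt u1 u2"
        then obtain z1 z2 where z: "z1 \<in> ?T" "z2 \<in> ?T" "s1 z1 = s2 z2"
          unfolding s disjnt_def by blast
        then have "z1 = z2" using s by metis
        have "s1 z = s2 z" if "z \<in> ?T" for z
          by (rule lam_sections_agree[of ?T s1 s2 z1])
             (use s z that \<open>z1 = z2\<close> in \<open>auto intro: holomorphic_on_imp_continuous_on\<close>)
        then have "u1 = u2" unfolding s by (rule image_cong[OF refl])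
        with \<open>u1 \<noteq> u2\<close> show False by simp
      qed
    qed
    show "\<forall>u\<in>?v. \<exists>q. homeomorphism u ?T lam q"
    proof
      fix u assume "u \<in> ?v"
      then obtain s where s: "u = s ` ?T" "?sec s" by blast
      have "homeomorphism u ?T lam s"
      proof (rule homeomorphismI)
        show "continuous_on u lam"
          using s by (intro continuous_on_subset[OF holomorphic_on_imp_continuous_on[OF lam_holomorphic]]) auto
        show "continuous_on ?T s" using s by (simp add: holomorphic_on_imp_continuous_on)
      qed (use s in auto)
      then show "\<exists>q. homeomorphism u ?T lam q" by blast
    qed
  qed
qed

section \<open>Lifts through the covering\<close>

lemma lam_lift:
  fixes f :: "'a::real_normed_vector \<Rightarrow> complex"
  assumes "simply_connected U" "locally path_connected U" "continuous_on U f"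
    "\<And>x. x \<in> U \<Longrightarrow> f x \<noteq> 0 \<and> f x \<noteq> 1" "z \<in> U" "a \<in> uhp" "f z = lam a"
  obtains g where "continuous_on U g" "\<And>x. x \<in> U \<Longrightarrow> g x \<in> uhp \<and> lam (g x) = f x" "g z = a"
proof -
  have im: "f \<in> U \<rightarrow> - {0, 1}" using assms(4) by auto
  obtain g where "continuous_on U g" "g \<in> U \<rightarrow> uhp" "g z = a" "\<And>y. y \<in> U \<Longrightarrow> lam (g y) = f y"
    using covering_space_lift_strong[OF covering_space_lam assms(6,5,1-3) im assms(7)] by blast
  then show ?thesis by (intro that[of g]) auto
qed

lemma lam_lift_holomorphic:
  assumes U: "open U" "f holomorphic_on U" "continuous_on U g"
    and g: "\<And>z. z \<in> U \<Longrightarrow> g z \<in> uhp \<and> lam (g z) = f z"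
  shows "g holomorphic_on U"
  unfolding holomorphic_on_open[OF U(1)]
proof
  fix z assume z: "z \<in> U"
  then obtain d where d: "d > 0" "ball (g z) d \<subseteq> uhp" "inj_on lam (ball (g z) d)" "open (lam ` ball (g z) d)"
    using lam_locally_inj g by metis
  obtain h where h: "h holomorphic_on lam ` ball (g z) d" "\<And>t. t \<in> ball (g z) d \<Longrightarrow> h (lam t) = t"
    using holomorphic_has_inverse[OF holomorphic_on_subset[OF lam_holomorphic d(2)] open_ball d(3)] by metis
  have op: "open (U \<inter> g -` ball (g z) d)"
    using U by (simp add: continuous_open_preimage)
  have zin: "z \<in> U \<inter> g -` ball (g z) d" using z d by simp
  have "(\<lambda>w. h (f w)) holomorphic_on (U \<inter> g -` ball (g z) d)"
  proof (rule holomorphic_on_compose_gen[OF _ h(1), unfolded o_def])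
    show "f holomorphic_on U \<inter> g -` ball (g z) d" using U(2) by (rule holomorphic_on_subset) blast
    show "f ` (U \<inter> g -` ball (g z) d) \<subseteq> lam ` ball (g z) d"
    proof (rule image_subsetI)
      fix w assume "w \<in> U \<inter> g -` ball (g z) d"
      then show "f w \<in> lam ` ball (g z) d" using g by (intro image_eqI[of _ _ "g w"]) auto
    qed
  qed
  then have "g holomorphic_on (U \<inter> g -` ball (g z) d)"
  proof (rule holomorphic_transform)
    show "h (f w) = g w" if "w \<in> U \<inter> g -` ball (g z) d" for w
      using that g[of w] h(2)[of "g w"] by simp
  qed
  then show "\<exists>f'. (g has_field_derivative f') (at z)"
    using op zin by (auto simp: holomorphic_on_open)
qed

section \<open>The imaginary axis\<close>

lemma theta3_cnj: "theta3 (cnj q) = cnj (theta3 q)"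
  unfolding theta3_def by (simp flip: infsum_cnj)

lemma theta2_cnj: "theta2 (cnj q) = cnj (theta2 q)"
  unfolding theta2_def by (simp flip: infsum_cnj)

lemma lamq_cnj: "lamq (cnj q) = cnj (lamq q)"
  by (simp add: lamq_def theta2_cnj theta3_cnj)

definition lamr :: "real \<Rightarrow> real" where "lamr p = Re (lamq (of_real p))"

lemma theta_of_real:
  assumes "\<bar>p\<bar> < 1"
  obtains a b where "theta3 (of_real p) = of_real a" "theta2 (of_real p) = of_real b" "a \<noteq> 0" "b \<noteq> 0"
proof -
  have "theta3 (of_real p) \<in> \<real>" "theta2 (of_real p) \<in> \<real>"
    using theta3_cnj[of "of_real p"] theta2_cnj[of "of_real p"] by (auto simp: Reals_cnj_iff)
  then obtain a b where ab: "theta3 (of_real p) = of_real a" "theta2 (of_real p) = of_real b"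
    by (auto elim!: Reals_cases)
  moreover have "a \<noteq> 0" "b \<noteq> 0"
    using theta3_nonzero[of "of_real p"] theta2_nonzero[of "of_real p"] assms ab by auto
  ultimately show ?thesis using that by blast
qed

lemma lamq_of_real:
  assumes p: "0 < p" "p < 1"
  shows "lamq (of_real p) = of_real (lamr p)" "0 < lamr p" "lamr p < 1"
proof -
  obtain a b where ab: "theta3 (of_real p) = of_real a" "theta2 (of_real p) = of_real b" "a \<noteq> 0" "b \<noteq> 0"
    using theta_of_real[of p] p by auto
  obtain c where c: "theta3 (of_real (- p)) = of_real c" "c \<noteq> 0"
    using theta_of_real[of "- p"] p by auto
  have e: "lamq (of_real p) = of_real (p * b ^ 4 / a ^ 4)" by (simp add: lamq_def ab)
  have e': "lamq (of_real p) = of_real (1 - (c\<^sup>2 / a\<^sup>2)\<^sup>2)"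
    using lamq_eq[of "of_real p"] p c(1) by (simp add: cmodq_def ab)
  show "lamq (of_real p) = of_real (lamr p)" by (simp add: lamr_def e)
  show "0 < lamr p" using p ab by (simp add: lamr_def e)
  show "lamr p < 1" using c ab unfolding lamr_def e' by simp
qed

lemma lamr_eq_square:
  assumes p: "0 < p" "p < 1"
  shows "lamr p = 4 * sqrt (lamr (p\<^sup>2)) / (1 + sqrt (lamr (p\<^sup>2)))\<^sup>2"
proof -
  have p2: "0 < p\<^sup>2" "p\<^sup>2 < 1" using p by (simp_all add: power_less_one_iff)
  obtain a b where ab: "theta3 (of_real (p\<^sup>2)) = of_real a" "theta2 (of_real (p\<^sup>2)) = of_real b" "a \<noteq> 0" "b \<noteq> 0"
    using theta_of_real[of "p\<^sup>2"] p2 by auto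
  define k where "k = p * b\<^sup>2 / a\<^sup>2"
  have kq: "kq (of_real p) = of_real k"
    using ab by (simp add: kq_def k_def)
  have "of_real (k\<^sup>2) = complex_of_real (lamr (p\<^sup>2))"
    using kq_square[of "of_real p"] kq lamq_of_real(1)[OF p2] p by simp
  then have "k\<^sup>2 = lamr (p\<^sup>2)" using of_real_eq_iff by blast
  moreover have "k \<ge> 0" using p by (simp add: k_def)
  ultimately have k: "sqrt (lamr (p\<^sup>2)) = k" by (metis real_sqrt_unique)
  have "complex_of_real (lamr p) = of_real (4 * k / (1 + k)\<^sup>2)"
    using lamq_eq_kq[of "of_real p"] p kq lamq_of_real(1)[OF p] by simp
  then show ?thesis unfolding k by (metis of_real_eq_iff)
qed

text \<open>For 0 < k < 1 one has 4k/(1 + k)^2 >= k. Replacing p by its square root repeatedly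
  therefore drives \<open>lamr\<close> towards 1.\<close>

lemma lamr_ge_sqrt:
  assumes p: "0 < p" "p < 1"
  shows "sqrt (lamr (p\<^sup>2)) \<le> lamr p"
proof -
  have p2: "0 < p\<^sup>2" "p\<^sup>2 < 1" using p by (simp_all add: power_less_one_iff)
  let ?k = "sqrt (lamr (p\<^sup>2))"
  have k: "0 < ?k" "?k < 1" using lamq_of_real(2,3)[OF p2] by auto
  have "(1 + ?k)\<^sup>2 \<le> 2\<^sup>2" using k by (intro power_mono) auto
  then have "?k * (1 + ?k)\<^sup>2 \<le> ?k * 4" using k by (intro mult_left_mono) auto
  moreover have "0 < (1 + ?k)\<^sup>2" using k by (intro zero_less_power) linarith
  ultimately show ?thesis unfolding lamr_eq_square[OF p] by (simp only: pos_le_divide_eq mult.commute[of 4])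
qed

text \<open>The map k -> 4k/(1 + k)^2 is injective on (0,1): equality at k and l amounts to (k -
  l)(1 - kl) = 0. So equal values persist when both nomes are squared repeatedly, and near 0
  \<open>lamq\<close> is injective.\<close>

lemma lamr_inj: 
  assumes p: "0 < p" "p < 1" and p': "0 < p'" "p' < 1" and eq: "lamr p = lamr p'"
  shows "p = p'"
proof -
  have step: "lamr (a\<^sup>2) = lamr (b\<^sup>2)" if a: "0 < a" "a < 1" and b: "0 < b" "b < 1" and "lamr a = lamr b" for a b
  proof -
    have a2: "0 < a\<^sup>2" "a\<^sup>2 < 1" "0 < b\<^sup>2" "b\<^sup>2 < 1" using a b by (simp_all add: power_less_one_iff)
    let ?k = "sqrt (lamr (a\<^sup>2))" and ?l = "sqrt (lamr (b\<^sup>2))"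
    have k: "0 < ?k" "?k < 1" "0 < ?l" "?l < 1"
      using lamq_of_real(2,3)[OF a2(1,2)] lamq_of_real(2,3)[OF a2(3,4)] by auto
    have "4 * ?k / (1 + ?k)\<^sup>2 = 4 * ?l / (1 + ?l)\<^sup>2"
      using that(5) lamr_eq_square[OF a] lamr_eq_square[OF b] by simp
    moreover have "1 + ?k \<noteq> 0" "1 + ?l \<noteq> 0" using k by linarith+
    then have "(1 + ?k)\<^sup>2 \<noteq> 0" "(1 + ?l)\<^sup>2 \<noteq> 0" by simp_all
    ultimately have "?k * (1 + ?l)\<^sup>2 = ?l * (1 + ?k)\<^sup>2" by (simp add: frac_eq_eq)
    then have "(?k - ?l) * (1 - ?k * ?l) = 0" by (simp add: power2_eq_square algebra_simps)
    moreover have "?k * ?l < 1 * 1" using k by (intro mult_strict_mono) auto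
    ultimately have "?k = ?l" by simp
    then show ?thesis by simp
  qed
  have bd: "0 < r ^ (2 ^ n)" "r ^ (2 ^ n) < 1" if "0 < r" "r < 1" for r :: real and n :: nat
    using that by (simp_all add: power_less_one_iff)
  have all: "lamr (p ^ (2 ^ n)) = lamr (p' ^ (2 ^ n))" for n :: nat
  proof (induction n)
    case (Suc n)
    have "lamr ((p ^ (2 ^ n))\<^sup>2) = lamr ((p' ^ (2 ^ n))\<^sup>2)" by (rule step[OF bd[OF p] bd[OF p'] Suc])
    then show ?case by (simp add: power_mult[symmetric] mult.commute)
  qed (use eq in simp)
  obtain d e Q where Q: "0 < d" "0 < e" "\<And>q. norm q < d \<Longrightarrow> norm (lamq q) < e \<Longrightarrow> Q (lamq q) = q"
    using lamq_local_inverse by metis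
  have ev: "\<forall>\<^sub>F n in sequentially. norm (of_real r ^ (2 ^ n) :: complex) < d \<and> norm (lamq (of_real r ^ (2 ^ n))) < e"
    if "0 < r" "r < 1" for r
  proof (rule eventually_conj)
    have n: "norm (complex_of_real r) < 1" using that by simp
    show "\<forall>\<^sub>F n in sequentially. norm (of_real r ^ (2 ^ n) :: complex) < d"
      using tendsto_norm[OF tendsto_power_iterate[OF n]] Q(1) by (intro order_tendstoD(2)) auto
    show "\<forall>\<^sub>F n in sequentially. norm (lamq (of_real r ^ (2 ^ n))) < e"
      using tendsto_norm[OF tendsto_at_power_iterate[OF lamq_holomorphic n]] Q(2)
      by (intro order_tendstoD(2)) (auto simp: lamq_0)
  qed
  from eventually_happens'[OF sequentially_bot eventually_conj[OF ev[OF p] ev[OF p']]] obtain n :: nat where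
    n: "norm (of_real p ^ (2 ^ n) :: complex) < d" "norm (lamq (of_real p ^ (2 ^ n))) < e"
       "norm (of_real p' ^ (2 ^ n) :: complex) < d" "norm (lamq (of_real p' ^ (2 ^ n))) < e" by blast
  have "lamq (of_real p ^ (2 ^ n)) = lamq (of_real p' ^ (2 ^ n))"
    using lamq_of_real(1)[OF bd[OF p, of n]] lamq_of_real(1)[OF bd[OF p', of n]] all[of n] by simp
  then have "Q (lamq (of_real p ^ (2 ^ n))) = Q (lamq (of_real p' ^ (2 ^ n)))" by (rule arg_cong)
  then have "complex_of_real p ^ (2 ^ n) = of_real p' ^ (2 ^ n)"
    unfolding Q(3)[OF n(1,2)] Q(3)[OF n(3,4)] .
  then have "p ^ (2 ^ n) = p' ^ (2 ^ n)" by (metis of_real_eq_iff of_real_power)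
  then show ?thesis using p p' by (simp add: power_eq_iff_eq_base)
qed

lemma continuous_on_lamr: "continuous_on {0<..<1} lamr"
proof -
  have "continuous_on {0<..<1} (\<lambda>p::real. lamq (of_real p))"
    by (rule continuous_on_compose2[OF holomorphic_on_imp_continuous_on[OF lamq_holomorphic]])
       (auto intro!: continuous_intros)
  then show ?thesis unfolding lamr_def[abs_def] by (intro continuous_intros)
qed

lemma lamr_connected: "x \<in> {lamr a..lamr b} \<Longrightarrow> 0 < a \<Longrightarrow> a < c \<Longrightarrow> 0 < b \<Longrightarrow> b < c \<Longrightarrow> c \<le> 1 \<Longrightarrow> \<exists>p\<in>{0<..<c}. lamr p = x"
proof -
  assume *: "x \<in> {lamr a..lamr b}" "0 < a" "a < c" "0 < b" "b < c" "c \<le> 1"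
  have "connected (lamr ` {0<..<c})"
    using *(6) by (intro connected_continuous_image continuous_on_subset[OF continuous_on_lamr]) auto
  then have "{lamr a..lamr b} \<subseteq> lamr ` {0<..<c}"
    by (rule connected_contains_Icc) (use * in auto)
  with *(1) show ?thesis by blast
qed

lemma lamr_small:
  assumes v: "0 < v" and p: "0 < p" "p < 1"
  obtains p' where "0 < p'" "p' \<le> p" "lamr p' < v"
proof -
  have n: "norm (complex_of_real p) < 1" using p by simp
  have "\<forall>\<^sub>F n in sequentially. norm (lamq (of_real p ^ (2 ^ n))) < v"
    using tendsto_norm[OF tendsto_at_power_iterate[OF lamq_holomorphic n]] v
    by (intro order_tendstoD(2)) (auto simp: lamq_0)
  from eventually_happens'[OF sequentially_bot this] obtain n :: nat where "norm (lamq (of_real p ^ (2 ^ n))) < v" by blast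
  then have "lamr (p ^ (2 ^ n)) < v"
    using complex_Re_le_cmod[of "lamq (of_real p ^ (2 ^ n))"] by (simp add: lamr_def)
  moreover have "p ^ (2 ^ n) \<le> p ^ 1" using p by (intro power_decreasing) auto
  ultimately show ?thesis using p by (intro that[of "p ^ (2 ^ n)"]) auto
qed

text \<open>Small values occur at the cusp. Values near 1 occur along repeated square roots of 1/2,
  where \<open>lamr_ge_sqrt\<close> guarantees at least c^(1/2^n) with c = lamr(1/2). Connectedness
  supplies the rest.\<close>

lemma lamr_surj:
  assumes v: "0 < v" "v < 1"
  shows "\<exists>p\<in>{0<..<1}. lamr p = v"
proof -
  obtain a where a: "0 < a" "a \<le> 1/2" "lamr a < v" using lamr_small[OF v(1), of "1/2"] by auto
  let ?c = "lamr (1/2)"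
  have c: "0 < ?c" "?c < 1" using lamq_of_real[of "1/2"] by auto
  have ex: "\<exists>p\<in>{0<..<1}. ?c powr (1 / 2 ^ n) \<le> lamr p" for n :: nat
  proof (induction n)
    case 0
    then show ?case using c by (intro bexI[of _ "1/2"]) auto
  next
    case (Suc n)
    then obtain p where p: "0 < p" "p < 1" "?c powr (1 / 2 ^ n) \<le> lamr p" by auto
    have s: "0 < sqrt p" "sqrt p < 1" using p by auto
    have "?c powr (1 / 2 ^ Suc n) = sqrt (?c powr (1 / 2 ^ n))"
      using c by (simp add: powr_half_sqrt[symmetric] powr_powr mult.commute)
    also have "\<dots> \<le> sqrt (lamr p)" using p(3) by simp
    also have "\<dots> \<le> lamr (sqrt p)" using lamr_ge_sqrt[OF s] p by simp
    finally show ?case using s by (intro bexI[of _ "sqrt p"]) auto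
  qed
  have "(\<lambda>n::nat. ?c powr (1 / 2 ^ n)) \<longlonglongrightarrow> ?c powr 0"
    using c LIMSEQ_power_zero[of "1/2::real"] by (intro tendsto_intros) (auto simp: power_divide)
  then have "\<forall>\<^sub>F n in sequentially. ?c powr (1 / 2 ^ n) > v"
    using v c by (intro order_tendstoD(1)) auto
  from eventually_happens'[OF sequentially_bot this] obtain n :: nat where "?c powr (1 / 2 ^ n) > v" by blast
  with ex[of n] obtain b where b: "0 < b" "b < 1" "v < lamr b" by force
  show ?thesis by (rule lamr_connected[of v a b 1]) (use a b in auto)
qed

section \<open>Lifts over the unit interval\<close>

definition on_axis :: "complex \<Rightarrow> bool" where "on_axis t \<longleftrightarrow> t \<in> uhp \<and> Re t = 0"

lemma lam_axis:
  assumes "on_axis t"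
  shows "lam t = of_real (lamr (exp (- pi * Im t)))" "0 < exp (- pi * Im t)" "exp (- pi * Im t) < 1"
proof -
  have t: "t = \<i> * of_real (Im t)" "Im t > 0" using assms by (auto simp: on_axis_def uhp_def complex_eq_iff)
  have "\<i> * pi * t = of_real (- pi * Im t)" using assms by (simp add: on_axis_def complex_eq_iff)
  then have e: "exp (\<i> * pi * t) = of_real (exp (- pi * Im t))" by (simp only: exp_of_real)
  show p: "0 < exp (- pi * Im t)" "exp (- pi * Im t) < 1" using t(2) by auto
  show "lam t = of_real (lamr (exp (- pi * Im t)))"
    using lamq_of_real(1)[OF p] by (simp only: lam_def e)
qed

definition unit_real :: "complex \<Rightarrow> bool" where "unit_real z \<longleftrightarrow> z \<in> \<real> \<and> 0 < Re z \<and> Re z < 1"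

lemma lam_axis_unit: "on_axis t \<Longrightarrow> unit_real (lam t)"
  using lam_axis[of t] lamq_of_real(2,3)[of "exp (- pi * Im t)"] by (simp add: unit_real_def)

lemma lam_axis_inj:
  assumes "on_axis s" "on_axis t" "lam s = lam t"
  shows "s = t"
proof -
  have "lamr (exp (- pi * Im s)) = lamr (exp (- pi * Im t))"
    using assms(3) unfolding lam_axis(1)[OF assms(1)] lam_axis(1)[OF assms(2)] of_real_eq_iff .
  then have "exp (- pi * Im s) = exp (- pi * Im t)"
    using lamr_inj lam_axis(2,3)[OF assms(1)] lam_axis(2,3)[OF assms(2)] by blast
  then show ?thesis using assms by (auto simp: on_axis_def complex_eq_iff)
qed

lemma axis_inverse:
  obtains y :: "real \<Rightarrow> real" where "continuous_on {0<..<1} y"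
    "\<And>v. 0 < v \<Longrightarrow> v < 1 \<Longrightarrow> 0 < y v \<and> lam (\<i> * of_real (y v)) = of_real v"
proof -
  have im: "lamr ` {0<..<1} = {0<..<1}"
    using lamq_of_real(2,3) lamr_surj by force
  have "inj_on lamr {0<..<1}" using lamr_inj by (auto intro!: inj_onI)
  then obtain g where g: "homeomorphism {0<..<1} {0<..<1} lamr g"
    using homeomorphism_into_1d[OF _ continuous_on_lamr im] by (auto simp: convex_imp_path_connected)
  have gi: "g v \<in> {0<..<1}" "lamr (g v) = v" if "v \<in> {0<..<1}" for v
    using g that by (auto simp: homeomorphism_def)
  define y where "y v = - ln (g v) / pi" for v
  have "continuous_on {0<..<1} y"
    unfolding y_def using gi homeomorphism_cont2[OF g] by (intro continuous_intros) force+
  moreover have "0 < y v \<and> lam (\<i> * of_real (y v)) = of_real v" if v: "0 < v" "v < 1" for v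
  proof -
    have g: "0 < g v" "g v < 1" "lamr (g v) = v" using gi[of v] v by auto
    then have y: "0 < y v" "exp (- pi * y v) = g v" by (simp_all add: y_def divide_neg_pos)
    then have "on_axis (\<i> * of_real (y v))" by (simp add: on_axis_def uhp_def)
    from lam_axis(1)[OF this] y g show ?thesis by simp
  qed
  ultimately show ?thesis using that by blast
qed

text \<open>The inverse of \<open>lam\<close> along the imaginary axis is a second lift of the same
  map; the two agree at \<open>a\<close> and hence everywhere. In this way totally real boundary
  values become geodesic ones.\<close>

lemma lift_stays_on_axis:
  assumes X: "connected X" "continuous_on X c" and c: "\<And>x. x \<in> X \<Longrightarrow> c x \<in> uhp"
    and l: "\<And>x. x \<in> X \<Longrightarrow> unit_real (lam (c x))" and a: "a \<in> X" "Re (c a) = 0" and x: "x \<in> X"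
  shows "on_axis (c x)"
proof -
  obtain y where y: "continuous_on {0<..<1} y"
    "\<And>v. 0 < v \<Longrightarrow> v < 1 \<Longrightarrow> 0 < y v \<and> lam (\<i> * of_real (y v)) = of_real v"
    using axis_inverse by metis
  define g where "g x = \<i> * of_real (y (Re (lam (c x))))" for x
  have l1: "0 < Re (lam (c x))" "Re (lam (c x)) < 1" "lam (c x) = of_real (Re (lam (c x)))" if "x \<in> X" for x
    using l[OF that] by (auto simp: unit_real_def)
  have cl: "continuous_on X (\<lambda>x. Re (lam (c x)))"
    using c by (intro continuous_intros continuous_on_compose2[OF holomorphic_on_imp_continuous_on[OF lam_holomorphic] X(2)]) auto
  have g: "g x \<in> uhp" "lam (g x) = lam (c x)" "on_axis (g x)" if "x \<in> X" for x
    using y(2)[OF l1(1,2)[OF that]] l1(3)[OF that] by (auto simp: g_def uhp_def on_axis_def)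
  have "c x = g x"
  proof (rule lam_sections_agree[OF X _ c g(1) g(2)[symmetric] a(1) _ x])
    show "continuous_on X g"
      unfolding g_def using l1 by (intro continuous_intros continuous_on_compose2[OF y(1) cl]) auto
    show "c a = g a"
      by (rule lam_axis_inj) (use a c g in \<open>auto simp: on_axis_def\<close>)
  qed
  then show ?thesis using g(3)[OF x] by simp
qed

lemma lam_plus_1:
  assumes "t \<in> uhp"
  shows "lam (t + 1) = lam t / (lam t - 1)"
proof -
  have "exp (\<i> * pi * (t + 1)) = - exp (\<i> * pi * t)" by (simp add: distrib_left exp_add)
  then show ?thesis using lamq_minus norm_nome assms unfolding lam_def by metis
qed

lemma lam_minus_1: "t \<in> uhp \<Longrightarrow> lam (t - 1) = lam t / (lam t - 1)"
proof -
  assume t: "t \<in> uhp"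
  have "exp (\<i> * pi * (t - 1)) = exp (\<i> * pi * (t + 1))"
    unfolding exp_eq by (intro exI[of _ "-1"]) (simp add: algebra_simps)
  then show ?thesis using lam_plus_1[OF t] by (simp add: lam_def)
qed

lemma lam_reflect: "lam (- cnj t) = cnj (lam t)"
proof -
  have "exp (\<i> * pi * (- cnj t)) = cnj (exp (\<i> * pi * t))" by (simp add: exp_cnj)
  then show ?thesis by (simp add: lam_def lamq_cnj)
qed

section \<open>The inversion\<close>

lemma theta3_of_real_le:
  assumes p: "0 < p" "p < (1::real)"
  shows "norm (theta3 (of_real p)) \<le> (1 + p) / (1 - p)"
proof -
  let ?f = "\<lambda>n::int. p ^ nat \<bar>n\<bar>"
  have g: "((\<lambda>n. p ^ n) has_sum (1 / (1 - p))) UNIV" "((\<lambda>n. p * p ^ n) has_sum (p * (1 / (1 - p)))) UNIV"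
    using p geometric_sums[of p] summable_geometric[of p]
    by (intro norm_summable_imp_has_sum sums_mult; simp add: norm_mult norm_power summable_mult)+
  have i: "inj int" "inj (\<lambda>n::nat. - int n - 1)"
    by (auto intro!: injI)
  have "(?f has_sum (1 / (1 - p))) (range int)"
    using g(1) by (subst has_sum_reindex[OF i(1)]) (simp add: o_def)
  moreover have "(?f has_sum (p * (1 / (1 - p)))) (range (\<lambda>n::nat. - int n - 1))"
  proof (subst has_sum_reindex[OF i(2)])
    have "nat \<bar>- int n - 1\<bar> = Suc n" for n by simp
    then show "(?f \<circ> (\<lambda>n. - int n - 1) has_sum (p * (1 / (1 - p)))) UNIV"
      using g(2) by (simp only: o_def power_Suc)
  qed
  ultimately have "(?f has_sum (1 / (1 - p) + p * (1 / (1 - p)))) (range int \<union> range (\<lambda>n::nat. - int n - 1))"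
    by (rule has_sum_Un_disjoint) auto
  moreover have "range int \<union> range (\<lambda>n::nat. - int n - 1) = UNIV"
  proof -
    have "x \<in> range (\<lambda>n::nat. - int n - 1)" if "x \<notin> range int" for x
    proof -
      have "x < 0" using that by (metis not_le rangeI zero_le_imp_eq_int)
      then show ?thesis by (intro image_eqI[of _ _ "nat (- x - 1)"]) auto
    qed
    then show ?thesis by blast
  qed
  ultimately have f: "(?f has_sum (1 / (1 - p) + p * (1 / (1 - p)))) UNIV" by simp
  have le: "nat \<bar>n\<bar> \<le> nat (n\<^sup>2)" for n :: int
  proof -
    have "\<bar>n\<bar> * 1 \<le> \<bar>n\<bar> * \<bar>n\<bar>" if "n \<noteq> 0" using that by (intro mult_left_mono) auto
    then have "\<bar>n\<bar> \<le> n\<^sup>2" by (cases "n = 0") (auto simp: power2_eq_square)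
    then show ?thesis by linarith
  qed
  have n1: "norm (complex_of_real p) < 1" using p by simp
  have "norm (theta3 (of_real p)) \<le> (\<Sum>\<^sub>\<infinity>n::int. norm (complex_of_real p ^ nat (n\<^sup>2)))"
    unfolding theta3_def by (rule norm_infsum_bound[OF theta3_summable[OF n1]])
  also have "\<dots> \<le> infsum ?f UNIV"
  proof (rule infsum_mono[OF theta3_summable[OF n1]])
    show "?f summable_on UNIV" using f by (rule has_sum_imp_summable)
    show "norm (complex_of_real p ^ nat (n\<^sup>2)) \<le> p ^ nat \<bar>n\<bar>" for n
      using p le[of n] by (simp add: norm_power power_decreasing)
  qed
  also have "\<dots> = (1 + p) / (1 - p)" using infsumI[OF f] by (simp add: add_divide_distrib)
  finally show ?thesis .
qed

lemma theta2_of_real_ge: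
  assumes p: "0 < p" "p < (1::real)"
  shows "2 \<le> norm (theta2 (of_real p))"
proof -
  have n1: "norm (complex_of_real p) < 1" using p by simp
  have s: "(\<lambda>n::int. complex_of_real p ^ nat (n\<^sup>2 + n)) summable_on UNIV"
    by (rule abs_summable_summable[OF theta2_summable[OF n1]])
  have re: "Re (complex_of_real p ^ k) = p ^ k" for k by (metis Re_complex_of_real of_real_power)
  have "2 = (\<Sum>\<^sub>\<infinity>n\<in>{0, -1::int}. p ^ nat (n\<^sup>2 + n))" by simp
  also have "\<dots> \<le> (\<Sum>\<^sub>\<infinity>n::int. p ^ nat (n\<^sup>2 + n))"
  proof (rule infsum_mono_neutral)
    show "(\<lambda>n::int. p ^ nat (n\<^sup>2 + n)) summable_on UNIV"
      using has_sum_Re[OF has_sum_infsum[OF s]] unfolding re by (rule has_sum_imp_summable)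
  qed (use p in auto)
  also have "\<dots> = Re (theta2 (of_real p))"
    using infsum_Re[OF s] unfolding re theta2_def .
  also have "\<dots> \<le> norm (theta2 (of_real p))" by (rule complex_Re_le_cmod)
  finally show ?thesis .
qed

text \<open>The bound 16p/((1 + p)/(1 - p))^4 is about 0.33 at p = 1/40, a convenient rational below
  exp(-pi).\<close>

lemma lamr_40: "1 / 4 < lamr (1 / 40)"
proof -
  let ?p = "1 / 40 :: real"
  have "lamr ?p = norm (lamq (of_real ?p))"
    using lamq_of_real[of ?p] by simp
  also have "\<dots> = ?p * norm (theta2 (of_real ?p)) ^ 4 / norm (theta3 (of_real ?p)) ^ 4"
    by (simp add: lamq_def norm_mult norm_divide norm_power)
  also have "\<dots> \<ge> ?p * 2 ^ 4 / ((1 + ?p) / (1 - ?p)) ^ 4"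
    using theta2_of_real_ge[of ?p] theta3_of_real_le[of ?p] theta3_nonzero[of "of_real ?p"]
    by (intro frac_le mult_left_mono power_mono) auto
  finally have "?p * 2 ^ 4 / ((1 + ?p) / (1 - ?p)) ^ 4 \<le> lamr ?p" .
  moreover have "1 / 4 < ?p * 2 ^ 4 / ((1 + ?p) / (1 - ?p)) ^ 4" by (simp add: power_divide)
  ultimately show ?thesis by linarith
qed

text \<open>If pi >= 16/5, then 53/100 <= pi/6 and sin(53/100) <= 1/2; the cubic Taylor polynomial
  with its error bound refutes this.\<close>

lemma pi_less_32: "pi < 16 / 5"
proof (rule ccontr)
  assume "\<not> pi < 16 / 5"
  then have "sin (53/100) \<le> sin (pi / 6)"
    using pi_gt_zero by (intro sin_monotone_2pi_le) auto
  then have "sin (53/100) \<le> (1/2 :: real)" by (simp add: sin_30)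
  moreover have "\<bar>sin (53/100) - (\<Sum>m<5. sin_coeff m * (53/100) ^ m)\<bar> \<le> inverse (fact 5) * \<bar>53/100::real\<bar> ^ 5"
    by (rule Maclaurin_sin_bound)
  moreover have "(\<Sum>m<5. sin_coeff m * (53/100) ^ m) = 53/100 - (53/100) ^ 3 / 6"
  proof -
    have "{..<5} = {0, 1, 2, 3, 4 :: nat}" by auto
    then show ?thesis by (simp add: sin_coeff_def fact_numeral)
  qed
  ultimately show False by (simp add: fact_numeral abs_le_iff power_divide)
qed

lemma exp_minus_pi_ge: "1 / 40 \<le> exp (- pi)"
proof -
  have "exp (16/5 :: real) ^ 5 = exp 16" by (simp add: exp_of_nat_mult[symmetric])
  also have "\<dots> = exp 1 ^ 16" by (simp add: exp_of_nat_mult[symmetric])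
  also have "\<dots> \<le> (3::real) ^ 16" using exp_le by (intro power_mono) auto
  also have "\<dots> \<le> 40 ^ 5" by simp
  finally have "exp (16/5 :: real) \<le> 40" using power_mono_iff[of "exp (16/5 :: real)" 40 5] by simp
  moreover have "exp pi \<le> exp (16/5)" using pi_less_32 by simp
  ultimately have "exp pi \<le> 40" by linarith
  then show ?thesis by (simp add: exp_minus field_simps)
qed

text \<open>Injectivity and continuity replace monotonicity: \<open>lamr\<close> is below
  \<open>lamr p\<close> near 0 and would be above it at 1/40, so there would be a second point below
  p with the same value.\<close>

lemma lamr_quarter:
  assumes p: "1 / 40 \<le> p" "p < 1"
  shows "1 / 4 < lamr p"
proof (rule ccontr)
  assume n: "\<not> 1 / 4 < lamr p"
  obtain a where a: "0 < a" "a \<le> 1/80" "lamr a < lamr p"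
    using lamr_small[of "lamr p" "1/80"] lamq_of_real(2)[of p] p by auto
  have "\<exists>b\<in>{0<..<p}. lamr b = lamr p"
  proof (rule lamr_connected[of _ a "1/40"])
    show "lamr p \<in> {lamr a..lamr (1/40)}" using a(3) n lamr_40 by simp
    show "1/40 < p" using p(1) n lamr_40 by (cases "p = 1/40") auto
    show "a < p" using a(2) p(1) by linarith
  qed (use a p in simp_all)
  then obtain b where "0 < b" "b < p" "lamr b = lamr p" by auto
  then show False using lamr_inj[of b p] p by auto
qed

text \<open>The true value is y = 1, but at this stage a lower bound has to do. If y <= 1/2, then
  exp(-2 pi y) >= exp(-pi) >= 1/40, so lambda exceeds 1/4 at this nome, and by
  \<open>lamr_ge_sqrt\<close> it exceeds 1/2 at exp(-pi y).\<close>

lemma lam_half_point: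
  obtains y where "1 / 2 < y" "lam (\<i> * of_real y) = 1 / 2"
proof -
  obtain f where f: "\<And>v. 0 < v \<Longrightarrow> v < 1 \<Longrightarrow> 0 < f v \<and> lam (\<i> * of_real (f v)) = of_real v"
    using axis_inverse by metis
  define y where "y = f (1/2)"
  have y: "0 < y" "lam (\<i> * of_real y) = of_real (1/2)" using f[of "1/2"] by (auto simp: y_def)
  have ax: "on_axis (\<i> * of_real y)" using y by (simp add: on_axis_def uhp_def)
  let ?p = "exp (- pi * y)"
  have p: "0 < ?p" "?p < 1" "lamr ?p = 1 / 2"
    using lam_axis[OF ax] y(2) by (simp_all flip: of_real_eq_iff[where 'a = complex])
  have "1 / 2 < y"
  proof (rule ccontr)
    assume "\<not> 1 / 2 < y"
    then have "- pi \<le> - (2 * pi * y)" using pi_gt_zero by (simp add: field_simps)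
    then have "exp (- pi) \<le> exp (2 * (- pi * y))" by simp
    also have "\<dots> = ?p\<^sup>2" by (simp only: exp_double)
    finally have "1 / 40 \<le> ?p\<^sup>2" using exp_minus_pi_ge by linarith
    moreover have "?p\<^sup>2 < 1" using p by (simp add: power_less_one_iff)
    ultimately have "1 / 4 < lamr (?p\<^sup>2)" by (rule lamr_quarter)
    then have "sqrt (1 / 4) < sqrt (lamr (?p\<^sup>2))" by (rule real_sqrt_less_mono)
    then show False using lamr_ge_sqrt[OF p(1,2)] p(3) by (simp add: real_sqrt_divide)
  qed
  with y show ?thesis using that by simp
qed

text \<open>\<open>C\<close> is the Cayley transform taking the fixed point to 0, and
  \<open>D\<close> is its inverse. For the conjugated involution Schwarz's lemma holds in both
  directions, so it is a rotation by alpha with alpha^2 = 1. The value 1 would make g the identity,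
  and -1 gives the stated formula.\<close>

lemma uhp_involution_fixing:
  assumes g: "g holomorphic_on uhp" "\<And>t. t \<in> uhp \<Longrightarrow> g t \<in> uhp" "\<And>t. t \<in> uhp \<Longrightarrow> g (g t) = t"
    and y: "y > 0" "g (\<i> * of_real y) = \<i> * of_real y" and ne: "t0 \<in> uhp" "g t0 \<noteq> t0"
    and t: "t \<in> uhp"
  shows "g t = - (of_real y)\<^sup>2 / t"
proof -
  let ?i = "\<i> * complex_of_real y"
  define C where "C t = (t - ?i) / (t + ?i)" for t
  define D where "D w = ?i * ((1 + w) / (1 - w))" for w
  have nz: "t + ?i \<noteq> 0" if "t \<in> uhp" for t
    using that y by (auto simp: uhp_def complex_eq_iff)
  have C1: "norm (C t) < 1" if "t \<in> uhp" for t
  proof -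
    have "(norm (t - ?i))\<^sup>2 < (norm (t + ?i))\<^sup>2"
      using that y unfolding cmod_power2 by (simp add: uhp_def power2_eq_square algebra_simps)
    then have "norm (t - ?i) < norm (t + ?i)" by (rule power2_less_imp_less) simp
    then show ?thesis using nz[OF that] by (simp add: C_def norm_divide)
  qed
  have w1: "1 - w \<noteq> 0" if "norm w < 1" for w :: complex using that by auto
  have DC: "D (C t) = t" if "t \<in> uhp" for t
  proof -
    have "1 + C t = 2 * t / (t + ?i)" "1 - C t = 2 * ?i / (t + ?i)"
      using nz[OF that] by (simp_all add: C_def add_divide_eq_iff diff_divide_eq_iff)
    then show ?thesis using nz[OF that] y by (simp add: D_def)
  qed
  have D1: "D w + ?i = 2 * ?i / (1 - w)" "D w - ?i = 2 * ?i * w / (1 - w)" if "norm w < 1" for w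
    using w1[OF that] by (simp_all add: D_def add_divide_eq_iff diff_divide_eq_iff algebra_simps)
  have CD: "C (D w) = w" if "norm w < 1" for w
    unfolding C_def D1[OF that] using w1[OF that] y by simp
  have Du: "D w \<in> uhp" if "norm w < 1" for w
  proof -
    have "Im (?i * x) = y * Re x" for x by simp
    then have "Im (D w) = y * Re ((1 + w) / (1 - w))" unfolding D_def .
    also have "Re ((1 + w) / (1 - w)) = (1 - (norm w)\<^sup>2) / (norm (1 - w))\<^sup>2"
      unfolding Re_divide cmod_power2 by (simp add: power2_eq_square algebra_simps)
    finally show ?thesis using that y w1[OF that] by (simp add: uhp_def power_less_one_iff)
  qed
  define f where "f w = C (g (D w))" for w
  have fh: "f holomorphic_on ball 0 1"
  proof -
    have Dh: "D holomorphic_on ball 0 1" unfolding D_def using w1 by (intro holomorphic_intros) auto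
    have "(\<lambda>w. g (D w)) holomorphic_on ball 0 1"
      by (rule holomorphic_on_compose_gen[OF Dh g(1), unfolded o_def]) (use Du in auto)
    then show ?thesis unfolding f_def C_def
      using nz g(2) Du by (intro holomorphic_intros) auto
  qed
  have f0: "f 0 = 0" using y by (simp add: f_def D_def C_def)
  have f1: "norm (f w) < 1" if "norm w < 1" for w unfolding f_def using C1 g(2) Du that by blast
  have ff: "f (f w) = w" if "norm w < 1" for w
    using that Du g CD DC by (simp add: f_def)
  have h: "norm (1/2::complex) < 1" by simp
  have "norm (f (1/2)) \<le> norm (1/2::complex)" by (rule Schwarz_Lemma(1)[OF fh f0 f1 h])
  moreover have "norm (f (f (1/2))) \<le> norm (f (1/2))" by (rule Schwarz_Lemma(1)[OF fh f0 f1 f1[OF h]])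
  ultimately have "norm (f (1/2)) = norm (1/2::complex)" using ff[OF h] by simp
  then have "\<exists>\<alpha>. (\<forall>z. norm z < 1 \<longrightarrow> f z = \<alpha> * z) \<and> norm \<alpha> = 1"
    using h by (intro Schwarz_Lemma(3)[OF fh f0 f1 h]) (auto intro!: exI[of _ "1/2"])
  then obtain \<alpha> where \<alpha>: "\<And>z. norm z < 1 \<Longrightarrow> f z = \<alpha> * z" "norm \<alpha> = 1" by blast
  have "f (f (1/2)) = \<alpha> * f (1/2)" by (rule \<alpha>(1)[OF f1[OF h]])
  also have "\<dots> = \<alpha> * (\<alpha> * (1/2))" by (simp only: \<alpha>(1)[OF h])
  finally have "\<alpha> * (\<alpha> * (1/2)) = 1/2" by (simp only: ff[OF h])
  then have "\<alpha>\<^sup>2 = 1" by (simp add: power2_eq_square)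
  then consider "\<alpha> = 1" | "\<alpha> = -1" by (auto simp: power2_eq_1_iff)
  then show ?thesis
  proof cases
    case 1
    then have "f (C t0) = C t0" using \<alpha>(1) C1[OF ne(1)] by simp
    then have "C (g t0) = C t0" by (simp add: f_def DC ne(1))
    then have "g t0 = t0" using DC[OF ne(1)] DC[OF g(2)[OF ne(1)]] by metis
    with ne(2) show ?thesis by simp
  next
    case 2
    then have "f (C t) = - C t" using \<alpha>(1) C1[OF t] by simp
    then have "C (g t) = - C t" by (simp add: f_def DC t)
    then have "(g t - ?i) * (t + ?i) = - ((t - ?i) * (g t + ?i))"
      using nz[OF t] nz[OF g(2)[OF t]] by (simp add: C_def frac_eq_eq minus_divide_left) (simp add: algebra_simps)
    then have "2 * (g t * t + (of_real y)\<^sup>2) = 0" by (simp add: power2_eq_square algebra_simps)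
    then have "g t * t + (of_real y)\<^sup>2 = 0" by (simp only: mult_eq_0_iff) simp
    then have "g t * t = - (of_real y)\<^sup>2" by (simp only: eq_neg_iff_add_eq_0)
    moreover have "t \<noteq> 0" using t by (auto simp: uhp_def)
    ultimately show ?thesis by (metis nonzero_mult_div_cancel_right)
  qed
qed

lemma minus_inverse_uhp: "t \<in> uhp \<Longrightarrow> - 1 / t \<in> uhp"
  using complex_neq_0[of t] by (auto simp: uhp_def Im_divide divide_simps)

text \<open>Lifting 1 - lam with the point over 1/2 held fixed gives a self-map g of the half-plane
  that covers an involution and has a fixed point. By uniqueness of lifts g is itself an involution,
  so g(t) = -y^2/t, and only y = 1 remains to be shown.\<close>

lemma lam_inversion:
  assumes "t \<in> uhp"
  shows "lam (- 1 / t) = 1 - lam t"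
proof -
  obtain y where y: "1 / 2 < y" "lam (\<i> * of_real y) = 1 / 2" by (rule lam_half_point)
  let ?i = "\<i> * complex_of_real y"
  have iu: "?i \<in> uhp" using y by (simp add: uhp_def)
  have sc: "simply_connected uhp" "locally path_connected uhp" "connected uhp"
    using convex_uhp by (auto intro: convex_imp_simply_connected convex_imp_locally_path_connected convex_connected)
  have lc: "continuous_on uhp lam" by (rule holomorphic_on_imp_continuous_on[OF lam_holomorphic])
  obtain g where g: "continuous_on uhp g" "\<And>t. t \<in> uhp \<Longrightarrow> g t \<in> uhp \<and> lam (g t) = 1 - lam t" "g ?i = ?i"
  proof (rule lam_lift[OF sc(1,2), of "\<lambda>t. 1 - lam t" ?i ?i])
    show "continuous_on uhp (\<lambda>t. 1 - lam t)" by (intro continuous_intros lc)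
    show "1 - lam ?i = lam ?i" unfolding y(2) by simp
  qed (use lam_omits iu in auto)
  have gh: "g holomorphic_on uhp"
    by (rule lam_lift_holomorphic[OF open_uhp _ g(1,2)]) (auto intro!: holomorphic_intros lam_holomorphic)
  have gg: "g (g t) = t" if "t \<in> uhp" for t
    by (rule lam_sections_agree[OF sc(3), of "\<lambda>t. g (g t)" "\<lambda>t. t" ?i])
       (use g that iu in \<open>auto intro!: continuous_on_compose2[OF g(1) g(1)]\<close>)
  \<comment> \<open>Over 1/3 the values 1/3 and 1 - 1/3 differ, so g is not the identity.\<close>
  obtain t0 where t0: "t0 \<in> uhp" "g t0 \<noteq> t0"
  proof -
    obtain f where f: "\<And>v. 0 < v \<Longrightarrow> v < 1 \<Longrightarrow> 0 < f v \<and> lam (\<i> * of_real (f v)) = of_real v"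
      using axis_inverse by metis
    define v where "v = f (1/3)"
    have v: "0 < v" "lam (\<i> * of_real v) = of_real (1/3)" using f[of "1/3"] by (auto simp: v_def)
    have "g (\<i> * of_real v) \<noteq> \<i> * of_real v"
      using g(2)[of "\<i> * of_real v"] v by (auto simp: uhp_def)
    with v show ?thesis by (intro that[of "\<i> * of_real v"]) (auto simp: uhp_def)
  qed
  let ?c = "(complex_of_real y)\<^sup>2"
  have geq: "g t = - ?c / t" if "t \<in> uhp" for t
    by (rule uhp_involution_fixing[OF gh _ gg _ g(3) t0 that]) (use g y in auto)
  define M where "M t = g (t + 1)" for t
  have u1: "t + 1 \<in> uhp" if "t \<in> uhp" for t using that by (simp add: uhp_def)
  have Mu: "M t \<in> uhp" if "t \<in> uhp" for t using g(2)[OF u1[OF that]] by (simp add: M_def)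
  have Ml: "lam (M t) = 1 / (1 - lam t)" if "t \<in> uhp" for t
  proof -
    have "1 - lam t / (lam t - 1) = 1 / (1 - lam t)"
      using lam_omits[OF that] by (simp add: divide_simps)
    then show ?thesis using g(2)[OF u1[OF that]] lam_plus_1[OF that] by (simp add: M_def)
  qed
  have Mc: "continuous_on uhp M" unfolding M_def
    by (rule continuous_on_compose2[OF g(1)]) (auto intro!: continuous_intros u1)
  \<comment> \<open>\<open>M\<close> is elliptic because \<open>y > 1/2\<close>; its cube is a deck transformation with a fixed point, hence trivial,
    and this forces \<open>y = 1\<close>.\<close>
  define s where "s = Complex (- 1 / 2) (sqrt (4 * y\<^sup>2 - 1) / 2)"
  have y4: "0 < 4 * y\<^sup>2 - 1"
    using y(1) power_strict_mono[of "1/2" y 2] by (simp add: power_divide)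
  have su: "s \<in> uhp" using y4 by (simp add: s_def uhp_def)
  \<comment> \<open>\<open>s\<close> is the root of s^2 + s + y^2 = 0 in the half-plane, that is, a
    fixed point of t -> -y^2/(t + 1).\<close>
  have "s * (s + 1) = - ?c"
  proof -
    let ?r = "sqrt (4 * y\<^sup>2 - 1) / 2"
    have "?r\<^sup>2 = y\<^sup>2 - 1 / 4" using y4 by (simp add: power_divide)
    moreover have "s * (s + 1) = of_real (- 1 / 4 - ?r\<^sup>2)"
      by (simp add: s_def complex_eq_iff power2_eq_square)
    ultimately show ?thesis by simp
  qed
  moreover have "s + 1 \<noteq> 0" using su by (auto simp: uhp_def complex_eq_iff)
  ultimately have Ms: "M s = s"
    unfolding M_def geq[OF u1[OF su]] by (metis nonzero_mult_div_cancel_right)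
  have M3: "M (M (M t)) = t" if "t \<in> uhp" for t
  proof (rule lam_sections_agree[OF sc(3), of "\<lambda>t. M (M (M t))" "\<lambda>t. t" s])
    show "continuous_on uhp (\<lambda>t. M (M (M t)))"
      by (intro continuous_on_compose2[OF Mc] continuous_on_compose2[OF Mc Mc] Mc) (auto simp: Mu)
    show "lam (M (M (M t))) = lam t" if "t \<in> uhp" for t
    proof -
      have n: "lam t \<noteq> 0" "1 - lam t \<noteq> 0" using lam_omits[OF that] by auto
      have "1 - 1 / (1 - lam t) = - lam t / (1 - lam t)" using n by (simp add: diff_divide_eq_iff)
      then have "lam (M (M t)) = - ((1 - lam t) / lam t)"
        using n Ml[OF that] Ml[OF Mu[OF that]] by simp
      moreover have "1 - - ((1 - lam t) / lam t) = 1 / lam t" using n by (simp add: divide_simps)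
      ultimately have "1 - lam (M (M t)) = 1 / lam t" by (simp only:)
      then show ?thesis using Ml[OF Mu[OF Mu[OF that]]] by simp
    qed
  qed (use su that Mu Ms in \<open>auto intro: continuous_on_id\<close>)
  have ne: "M t + 1 \<noteq> 0" if "t \<in> uhp" for t using Mu[OF that] by (auto simp: uhp_def complex_eq_iff)
  \<comment> \<open>The cycle i, M(i), M(M(i)), i is written out as three equations. Eliminating the
    two middle points leaves one equation in y^2, whose real part reads y^2 = 1.\<close>
  have i: "\<i> \<in> uhp" by (simp add: uhp_def)
  have "1 + \<i> \<noteq> 0" by (simp add: complex_eq_iff)
  then have a1: "M \<i> * (1 + \<i>) = - ?c" using geq[OF u1[OF i]] by (simp add: M_def add.commute)
  have a2: "M (M \<i>) * (M \<i> + 1) = - ?c" using geq[OF u1[OF Mu[OF i]]] ne[OF i] by (simp add: M_def)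
  have a3: "\<i> * (M (M \<i>) + 1) = - ?c"
  proof -
    have "M (M (M \<i>)) = - ?c / (M (M \<i>) + 1)"
      unfolding M_def[of "M (M \<i>)"] by (rule geq[OF u1[OF Mu[OF Mu[OF i]]]])
    then have "\<i> = - ?c / (M (M \<i>) + 1)" unfolding M3[OF i] .
    then show ?thesis using ne[OF Mu[OF i]] nonzero_eq_divide_eq by blast
  qed
  have b: "M (M \<i>) = \<i> * ?c - 1"
    using arg_cong[OF a3, of "\<lambda>x. - \<i> * x"] by (simp add: algebra_simps)
  have "(\<i> * ?c - 1) * (M \<i> * (1 + \<i>) + (1 + \<i>)) = - ?c * (1 + \<i>)"
    using arg_cong[OF a2, of "\<lambda>x. x * (1 + \<i>)"] unfolding b by (simp add: algebra_simps)
  then have "(\<i> * ?c - 1) * (- ?c + (1 + \<i>)) = - ?c * (1 + \<i>)" unfolding a1 .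
  then have "Re ((\<i> * ?c - 1) * (- ?c + (1 + \<i>))) = Re (- ?c * (1 + \<i>))" by simp
  then have "y\<^sup>2 = 1" by (simp flip: of_real_power)
  then have "?c = 1" by (simp flip: of_real_power)
  then show ?thesis using geq[OF assms] g(2)[OF assms] by simp
qed

section \<open>The tessellation\<close>

text \<open>The group generated by (1,2;0,1) and (1,0;2,1). The rules multiply on the right by
  powers of the generators, so facts about deck transformations follow by induction on words; the
  arithmetic used later is collected in \<open>gam_det\<close>.\<close>

inductive gam :: "int \<Rightarrow> int \<Rightarrow> int \<Rightarrow> int \<Rightarrow> bool" where
  gam_id: "gam 1 0 0 1"
| gam_T: "gam p q r s \<Longrightarrow> gam p (q + 2 * k * p) r (s + 2 * k * r)"
| gam_U: "gam p q r s \<Longrightarrow> gam (p + 2 * k * q) q (r + 2 * k * s) s"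

definition mob :: "int \<Rightarrow> int \<Rightarrow> int \<Rightarrow> int \<Rightarrow> complex \<Rightarrow> complex" where
  "mob p q r s t = (of_int p * t + of_int q) / (of_int r * t + of_int s)"

lemma gam_det: "gam p q r s \<Longrightarrow> p * s - q * r = 1 \<and> even q \<and> even r"
  by (induction rule: gam.induct) (auto simp: algebra_simps)

lemma mob_denominator_nonzero:
  assumes "p * s - q * r = (1::int)" "t \<in> uhp"
  shows "of_int r * t + of_int s \<noteq> (0::complex)"
proof
  assume z: "of_int r * t + of_int s = (0::complex)"
  then have "Im (of_int r * t + of_int s) = 0" by simp
  then have "r = 0" using assms(2) by (simp add: uhp_def)
  with z assms(1) show False by simp
qed

lemma mob_uhp:
  assumes "p * s - q * r = (1::int)" "t \<in> uhp"
  shows "mob p q r s t \<in> uhp"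
proof -
  let ?d = "of_int r * t + of_int s :: complex"
  have d: "?d \<noteq> 0" by (rule mob_denominator_nonzero[OF assms])
  have "Im (mob p q r s t) = Im t * (of_int (p * s - q * r)) / (norm ?d)\<^sup>2"
    unfolding mob_def Im_divide cmod_power2 by (simp add: algebra_simps)
  then show ?thesis using d assms by (simp add: uhp_def)
qed

lemma shift_uhp: "t + 2 * of_int k \<in> uhp" if "t \<in> uhp"
  using that by (simp add: uhp_def)

lemma shear_uhp: "t / (2 * of_int k * t + 1) \<in> uhp" if "t \<in> uhp"
  using mob_uhp[of 1 1 0 "2 * k" t] that by (simp add: mob_def)

lemma mob_shift: "mob p (q + 2 * k * p) r (s + 2 * k * r) t = mob p q r s (t + 2 * of_int k)"
  by (simp add: mob_def algebra_simps)

lemma mob_shear: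
  assumes "t \<in> uhp"
  shows "mob (p + 2 * k * q) q (r + 2 * k * s) s t = mob p q r s (t / (2 * of_int k * t + 1))"
proof -
  let ?d = "2 * of_int k * t + 1"
  have d: "?d \<noteq> 0" using mob_denominator_nonzero[of 1 1 0 "2 * k" t] assms by simp
  have "of_int p * (t / ?d) + of_int q = (of_int (p + 2 * k * q) * t + of_int q) / ?d"
    "of_int r * (t / ?d) + of_int s = (of_int (r + 2 * k * s) * t + of_int s) / ?d"
    using d by (simp_all add: field_simps)
  then show ?thesis using d by (simp add: mob_def)
qed

lemma lam_shift: "lam (t + 2 * of_int k) = lam t"
proof -
  have "exp (\<i> * pi * (t + 2 * of_int k)) = exp (\<i> * pi * t)"
    unfolding exp_eq by (intro exI[of _ k]) (simp add: algebra_simps)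
  then show ?thesis by (simp add: lam_def)
qed

text \<open>The shear is the translation by -2k conjugated by t -> -1/t, and the two uses of
  \<open>lam_inversion\<close> cancel.\<close>

lemma lam_shear:
  assumes "t \<in> uhp"
  shows "lam (t / (2 * of_int k * t + 1)) = lam t"
proof -
  let ?u = "- 1 / t + 2 * of_int (- k)"
  have t0: "t \<noteq> 0" using assms by (auto simp: uhp_def)
  have u: "?u \<in> uhp" by (rule shift_uhp[OF minus_inverse_uhp[OF assms]])
  have "- 1 / ?u = t / (2 * of_int k * t + 1)"
  proof -
    have "?u = - ((2 * of_int k * t + 1) / t)" using t0 by (simp add: field_simps)
    moreover have "- 1 / (- (x / t)) = t / x" for x by simp
    ultimately show ?thesis by metis
  qed
  then have "lam (t / (2 * of_int k * t + 1)) = 1 - lam ?u" using lam_inversion[OF u] by simp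
  also have "lam ?u = 1 - lam t" unfolding lam_shift using lam_inversion[OF assms] .
  finally show ?thesis by simp
qed

lemma lam_mob: "gam p q r s \<Longrightarrow> t \<in> uhp \<Longrightarrow> lam (mob p q r s t) = lam t"
proof (induction arbitrary: t rule: gam.induct)
  case gam_id
  then show ?case by (simp add: mob_def)
next
  case (gam_T p q r s k)
  then show ?case unfolding mob_shift using lam_shift shift_uhp by simp
next
  case (gam_U p q r s k)
  then show ?case unfolding mob_shear[OF gam_U.prems] using lam_shear shear_uhp by simp
qed

definition orb :: "complex \<Rightarrow> complex \<Rightarrow> bool" where
  "orb t t' \<longleftrightarrow> (\<exists>p q r s. gam p q r s \<and> t = mob p q r s t')"

lemma orb_shift: "orb t (t' + 2 * of_int k) \<Longrightarrow> orb t t'"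
  unfolding orb_def using gam_T mob_shift by metis

lemma orb_shear: "orb t (t' / (2 * of_int k * t' + 1)) \<Longrightarrow> t' \<in> uhp \<Longrightarrow> orb t t'"
  unfolding orb_def using gam_U mob_shear by metis

text \<open>Closeness to 16q alone does not control the sign near the real axis. But F = lamq - 16q
  is real on the reals and its derivative stays below 16 near 0, so |Im F(q)| <= 16 Im q.\<close>

lemma Im_lamq_nonneg:
  obtains d where "d > 0" "\<And>q. norm q < d \<Longrightarrow> 0 \<le> Im q \<Longrightarrow> 0 \<le> Im (lamq q)"
proof -
  define F where "F q = lamq q - 16 * q" for q
  have Fh: "F holomorphic_on ball 0 1" unfolding F_def by (intro holomorphic_intros lamq_holomorphic)
  have lf: "lamq field_differentiable at 0"
    using lamq_holomorphic by (rule holomorphic_on_imp_differentiable_at) auto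
  have "deriv F 0 = deriv lamq 0 - 16"
    unfolding F_def[abs_def] using lf by (subst deriv_diff) (auto intro!: derivative_intros)
  then have F0: "deriv F 0 = 0" by (simp add: deriv_lamq_0)
  have "isCont (deriv F) 0"
    using holomorphic_on_imp_continuous_on[OF holomorphic_deriv[OF Fh open_ball]]
    by (simp add: continuous_on_eq_continuous_at)
  then obtain d0 where d0: "d0 > 0" "\<And>q. norm q < d0 \<Longrightarrow> norm (deriv F q) < 16"
    unfolding continuous_at_eps_delta using F0 by (force simp: dist_norm dest: spec[of _ 16])
  define d where "d = min d0 1"
  have d: "d > 0" "ball (0::complex) d \<subseteq> ball 0 1" using d0 by (auto simp: d_def)
  show ?thesis
  proof
    show "d > 0" by (rule d)
    fix q :: complex assume q: "norm q < d" "0 \<le> Im q"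
    have re: "norm (complex_of_real (Re q)) < d" using q(1) abs_Re_le_cmod[of q] by simp
    have "norm (F q - F (of_real (Re q))) \<le> 16 * norm (q - of_real (Re q))"
    proof (rule field_differentiable_bound[where S = "ball 0 d" and f' = "deriv F"])
      show "(F has_field_derivative deriv F z) (at z within ball 0 d)" if "z \<in> ball 0 d" for z
        using holomorphic_derivI[OF Fh open_ball, of z] d that by (auto intro: has_field_derivative_at_within)
      show "norm (deriv F z) \<le> 16" if "z \<in> ball 0 d" for z
        using d0(2)[of z] that by (simp add: d_def)
    qed (use q re in auto)
    also have "norm (q - of_real (Re q)) = Im q"
      using q(2) by (simp add: cmod_eq_Im)
    finally have "\<bar>Im (F q - F (of_real (Re q)))\<bar> \<le> 16 * Im q" using abs_Im_le_cmod order_trans by blast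
    moreover have "Im (F (of_real (Re q))) = 0"
      using lamq_cnj[of "of_real (Re q)"] by (simp add: F_def complex_eq_iff)
    moreover have "Im (F q) = Im (lamq q) - 16 * Im q" by (simp add: F_def)
    ultimately show "0 \<le> Im (lamq q)" by (simp add: abs_le_iff)
  qed
qed

text \<open>The half-planes are closed, so that a section over one and a section over the other can
  be compared on the three real intervals.\<close>

definition upper :: "complex set" where "upper = {z. 0 \<le> Im z} - {0, 1}"
definition lower :: "complex set" where "lower = {z. Im z \<le> 0} - {0, 1}"

lemma upper_simply_connected: "simply_connected upper" "locally path_connected upper"
proof -
  have "starlike upper"
    unfolding starlike_def
  proof (intro bexI[of _ \<i>] ballI subsetI)
    fix x y assume x: "x \<in> upper" and "y \<in> closed_segment \<i> x"
    then obtain u where u: "0 \<le> u" "u \<le> 1" "y = (1 - u) *\<^sub>R \<i> + u *\<^sub>R x" by (auto simp: in_segment)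
    have im: "Im y = (1 - u) + u * Im x" using u by simp
    have ge: "0 \<le> u * Im x" using u x by (simp add: upper_def)
    show "y \<in> upper"
    proof (cases "u = 1")
      case True
      then show ?thesis using u x by simp
    next
      case False
      then have "0 < Im y" using im ge u by simp
      then show ?thesis by (auto simp: upper_def)
    qed
  qed (simp add: upper_def complex_eq_iff)
  then show "simply_connected upper" by (rule starlike_imp_simply_connected)
  have "openin (top_of_set {z. 0 \<le> Im z}) upper"
    unfolding upper_def by (metis Diff_eq finite.emptyI finite_insert finite_imp_closed openin_open open_Compl)
  then show "locally path_connected upper"
    using convex_imp_locally_path_connected[OF convex_halfspace_Im_ge[of 0]] locally_open_subset
    by (simp add: upper_def)
qed

lemma lam_i: "lam \<i> = 1 / 2"
proof -
  have "lam \<i> = 1 - lam \<i>" using lam_inversion[of \<i>] by (simp add: uhp_def)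
  then show ?thesis by (simp add: eq_diff_eq field_simps)
qed

text \<open>The intervals (0,1), (-infinity,0) and (1,infinity) go into the sides of the ideal
  triangle with vertices 0, 1, infinity: the lines Re t = 0 and Re t = 1, and the reflection of the
  latter in the unit circle, the semicircle over [0,1]. The sides determine how \<open>s\<close>
  differs from its mirror image.\<close>

lemma upper_lift:
  obtains s where "continuous_on upper s" "\<And>z. z \<in> upper \<Longrightarrow> s z \<in> uhp \<and> lam (s z) = z"
    "\<And>x. 0 < x \<Longrightarrow> x < 1 \<Longrightarrow> Re (s (of_real x)) = 0"
    "\<And>x. x < 0 \<Longrightarrow> Re (s (of_real x)) = 1"
    "\<And>x. 1 < x \<Longrightarrow> s (of_real x) = - 1 / (- cnj (s (of_real (1 - x))))"
proof -
  have hU: "1 / 2 \<in> upper" by (auto simp: upper_def)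
  obtain s where s: "continuous_on upper s" "\<And>z. z \<in> upper \<Longrightarrow> s z \<in> uhp \<and> lam (s z) = z" "s (1/2) = \<i>"
    by (rule lam_lift[OF upper_simply_connected, of "\<lambda>z. z" "1/2" \<i>])
       (use hU in \<open>auto simp: upper_def uhp_def lam_i\<close>)
  have su: "s z \<in> uhp" "lam (s z) = z" if "z \<in> upper" for z using s(2)[OF that] by auto
  have con: "connected (complex_of_real ` I)" if "connected I" for I
    using that by (intro connected_continuous_image continuous_intros)
  have axis: "on_axis (s (of_real x))" if x: "0 < x" "x < 1" for x
  proof -
    have sub: "complex_of_real ` {0<..<1} \<subseteq> upper" by (auto simp: upper_def)
    show ?thesis
    proof (rule lift_stays_on_axis[OF con[of "{0<..<1}"] continuous_on_subset[OF s(1) sub]])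
      show "complex_of_real (1/2) \<in> complex_of_real ` {0<..<1}" by (intro imageI) auto
      show "unit_real (lam (s z))" if "z \<in> complex_of_real ` {0<..<1}" for z
        using that sub s(2) by (auto simp: unit_real_def)
    qed (use sub s x in auto)
  qed
  obtain d where d: "d > 0" "\<And>q. norm q < d \<Longrightarrow> 0 \<le> Im q \<Longrightarrow> 0 \<le> Im (lamq q)"
    using Im_lamq_nonneg by metis
  \<comment> \<open>At height Y the nome has modulus below d, so \<open>lam\<close> sends the
    segment from iY to iY + 1 into \<open>upper\<close>. Following \<open>s\<close> along it leads
    from the side Re t = 0 to the side Re t = 1.\<close>
  define Y where "Y = max 1 (- ln d / pi + 1)"
  let ?c = "\<lambda>t. \<i> * of_real Y + of_real t :: complex"
  have cu: "?c t \<in> uhp" for t by (simp add: uhp_def Y_def)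
  have cU: "lam (?c t) \<in> upper" if t: "t \<in> {0..1}" for t
  proof -
    let ?q = "exp (\<i> * pi * ?c t)"
    have "- ln d / pi < Y" by (simp add: Y_def less_max_iff_disj)
    then have "- pi * Y < ln d" by (simp add: field_simps)
    then have "exp (- pi * Y) < exp (ln d)" by (simp only: exp_less_cancel_iff)
    then have "norm ?q < d" using d(1) by simp
    moreover have "0 \<le> Im ?q"
      using t sin_ge_zero[of "pi * t"] by (simp add: Im_exp mult_left_le)
    ultimately have "0 \<le> Im (lam (?c t))" unfolding lam_def by (rule d(2))
    then show ?thesis using lam_omits[OF cu] by (simp add: upper_def)
  qed
  have ax0: "on_axis (?c 0)" by (simp add: on_axis_def uhp_def Y_def)
  have s1: "s (lam (?c t)) = ?c t" if "t \<in> {0..1}" for t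
  proof (rule lam_sections_agree[of "{0..1}" "\<lambda>t. s (lam (?c t))" ?c 0])
    show "continuous_on {0..1} (\<lambda>t. s (lam (?c t)))"
      by (intro continuous_on_compose2[OF s(1)] continuous_on_compose2[OF holomorphic_on_imp_continuous_on[OF lam_holomorphic]]
          continuous_intros) (use cU cu in auto)
    show "s (lam (?c 0)) = ?c 0"
    proof (rule lam_axis_inj[OF _ ax0])
      have "unit_real (lam (?c 0))" by (rule lam_axis_unit[OF ax0])
      then show "on_axis (s (lam (?c 0)))"
        using axis[of "Re (lam (?c 0))"] by (auto simp: unit_real_def)
      show "lam (s (lam (?c 0))) = lam (?c 0)" by (rule su(2)[OF cU]) simp
    qed
  qed (use that cU su cu in \<open>auto intro!: continuous_intros\<close>)
  have left: "Re (s (of_real x)) = 1" if x: "x < 0" for x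
  proof -
    have sub: "complex_of_real ` {..<0} \<subseteq> upper" by (auto simp: upper_def)
    obtain l where l: "lam (?c 0) = of_real l" "0 < l" "l < 1"
      using lam_axis_unit[OF ax0] by (auto simp: unit_real_def elim!: Reals_cases)
    define x0 where "x0 = l / (l - 1)"
    have x0: "x0 < 0" using l by (simp add: x0_def divide_pos_neg)
    have "lam (?c 1) = of_real x0"
      using lam_plus_1[OF cu[of 0]] l by (simp add: x0_def)
    then have r0: "Re (s (of_real x0) - 1) = 0" using s1[of 1] by simp
    have m: "lam (s (of_real y) - 1) = of_real (y / (y - 1))" if "y < 0" for y
      using lam_minus_1[of "s (of_real y)"] su[of "of_real y"] sub that by auto
    \<comment> \<open>Under t -> t - 1 the value y of \<open>lam\<close> becomes y/(y - 1), which
      carries the negative reals into (0,1); the translated lift starts on the axis at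
      \<open>x0\<close>.\<close>
    have "on_axis (s (of_real x) - 1)"
    proof (rule lift_stays_on_axis[where X = "complex_of_real ` {..<0}" and c = "\<lambda>z. s z - 1"])
      show "continuous_on (complex_of_real ` {..<0}) (\<lambda>z. s z - 1)"
        by (intro continuous_intros continuous_on_subset[OF s(1) sub])
      show "unit_real (lam (s z - 1))" if zz: "z \<in> complex_of_real ` {..<0}" for z
      proof -
        obtain y where y: "y < 0" "z = of_real y" using zz by auto
        have "0 < y / (y - 1) \<and> y / (y - 1) < 1" using y(1) by (simp add: divide_neg_neg divide_less_eq)
        then show ?thesis unfolding y(2) m[OF y(1)] unit_real_def by simp
      qed
      show "s z - 1 \<in> uhp" if "z \<in> complex_of_real ` {..<0}" for z
        using su(1)[of z] sub that by (auto simp: uhp_def)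
      show "complex_of_real x0 \<in> complex_of_real ` {..<0}" using x0 by auto
    qed (use x r0 con in auto)
    then show ?thesis by (simp add: on_axis_def)
  qed
  \<comment> \<open>The reflection z -> 1 - cnj z preserves \<open>upper\<close> and fixes 1/2. The
    right side is again a section, and both equal i at 1/2.\<close>
  have right: "s z = - 1 / (- cnj (s (1 - cnj z)))" if z: "z \<in> upper" for z
  proof (rule lam_sections_agree[OF simply_connected_imp_connected[OF upper_simply_connected(1)] s(1), of _ "1/2"])
    let ?f = "\<lambda>z. - cnj (s (1 - cnj z))"
    have U: "1 - cnj z \<in> upper" if "z \<in> upper" for z
      using that by (auto simp: upper_def complex_eq_iff)
    have f: "?f z \<in> uhp" "lam (?f z) = 1 - z" if "z \<in> upper" for z
      using su[OF U[OF that]] lam_reflect[of "s (1 - cnj z)"] by (auto simp: uhp_def)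
    show "- 1 / ?f z \<in> uhp" if "z \<in> upper" for z by (rule minus_inverse_uhp[OF f(1)[OF that]])
    show "lam (s z) = lam (- 1 / ?f z)" if "z \<in> upper" for z
      using lam_inversion[OF f(1)[OF that]] f(2)[OF that] su(2)[OF that] by simp
    have "s (1 - cnj z) \<noteq> 0" if "z \<in> upper" for z using f(1)[OF that] by (auto simp: uhp_def)
    then show "continuous_on upper (\<lambda>z. - 1 / ?f z)"
      by (intro continuous_intros continuous_on_compose2[OF s(1)]) (auto simp: U)
    show "s (1/2) = - 1 / ?f (1/2)" using s(3) by simp
  qed (use hU z su in auto)
  show ?thesis
  proof (rule that[of s])
    show "s (of_real x) = - 1 / (- cnj (s (of_real (1 - x))))" if "1 < x" for x
      using right[of "of_real x"] that by (simp add: upper_def)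
  qed (use s(1,2) axis left in \<open>auto simp: on_axis_def\<close>)
qed


section \<open>Exhausting the half-plane by the orbits of two sections\<close>

lemma mob_continuous:
  assumes "p * s - q * r = (1::int)" "continuous_on X f" "\<And>x. x \<in> X \<Longrightarrow> f x \<in> uhp"
  shows "continuous_on X (\<lambda>x. mob p q r s (f x))"
  unfolding mob_def using mob_denominator_nonzero[OF assms(1)] assms by (intro continuous_intros) auto

lemma orb_continue:
  assumes C: "convex C" "continuous_on C f" "continuous_on C h"
    and f: "\<And>z. z \<in> C \<Longrightarrow> f z \<in> uhp \<and> lam (f z) = z" and h: "\<And>z. z \<in> C \<Longrightarrow> h z \<in> uhp \<and> lam (h z) = z"
    and a: "a \<in> C" "orb (f a) (h a)" and z: "z \<in> C"
  shows "orb (f z) (h z)"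
proof -
  obtain p q r s where g: "gam p q r s" "f a = mob p q r s (h a)" using a(2) by (auto simp: orb_def)
  have d: "p * s - q * r = 1" using gam_det[OF g(1)] by simp
  have "f z = mob p q r s (h z)"
    by (rule lam_sections_agree[OF convex_connected[OF C(1)] C(2) mob_continuous[OF d C(3)] _ _ _ a(1) g(2) z])
       (use f h lam_mob[OF g(1)] mob_uhp[OF d] in auto)
  then show ?thesis using g(1) by (auto simp: orb_def)
qed

text \<open>The images under \<open>orb\<close> of the two sections over the closed half-planes form an open and closed subset of
  the half-plane, so they exhaust it.\<close>
lemma orbit_of_axis:
  assumes t: "t \<in> uhp" "unit_real (lam t)"
  obtains p q r s a where "gam p q r s" "on_axis a" "t = mob p q r s a" "lam a = lam t"
proof -
  obtain s where s: "continuous_on upper s" "\<And>z. z \<in> upper \<Longrightarrow> s z \<in> uhp \<and> lam (s z) = z"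
    "\<And>x. 0 < x \<Longrightarrow> x < 1 \<Longrightarrow> Re (s (of_real x)) = 0"
    "\<And>x. x < 0 \<Longrightarrow> Re (s (of_real x)) = 1"
    "\<And>x. 1 < x \<Longrightarrow> s (of_real x) = - 1 / (- cnj (s (of_real (1 - x))))"
    using upper_lift by metis
  define s' where "s' z = - cnj (s (cnj z))" for z
  have cl: "cnj z \<in> upper" if "z \<in> lower" for z using that by (auto simp: upper_def lower_def complex_eq_iff)
  have s'u: "s' z \<in> uhp \<and> lam (s' z) = z" if "z \<in> lower" for z
    using s(2)[OF cl[OF that]] lam_reflect[of "s (cnj z)"] by (auto simp: s'_def uhp_def)
  have s'c: "continuous_on lower s'"
    unfolding s'_def by (intro continuous_intros continuous_on_compose2[OF s(1)]) (auto simp: cl)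
  \<comment> \<open>Across (-infinity,0) the two sections differ by t + 2, across (0,1) they agree,
    and across (1,infinity) they differ by the shear t/(2t + 1): the generators of the
    group.\<close>
  have trans: "(\<exists>k. s z = s' z + 2 * of_int k) \<and> (\<exists>k. s' z = s z + 2 * of_int k) \<or>
     (\<exists>k. s z = s' z / (2 * of_int k * s' z + 1)) \<and> (\<exists>k. s' z = s z / (2 * of_int k * s z + 1))"
    if z: "z \<in> upper" "Im z = 0" for z
  proof -
    define x where "x = Re z"
    have zx: "z = of_real x" using z(2) by (simp add: x_def complex_eq_iff)
    have s'x: "s' z = - cnj (s z)" by (simp add: s'_def zx)
    consider "x < 0" | "0 < x" "x < 1" | "1 < x"
      using z(1) unfolding zx upper_def by (force simp: less_le)
    then show ?thesis
    proof cases
      case 1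
      then have "s z = s' z + 2 * of_int 1" "s' z = s z + 2 * of_int (-1)"
        using s(4)[of x] by (auto simp: s'x[unfolded zx] zx complex_eq_iff)
      then show ?thesis by blast
    next
      case 2
      then have "s z = s' z + 2 * of_int 0" "s' z = s z + 2 * of_int 0"
        using s(3)[of x] by (auto simp: s'x[unfolded zx] zx complex_eq_iff)
      then show ?thesis by blast
    next
      case 3
      let ?w = "s (of_real (1 - x))"
      have U: "of_real (1 - x) \<in> upper" using 3 by (auto simp: upper_def)
      have w: "?w \<noteq> 0" "cnj ?w = 2 - ?w"
        using s(2)[OF U] s(4)[of "1 - x"] 3 by (auto simp: uhp_def complex_eq_iff)
      have w2: "2 - ?w \<noteq> 0" using w by (metis complex_cnj_zero_iff)
      have a: "s z = 1 / (2 - ?w)" using s(5)[OF 3] w(2) by (simp add: zx)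
      have b: "s' z = - 1 / ?w"
      proof -
        have "cnj (2 - ?w) = ?w" using w(2) by (metis complex_cnj_cnj)
        then show ?thesis unfolding s'x a by simp
      qed
      have "s z = s' z / (2 * of_int 1 * s' z + 1)"
      proof -
        have "2 * of_int 1 * s' z + 1 = (?w - 2) / ?w" unfolding b using w(1) by (simp add: divide_simps)
        then have "s' z / (2 * of_int 1 * s' z + 1) = - (1 / (?w - 2))" unfolding b using w(1) by simp
        also have "\<dots> = 1 / (2 - ?w)" by (metis minus_diff_eq minus_divide_right)
        finally show ?thesis unfolding a ..
      qed
      moreover have "s' z = s z / (2 * of_int (-1) * s z + 1)"
      proof -
        have "2 * of_int (-1) * s z + 1 = - ?w / (2 - ?w)" unfolding a using w2 by (simp add: divide_simps)
        then have "s z / (2 * of_int (-1) * s z + 1) = - 1 / ?w" unfolding a using w2 by simp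
        then show ?thesis unfolding b ..
      qed
      ultimately show ?thesis by blast
    qed
  qed
  have t12: "orb t (s z) \<Longrightarrow> orb t (s' z)" and t21: "orb t (s' z) \<Longrightarrow> orb t (s z)"
    if "z \<in> upper" "Im z = 0" for z t
  proof -
    have "z \<in> lower" using that by (auto simp: upper_def lower_def)
    then have u: "s z \<in> uhp" "s' z \<in> uhp" using s(2) s'u that by auto
    show "orb t (s z) \<Longrightarrow> orb t (s' z)" using trans[OF that] orb_shift orb_shear[OF _ u(2)] by metis
    show "orb t (s' z) \<Longrightarrow> orb t (s z)" using trans[OF that] orb_shift orb_shear[OF _ u(1)] by metis
  qed
  define X where "X = {t \<in> uhp. (lam t \<in> upper \<and> orb t (s (lam t))) \<or> (lam t \<in> lower \<and> orb t (s' (lam t)))}"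
  have local: "\<exists>N. open N \<and> t0 \<in> N \<and> N \<subseteq> uhp \<and> (N \<inter> X \<noteq> {} \<longrightarrow> N \<subseteq> X)" if t0: "t0 \<in> uhp" for t0
  proof -
    define z0 where "z0 = lam t0"
    have "open (- {0, 1} :: complex set)" by (intro open_Compl finite_imp_closed) simp
    moreover have "z0 \<in> - {0, 1}" using lam_omits[OF t0] by (simp add: z0_def)
    ultimately obtain e where e: "e > 0" "ball z0 e \<subseteq> - {0, 1}" using open_contains_ball by metis
    \<comment> \<open>The disc is either centred on the real axis, so that its centre lies in both
      closed half-planes, or it misses the axis. In all cases its parts in \<open>upper\<close> and
      \<open>lower\<close> are convex.\<close>
    define r where "r = (if Im z0 = 0 then e else min e \<bar>Im z0\<bar>)"
    have r: "r > 0" "r \<le> e" "Im z0 \<noteq> 0 \<Longrightarrow> r \<le> \<bar>Im z0\<bar>" using e by (auto simp: r_def)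
    have B01: "ball z0 r \<subseteq> - {0, 1}" using e(2) r(2) subset_ball by blast
    obtain f where f: "f holomorphic_on ball z0 (r / 2)" "f z0 = t0"
      "\<And>z. z \<in> ball z0 (r / 2) \<Longrightarrow> f z \<in> uhp \<and> lam (f z) = z"
      using lam_section[OF r(1) B01 t0] unfolding z0_def by metis
    let ?B = "ball z0 (r / 2)"
    have B: "z \<noteq> 0 \<and> z \<noteq> 1" if "z \<in> ?B" for z
    proof -
      have "z \<in> ball z0 r" using that r(1) by simp
      then have "z \<in> - {0, 1}" by (rule subsetD[OF B01])
      then show ?thesis by simp
    qed
    have z0B: "z0 \<in> ?B" using r by simp
    have cf: "continuous_on ?B f" using f(1) by (rule holomorphic_on_imp_continuous_on)
    have "inj_on f ?B" using f(3) by (metis inj_onI)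
    then have N: "open (f ` ?B)" using f(1) by (intro open_mapping_thm3) auto
    have BU: "?B \<inter> upper = ?B \<inter> {z. 0 \<le> Im z}" "?B \<inter> lower = ?B \<inter> {z. Im z \<le> 0}"
      using B unfolding upper_def lower_def by blast+
    have convU: "convex (?B \<inter> upper)" "convex (?B \<inter> lower)"
      unfolding BU by (intro convex_Int convex_ball convex_halfspace_Im_ge convex_halfspace_Im_le)+
    have up: "orb (f z) (s z)" if "w \<in> ?B" "w \<in> upper" "orb (f w) (s w)" "z \<in> ?B" "z \<in> upper" for z w
      by (rule orb_continue[OF convU(1) continuous_on_subset[OF cf] continuous_on_subset[OF s(1)], of w])
         (use f s(2) that in auto)
    have low: "orb (f z) (s' z)" if "w \<in> ?B" "w \<in> lower" "orb (f w) (s' w)" "z \<in> ?B" "z \<in> lower" for z w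
      by (rule orb_continue[OF convU(2) continuous_on_subset[OF cf] continuous_on_subset[OF s'c], of w])
         (use f s'u that in auto)
    have ImB: "\<bar>Im z - Im z0\<bar> < r / 2" if "z \<in> ?B" for z
      using that abs_Im_le_cmod[of "z - z0"] by (simp add: dist_norm norm_minus_commute)
    have "f ` ?B \<subseteq> X" if "f ` ?B \<inter> X \<noteq> {}"
    proof -
      from that obtain w where w: "w \<in> ?B" "f w \<in> X" by auto
      then have w': "(w \<in> upper \<and> orb (f w) (s w)) \<or> (w \<in> lower \<and> orb (f w) (s' w))"
        using f(3)[OF w(1)] by (simp add: X_def)
      have "(z \<in> upper \<and> orb (f z) (s z)) \<or> (z \<in> lower \<and> orb (f z) (s' z))" if z: "z \<in> ?B" for z
      proof -
        consider "Im z0 = 0" | "Im z0 > 0" | "Im z0 < 0" by linarith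
        then show ?thesis
        proof cases
          case 1
          then have z0: "z0 \<in> upper" "z0 \<in> lower" using B[OF z0B] by (auto simp: upper_def lower_def)
          have "orb t0 (s z0) \<and> orb t0 (s' z0)"
            using w' up[OF w(1) _ _ z0B z0(1)] low[OF w(1) _ _ z0B z0(2)] t12[OF z0(1) 1] t21[OF z0(1) 1] f(2) by auto
          moreover have "z \<in> upper \<or> z \<in> lower" using B[OF z] by (auto simp: upper_def lower_def)
          ultimately show ?thesis
            using up[OF z0B z0(1) _ z] low[OF z0B z0(2) _ z] f(2) by auto
        next
          case 2
          then have "r \<le> Im z0" using r(3) by simp
          then have pos: "0 < Im v" if "v \<in> ?B" for v using ImB[OF that] r(1) by linarith
          then have "w \<notin> lower" "z \<in> upper" using pos[OF w(1)] pos[OF z] B[OF z] by (auto simp: upper_def lower_def)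
          then show ?thesis using w' up[OF w(1) _ _ z] by blast
        next
          case 3
          then have "r \<le> - Im z0" using r(3) by simp
          then have neg: "Im v < 0" if "v \<in> ?B" for v using ImB[OF that] r(1) by linarith
          then have "w \<notin> upper" "z \<in> lower" using neg[OF w(1)] neg[OF z] B[OF z] by (auto simp: upper_def lower_def)
          then show ?thesis using w' low[OF w(1) _ _ z] by blast
        qed
      qed
      note * = this
      show ?thesis
      proof (rule image_subsetI)
        fix z assume "z \<in> ?B"
        from *[OF this] f(3)[OF this] show "f z \<in> X" unfolding X_def by auto
      qed
    qed
    then show ?thesis
      using N f z0B by (intro exI[of _ "f ` ?B"]) auto
  qed
  have Xu: "X \<subseteq> uhp" by (auto simp: X_def)
  have "open X"
  proof (subst open_subopen, intro ballI)
    fix x assume "x \<in> X"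
    then show "\<exists>T. open T \<and> x \<in> T \<and> T \<subseteq> X" using local[of x] Xu by blast
  qed
  moreover have "open (uhp - X)"
  proof (subst open_subopen, intro ballI)
    fix x assume "x \<in> uhp - X"
    then show "\<exists>T. open T \<and> x \<in> T \<and> T \<subseteq> uhp - X" using local[of x] by blast
  qed
  ultimately have "X = {} \<or> uhp - X = {}"
    using connectedD[OF convex_connected[OF convex_uhp], of X "uhp - X"] Xu by blast
  moreover have "s \<i> \<in> X"
  proof -
    have "\<i> \<in> upper" by (simp add: upper_def complex_eq_iff)
    moreover have "orb t t" for t unfolding orb_def
      by (rule exI[of _ 1], rule exI[of _ 0], rule exI[of _ 0], rule exI[of _ 1]) (simp add: gam_id mob_def)
    ultimately show ?thesis using s(2) by (simp add: X_def)
  qed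
  ultimately have "t \<in> X" using t by blast
  obtain x where x: "lam t = of_real x" "0 < x" "x < 1"
    using t(2) by (auto simp: unit_real_def elim!: Reals_cases)
  have U: "lam t \<in> upper" "Im (lam t) = 0" using x by (auto simp: upper_def)
  then have "orb t (s (lam t))" using \<open>t \<in> X\<close> t21[OF U] by (auto simp: X_def)
  moreover have "on_axis (s (lam t))" using s(2)[OF U(1)] s(3)[of x] x by (simp add: on_axis_def)
  ultimately show ?thesis using that s(2)[OF U(1)] by (auto simp: orb_def)
qed

section \<open>Lifting arcs of triples\<close>

text \<open>The geodesic from \<open>q/s\<close> to \<open>p/r\<close>, the image of the imaginary axis under \<open>mob p q r s\<close>.\<close>

definition geo :: "int \<Rightarrow> int \<Rightarrow> int \<Rightarrow> int \<Rightarrow> complex \<Rightarrow> bool" where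
  "geo p q r s t \<longleftrightarrow> of_int (r * s) * (norm t)\<^sup>2 - of_int (p * s + q * r) * Re t + of_int (p * q) = (0::real)"

lemma mob_inverse:
  assumes d: "p * s - q * r = (1::int)" and t: "t \<in> uhp"
  shows "mob s (- q) (- r) p t \<in> uhp" "mob p q r s (mob s (- q) (- r) p t) = t"
proof -
  have d': "s * p - (- q) * (- r) = 1" using d by (simp add: mult.commute)
  show "mob s (- q) (- r) p t \<in> uhp" by (rule mob_uhp[OF d' t])
  let ?e = "of_int (- r) * t + of_int p :: complex"
  have e: "?e \<noteq> 0" by (rule mob_denominator_nonzero[OF d' t])
  have d1: "of_int p * of_int s - of_int q * of_int r = (1::complex)"
    using d by (metis of_int_1 of_int_diff of_int_mult)
  have "of_int p * mob s (- q) (- r) p t + of_int q = (of_int p * of_int s - of_int q * of_int r) * t / ?e"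
    "of_int r * mob s (- q) (- r) p t + of_int s = (of_int p * of_int s - of_int q * of_int r) / ?e"
    unfolding mob_def using e by (simp_all add: add_divide_eq_iff algebra_simps)
  then show "mob p q r s (mob s (- q) (- r) p t) = t"
    unfolding d1 using e by (simp add: mob_def[of p])
qed

lemma geo_iff:
  assumes d: "p * s - q * r = (1::int)" and t: "t \<in> uhp"
  shows "geo p q r s t \<longleftrightarrow> Re (mob s (- q) (- r) p t) = 0"
proof -
  have d': "s * p - (- q) * (- r) = 1" using d by (simp add: mult.commute)
  have e: "of_int (- r) * t + of_int p \<noteq> (0 :: complex)" by (rule mob_denominator_nonzero[OF d' t])
  have "Re (mob s (- q) (- r) p t) = - (of_int (r * s) * (norm t)\<^sup>2 - of_int (p * s + q * r) * Re t + of_int (p * q))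
      / (norm (of_int (- r) * t + of_int p))\<^sup>2"
    unfolding mob_def Re_divide cmod_power2 by (simp add: power2_eq_square algebra_simps)
  then show ?thesis unfolding geo_def using e by (auto simp: divide_eq_0_iff)
qed

lemma geo_mob:
  assumes g: "gam p q r s" and t: "on_axis t"
  shows "geo p q r s (mob p q r s t)"
proof -
  have d: "p * s - q * r = 1" using gam_det[OF g] by simp
  have u: "t \<in> uhp" using t by (simp add: on_axis_def)
  have e: "of_int r * t + of_int s \<noteq> (0::complex)" by (rule mob_denominator_nonzero[OF d u])
  have d1: "of_int p * of_int s - of_int q * of_int r = (1::complex)"
    using d by (metis of_int_1 of_int_diff of_int_mult)
  have "of_int s * mob p q r s t + of_int (- q) = (of_int p * of_int s - of_int q * of_int r) * t / (of_int r * t + of_int s)"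
    "of_int (- r) * mob p q r s t + of_int p = (of_int p * of_int s - of_int q * of_int r) / (of_int r * t + of_int s)"
    unfolding mob_def using e by (simp_all add: diff_divide_eq_iff add_divide_eq_iff algebra_simps)
  then have "mob s (- q) (- r) p (mob p q r s t) = t"
    unfolding d1 using e by (simp add: mob_def[of s])
  then show ?thesis using geo_iff[OF d mob_uhp[OF d u]] t by (simp add: on_axis_def)
qed

lemma geo_unit_real:
  assumes g: "gam p q r s" and t: "t \<in> uhp" "geo p q r s t"
  shows "unit_real (lam t)"
proof -
  have d: "p * s - q * r = 1" using gam_det[OF g] by simp
  let ?u = "mob s (- q) (- r) p t"
  have "on_axis ?u" using geo_iff[OF d t(1)] t(2) mob_inverse[OF d t(1)] by (simp add: on_axis_def)
  then have "unit_real (lam ?u)" by (rule lam_axis_unit)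
  then show ?thesis using lam_mob[OF g mob_inverse(1)[OF d t(1)]] mob_inverse(2)[OF d t(1)] by simp
qed

lemma lift_stays_on_geo:
  assumes g: "gam p q r s" and X: "connected X" "continuous_on X c" and c: "\<And>x. x \<in> X \<Longrightarrow> c x \<in> uhp"
    and l: "\<And>x. x \<in> X \<Longrightarrow> unit_real (lam (c x))" and a: "a \<in> X" "geo p q r s (c a)" and x: "x \<in> X"
  shows "geo p q r s (c x)"
proof -
  have d: "p * s - q * r = 1" using gam_det[OF g] by simp
  have d': "s * p - (- q) * (- r) = 1" using d by (simp add: mult.commute)
  have "on_axis (mob s (- q) (- r) p (c x))"
  proof (rule lift_stays_on_axis[OF X(1) mob_continuous[OF d' X(2) c] _ _ a(1) _ x])
    show "unit_real (lam (mob s (- q) (- r) p (c y)))" if "y \<in> X" for y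
      using lam_mob[OF g mob_inverse(1)[OF d c[OF that]]] mob_inverse(2)[OF d c[OF that]] l[OF that] by simp
    show "Re (mob s (- q) (- r) p (c a)) = 0" using geo_iff[OF d c[OF a(1)]] a(2) by simp
  qed (use mob_inverse(1)[OF d c] in auto)
  then show ?thesis using geo_iff[OF d c[OF x]] by (simp add: on_axis_def)
qed

text \<open>Averaging points as positive definite quadratic forms \<open>(|t|\<^sup>2, Re t, 1) / Im t\<close>: geodesics are linear
  conditions on forms, hence preserved.\<close>

definition mix :: "real \<Rightarrow> complex \<Rightarrow> complex \<Rightarrow> complex" where
  "mix u a b = (let R = (1 - u) / Im a + u / Im b; Q = (1 - u) * Re a / Im a + u * Re b / Im b;
     P = (1 - u) * (norm a)\<^sup>2 / Im a + u * (norm b)\<^sup>2 / Im b in Complex (Q / R) (sqrt (P * R - Q\<^sup>2) / R))"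

text \<open>The form of a single point has determinant 1, and a convex combination has determinant
  at least 1. This keeps the square root in \<open>mix\<close> real and positive. \<open>A\<close>
  and \<open>B\<close> stand for the reciprocals of the imaginary parts, which makes the identity
  polynomial.\<close>

lemma mix_identity:
  fixes u xa xb ya yb A B :: real
  assumes "A * ya = 1" "B * yb = 1"
  shows "((1 - u) * (xa\<^sup>2 + ya\<^sup>2) * A + u * (xb\<^sup>2 + yb\<^sup>2) * B) * ((1 - u) * A + u * B)
    - ((1 - u) * xa * A + u * xb * B)\<^sup>2 = 1 + u * (1 - u) * ((xa - xb)\<^sup>2 + (ya - yb)\<^sup>2) * (A * B)"
  using assms by algebra

context
  fixes u :: real and a b :: complex
  assumes u: "0 \<le> u" "u \<le> 1" and ab: "a \<in> uhp" "b \<in> uhp"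
begin

lemma mix_aux:
  defines "R \<equiv> (1 - u) / Im a + u / Im b" and "Q \<equiv> (1 - u) * Re a / Im a + u * Re b / Im b"
    and "P \<equiv> (1 - u) * (norm a)\<^sup>2 / Im a + u * (norm b)\<^sup>2 / Im b"
  shows "R > 0" "P * R - Q\<^sup>2 \<ge> 1" "Re (mix u a b) = Q / R" "Im (mix u a b) = sqrt (P * R - Q\<^sup>2) / R"
    "(norm (mix u a b))\<^sup>2 = P / R"
proof -
  have i: "Im a > 0" "Im b > 0" using ab by (auto simp: uhp_def)
  show R: "R > 0"
  proof (cases "u = 0")
    case False
    then show ?thesis using i u unfolding R_def by (intro add_nonneg_pos) auto
  qed (use i in \<open>simp add: R_def\<close>)
  have "P * R - Q\<^sup>2 = 1 + u * (1 - u) * ((Re a - Re b)\<^sup>2 + (Im a - Im b)\<^sup>2) / (Im a * Im b)"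
    using mix_identity[of "1 / Im a" "Im a" "1 / Im b" "Im b" u "Re a" "Re b"] i
    unfolding P_def R_def Q_def cmod_power2 by simp
  moreover have "0 \<le> u * (1 - u) * ((Re a - Re b)\<^sup>2 + (Im a - Im b)\<^sup>2) / (Im a * Im b)"
    using u i by (intro divide_nonneg_pos mult_nonneg_nonneg add_nonneg_nonneg) auto
  ultimately show PQ: "P * R - Q\<^sup>2 \<ge> 1" by linarith
  show re: "Re (mix u a b) = Q / R" and im: "Im (mix u a b) = sqrt (P * R - Q\<^sup>2) / R"
    unfolding mix_def Let_def P_def Q_def R_def by simp_all
  have "(norm (mix u a b))\<^sup>2 = Q\<^sup>2 / R\<^sup>2 + (P * R - Q\<^sup>2) / R\<^sup>2"
    unfolding cmod_power2 re im using PQ by (simp add: power_divide)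
  then have "(norm (mix u a b))\<^sup>2 = P * R / R\<^sup>2" by (simp add: diff_divide_distrib)
  then show "(norm (mix u a b))\<^sup>2 = P / R" using R by (simp add: power2_eq_square)
qed

lemma mix_uhp: "mix u a b \<in> uhp"
  using mix_aux(1,2,4) by (simp add: uhp_def)

lemma mix_geo:
  assumes g: "geo p q r s a" "geo p q r s b"
  shows "geo p q r s (mix u a b)"
proof -
  have i: "Im a > 0" "Im b > 0" using ab by (auto simp: uhp_def)
  let ?R = "(1 - u) / Im a + u / Im b" and ?Q = "(1 - u) * Re a / Im a + u * Re b / Im b"
    and ?P = "(1 - u) * (norm a)\<^sup>2 / Im a + u * (norm b)\<^sup>2 / Im b"
  have "of_int (r * s) * ?P - of_int (p * s + q * r) * ?Q + of_int (p * q) * ?R =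
    (1 - u) / Im a * (of_int (r * s) * (norm a)\<^sup>2 - of_int (p * s + q * r) * Re a + of_int (p * q)) +
    u / Im b * (of_int (r * s) * (norm b)\<^sup>2 - of_int (p * s + q * r) * Re b + of_int (p * q))"
    by (simp add: algebra_simps)
  also have "\<dots> = 0" using g by (simp only: geo_def mult_zero_right add_0)
  finally have eq: "of_int (r * s) * ?P - of_int (p * s + q * r) * ?Q + of_int (p * q) * ?R = 0" .
  have lin: "X * (P / R) - Y * (Q / R) + Z = 0" if "X * P - Y * Q + Z * R = 0" "R > 0" for X P Y Q Z R :: real
    using that by (simp add: field_simps)
  have "of_int (r * s) * (?P / ?R) - of_int (p * s + q * r) * (?Q / ?R) + of_int (p * q) = (0::real)"
    by (rule lin[OF eq mix_aux(1)])
  then show ?thesis unfolding geo_def mix_aux(3,5) .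
qed

lemma mix_Re_0: "Re a = 0 \<Longrightarrow> Re b = 0 \<Longrightarrow> Re (mix u a b) = 0"
  using mix_aux(3) by simp

end

lemma mix_0: "a \<in> uhp \<Longrightarrow> mix 0 a b = a"
proof -
  assume a: "a \<in> uhp"
  have "(norm a)\<^sup>2 / Im a * (1 / Im a) - (Re a / Im a)\<^sup>2 = 1"
    using a unfolding cmod_power2 by (simp add: uhp_def field_simps power2_eq_square)
  then show ?thesis using a by (simp add: mix_def uhp_def complex_eq_iff)
qed

lemma mix_1: "b \<in> uhp \<Longrightarrow> mix 1 a b = b"
proof -
  assume a: "b \<in> uhp"
  have "(norm b)\<^sup>2 / Im b * (1 / Im b) - (Re b / Im b)\<^sup>2 = 1"
    using a unfolding cmod_power2 by (simp add: uhp_def field_simps power2_eq_square)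
  then show ?thesis using a by (simp add: mix_def uhp_def complex_eq_iff)
qed

lemma continuous_on_mix:
  assumes "continuous_on X u" "continuous_on X a" "continuous_on X b"
    and X: "\<And>x. x \<in> X \<Longrightarrow> 0 \<le> u x \<and> u x \<le> 1 \<and> a x \<in> uhp \<and> b x \<in> uhp"
  shows "continuous_on X (\<lambda>x. mix (u x) (a x) (b x))"
proof -
  have n: "Im (a x) \<noteq> 0" "Im (b x) \<noteq> 0" "(1 - u x) / Im (a x) + u x / Im (b x) \<noteq> 0" if "x \<in> X" for x
    using X[OF that] mix_aux(1)[of "u x" "a x" "b x"] by (auto simp: uhp_def)
  show ?thesis
    unfolding mix_def Let_def Complex_eq using n by (intro continuous_intros assms) auto
qed

section \<open>Triples up to affine maps\<close>

definition ratio :: "(nat \<Rightarrow> complex) \<Rightarrow> complex" where "ratio z = (z 1 - z 0) / (z 2 - z 0)"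

lemma all_less_3: "(\<forall>j<3. P j) \<longleftrightarrow> P 0 \<and> P 1 \<and> P (2::nat)"
  by (auto simp: numeral_3_eq_3 numeral_2_eq_2 less_Suc_eq)

lemma conf_3: "conf 3 z \<longleftrightarrow> z 0 \<noteq> z 1 \<and> z 0 \<noteq> z 2 \<and> z 1 \<noteq> z 2"
  unfolding conf_def all_less_3 by auto

lemma real_conf_3: "real_conf 3 z \<longleftrightarrow> conf 3 z \<and> z 0 \<in> \<real> \<and> z 1 \<in> \<real> \<and> z 2 \<in> \<real>"
  unfolding real_conf_def all_less_3 by auto

lemma incr_real_conf_3: "incr_real_conf 3 z \<longleftrightarrow> real_conf 3 z \<and> Re (z 0) < Re (z 1) \<and> Re (z 1) < Re (z 2)"
proof -
  have "(\<forall>j k. j < k \<and> k < 3 \<longrightarrow> Re (z j) < Re (z k)) \<longleftrightarrow> (\<forall>k<3. \<forall>j<3. j < k \<longrightarrow> Re (z j) < Re (z k))"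
    by (meson less_trans)
  also have "\<dots> \<longleftrightarrow> Re (z 0) < Re (z 1) \<and> Re (z 1) < Re (z 2)"
    unfolding all_less_3 by auto
  finally show ?thesis unfolding incr_real_conf_def by simp
qed

lemma ratio_omits: "conf 3 z \<Longrightarrow> ratio z \<noteq> 0 \<and> ratio z \<noteq> 1"
  by (auto simp: conf_3 ratio_def)

lemma ratio_unit_real: "incr_real_conf 3 z \<Longrightarrow> unit_real (ratio z)"
  unfolding incr_real_conf_3 real_conf_3 ratio_def unit_real_def
  by (auto elim!: Reals_cases simp flip: of_real_diff of_real_divide)

lemma ratio_real: "real_conf 3 z \<Longrightarrow> ratio z \<in> \<real>"
  unfolding real_conf_3 ratio_def by auto

lemma unit_real_incr:
  assumes z: "z 0 \<in> \<real>" "unit_real f" "d \<in> \<real>" "0 < Re d" "z 1 = z 0 + d * f" "z 2 = z 0 + d"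
  shows "incr_real_conf 3 z"
proof -
  obtain x y v where "z 0 = of_real x" "f = of_real y" "d = of_real v" "0 < y" "y < 1" "0 < v"
    using z(1-4) by (auto simp: unit_real_def elim!: Reals_cases)
  then show ?thesis using z(5,6)
    unfolding incr_real_conf_3 real_conf_3 conf_3 by auto
qed

lemma continuous_on_ratio:
  assumes "\<forall>j<3. continuous_on X (\<lambda>x. g x j)" "\<And>x. x \<in> X \<Longrightarrow> conf 3 (g x)"
  shows "continuous_on X (\<lambda>x. ratio (g x))"
proof -
  have "continuous_on X (\<lambda>x. g x 0)" "continuous_on X (\<lambda>x. g x 1)" "continuous_on X (\<lambda>x. g x 2)"
    using assms(1) unfolding all_less_3 by auto
  moreover have "g x 2 - g x 0 \<noteq> 0" if "x \<in> X" for x using assms(2)[OF that] by (auto simp: conf_3)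
  ultimately show ?thesis unfolding ratio_def by (intro continuous_intros) auto
qed

text \<open>The lift is asked to start somewhere on the axis; by \<open>lam_axis_inj\<close> and
  uniqueness of lifts it is then determined by \<open>g\<close>. Its end is recorded as lying on the
  image of the axis under the matrix.\<close>

definition ends_in :: "(real \<Rightarrow> nat \<Rightarrow> complex) \<Rightarrow> int \<Rightarrow> int \<Rightarrow> int \<Rightarrow> int \<Rightarrow> bool" where
  "ends_in g p q r s \<longleftrightarrow> (\<exists>c. continuous_on {0..1} c \<and> (\<forall>t\<in>{0..1}. c t \<in> uhp \<and> lam (c t) = ratio (g t)) \<and>
     Re (c 0) = 0 \<and> geo p q r s (c 1))"

lemma ends_in_exists:
  assumes g: "tr_arc 3 g" "incr_real_conf 3 (g 1)"
  obtains p q r s where "gam p q r s" "ends_in g p q r s"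
proof -
  have c: "conf 3 (g t)" if "t \<in> {0..1}" for t using g that by (simp add: tr_arc_def)
  have "unit_real (ratio (g 0))" using g by (simp add: tr_arc_def ratio_unit_real)
  then obtain x where x: "ratio (g 0) = of_real x" "0 < x" "x < 1"
    by (auto simp: unit_real_def elim!: Reals_cases)
  obtain y where y: "\<And>v. 0 < v \<Longrightarrow> v < 1 \<Longrightarrow> 0 < y v \<and> lam (\<i> * of_real (y v)) = of_real v"
    using axis_inverse by metis
  have a: "\<i> * of_real (y x) \<in> uhp" "lam (\<i> * of_real (y x)) = ratio (g 0)"
    using y[OF x(2,3)] x(1) by (auto simp: uhp_def)
  have "continuous_on {0..1} (\<lambda>t. ratio (g t))"
    using g c by (intro continuous_on_ratio) (auto simp: tr_arc_def)
  then obtain f where f: "continuous_on {0..1} f" "\<And>t. t \<in> {0..1} \<Longrightarrow> f t \<in> uhp \<and> lam (f t) = ratio (g t)" "f 0 = \<i> * of_real (y x)"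
    using lam_lift[of "{0..1}" "\<lambda>t. ratio (g t)" 0 "\<i> * of_real (y x)"] ratio_omits c a
    by (metis atLeastAtMost_iff convex_imp_locally_path_connected convex_imp_simply_connected convex_real_interval(5) order_refl zero_le_one)
  have f1: "f 1 \<in> uhp" "unit_real (lam (f 1))" using f(2)[of 1] ratio_unit_real[OF g(2)] by auto
  obtain p q r s b where "gam p q r s" "on_axis b" "f 1 = mob p q r s b" using orbit_of_axis[OF f1] by metis
  then show ?thesis
    using that f geo_mob unfolding ends_in_def by (metis Re_i_times Im_complex_of_real neg_equal_0_iff_equal)
qed

lemma tr_homotopic_sym: "tr_homotopic n g h \<Longrightarrow> tr_homotopic n h g"
proof -
  assume "tr_homotopic n g h"
  then obtain H :: "real \<times> real \<Rightarrow> nat \<Rightarrow> complex" where H: "\<forall>j<n. continuous_on ({0..1} \<times> {0..1}) (\<lambda>p. H p j)"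
    "\<forall>p\<in>{0..1} \<times> {0..1}. conf n (H p)"
    "\<forall>s\<in>{0..1}. incr_real_conf n (H (s, 0)) \<and> real_conf n (H (s, 1))"
    "\<forall>t\<in>{0..1}. \<forall>j<n. H (0, t) j = g t j \<and> H (1, t) j = h t j"
    unfolding tr_homotopic_def by (elim exE conjE) (rule that; assumption)
  let ?H = "\<lambda>p. H (1 - fst p, snd p)"
  have m: "(1 - fst p, snd p) \<in> {0..1} \<times> {0..1}" if "p \<in> {0..1} \<times> {0..1}" for p :: "real \<times> real"
    using that by auto
  have "continuous_on ({0..1} \<times> {0..1}) (\<lambda>p. ?H p j)" if "j < n" for j
    by (rule continuous_on_compose2[OF H(1)[rule_format, OF that]]) (auto intro!: continuous_intros)
  then show ?thesis unfolding tr_homotopic_def using H(2-4) m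
    by (intro exI[of _ ?H]) auto
qed

lemma unit_real_connected:
  assumes X: "connected X" "continuous_on X f" and f: "\<And>x. x \<in> X \<Longrightarrow> f x \<in> \<real> \<and> f x \<noteq> 0 \<and> f x \<noteq> 1"
    and a: "a \<in> X" "unit_real (f a)" and x: "x \<in> X"
  shows "unit_real (f x)"
proof -
  have c: "connected ((\<lambda>x. Re (f x)) ` X)" using X by (intro connected_continuous_image continuous_intros)
  have ne: "Re (f y) \<noteq> 0 \<and> Re (f y) \<noteq> 1" if "y \<in> X" for y
    using f[OF that] by (auto elim!: Reals_cases)
  have a1: "0 < Re (f a)" "Re (f a) < 1" using a(2) by (auto simp: unit_real_def)
  have "0 < Re (f x)"
  proof (rule ccontr)
    assume "\<not> 0 < Re (f x)"
    then have "0 \<in> (\<lambda>x. Re (f x)) ` X"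
      using connected_contains_Icc[OF c imageI[OF x] imageI[OF a(1)]] a1 by (auto simp: subset_iff)
    then show False using ne by auto
  qed
  moreover have "Re (f x) < 1"
  proof (rule ccontr)
    assume "\<not> Re (f x) < 1"
    then have "1 \<in> (\<lambda>x. Re (f x)) ` X"
      using connected_contains_Icc[OF c imageI[OF a(1)] imageI[OF x]] a1 by (auto simp: subset_iff)
    then show False using ne by auto
  qed
  ultimately show ?thesis using f[OF x] by (simp add: unit_real_def)
qed

text \<open>The whole homotopy is lifted. One side of the square stays on the axis. On the opposite
  side the configurations are only known to be real, but their ratio cannot leave (0,1) without
  meeting 0 or 1, so the lift stays on the geodesic.\<close>

lemma ends_in_homotopic:
  assumes hom: "tr_homotopic 3 g h" and gam: "gam p q r s" and g: "ends_in g p q r s"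
  shows "ends_in h p q r s"
proof -
  obtain H :: "real \<times> real \<Rightarrow> nat \<Rightarrow> complex" where H: "\<forall>j<3. continuous_on ({0..1} \<times> {0..1}) (\<lambda>p. H p j)"
    "\<forall>p\<in>{0..1} \<times> {0..1}. conf 3 (H p)"
    "\<forall>s\<in>{0..1}. incr_real_conf 3 (H (s, 0)) \<and> real_conf 3 (H (s, 1))"
    "\<forall>t\<in>{0..1}. \<forall>j<3. H (0, t) j = g t j \<and> H (1, t) j = h t j"
    using hom unfolding tr_homotopic_def by (elim exE conjE) (rule that; assumption)
  let ?Q = "{0..1} \<times> {0..1} :: (real \<times> real) set"
  obtain c where c: "continuous_on {0..1} c" "\<And>t. t \<in> {0..1} \<Longrightarrow> c t \<in> uhp \<and> lam (c t) = ratio (g t)"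
     "Re (c 0) = 0" "geo p q r s (c 1)" using g unfolding ends_in_def by blast
  have r0: "ratio (H (0, t)) = ratio (g t)" "ratio (H (1, t)) = ratio (h t)" if "t \<in> {0..1}" for t
    using H(4) that unfolding all_less_3 ratio_def by auto
  have cr: "continuous_on ?Q (\<lambda>p. ratio (H p))" using H by (intro continuous_on_ratio) auto
  have cvx: "convex ?Q" by (intro convex_Times) auto
  obtain L where L: "continuous_on ?Q L" "\<And>p. p \<in> ?Q \<Longrightarrow> L p \<in> uhp \<and> lam (L p) = ratio (H p)" "L (0, 0) = c 0"
  proof (rule lam_lift[OF convex_imp_simply_connected[OF cvx] convex_imp_locally_path_connected[OF cvx] cr])
    show "ratio (H x) \<noteq> 0 \<and> ratio (H x) \<noteq> 1" if "x \<in> ?Q" for x using H(2) that ratio_omits by blast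
    show "(0, 0) \<in> ?Q" by simp
    show "c 0 \<in> uhp" "ratio (H (0, 0)) = lam (c 0)" using c(2)[of 0] r0(1)[of 0] by auto
  qed (rule that)
  have sub: "continuous_on {0..1} (\<lambda>t. L (a, t))" "continuous_on {0..1} (\<lambda>t. L (t, a))" if "a \<in> {0..1}" for a
    by (rule continuous_on_compose2[OF L(1)]; use that in \<open>auto intro!: continuous_intros\<close>)+
  have con: "connected {0..1::real}" by simp
  have Lc: "L (0, t) = c t" if "t \<in> {0..1}" for t
    by (rule lam_sections_agree[OF con sub(1) c(1), of 0 0]) (use that L(2,3) c(2) r0 in auto)
  have "on_axis (L (1, 0))"
    by (rule lift_stays_on_axis[OF con sub(2), of 0 0 1])
       (use L(2,3) c(3) H(3) ratio_unit_real in auto)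
  moreover have "geo p q r s (L (1, 1))"
  proof (rule lift_stays_on_geo[OF gam con sub(2), of 1 0 1])
    show "geo p q r s (L (0, 1))" using Lc[of 1] c(4) by simp
    have u0: "unit_real (ratio (H (0, 1)))"
      using geo_unit_real[OF gam _ c(4)] c(2)[of 1] r0(1)[of 1] by simp
    show "unit_real (lam (L (x, 1)))" if x: "x \<in> {0..1}" for x
    proof -
      have "unit_real (ratio (H (x, 1)))"
        by (rule unit_real_connected[OF con, of "\<lambda>x. ratio (H (x, 1))" 0])
           (use x u0 H(2,3) ratio_real ratio_omits in \<open>auto intro!: continuous_on_compose2[OF cr] continuous_intros\<close>)
      then show ?thesis using L(2)[of "(x, 1)"] x by simp
    qed
  qed (use L(2) in auto)
  ultimately show ?thesis
    unfolding ends_in_def using L(2) r0(2) sub(1)[of 1]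
    by (intro exI[of _ "\<lambda>t. L (1, t)"]) (auto simp: on_axis_def)
qed

section \<open>Classes of arcs\<close>

text \<open>The number of full turns of the difference of the outer points. It is the coordinate
  that \<open>ratio\<close> forgets, and the full twist with parameter k raises it by k.\<close>

definition wind :: "(real \<Rightarrow> nat \<Rightarrow> complex) \<Rightarrow> int \<Rightarrow> bool" where
  "wind g n \<longleftrightarrow> (\<exists>l. continuous_on {0..1} l \<and> (\<forall>t\<in>{0..1}. g t 2 - g t 0 = exp (l t)) \<and>
     Im (l 0) = 0 \<and> Im (l 1) = 2 * pi * of_int n)"

lemma incr_difference:
  assumes "incr_real_conf 3 z"
  obtains d where "z 2 - z 0 = of_real d" "0 < d"
proof (rule that[of "Re (z 2) - Re (z 0)"])
  show "z 2 - z 0 = of_real (Re (z 2) - Re (z 0))" "0 < Re (z 2) - Re (z 0)"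
    using assms unfolding incr_real_conf_3 real_conf_3 by (auto simp: complex_eq_iff complex_is_Real_iff)
qed

lemma exp_eq_pos_real:
  assumes "exp l = complex_of_real d" "0 < d"
  obtains n :: int where "Im l = 2 * pi * of_int n"
proof -
  have "exp l = exp (of_real (ln d))" using assms by (simp add: exp_of_real)
  then obtain n :: int where "l = of_real (ln d) + complex_of_real (of_int (2 * n) * pi) * \<i>"
    unfolding exp_eq by auto
  then show ?thesis by (intro that[of n]) simp
qed

lemma tr_arc_3:
  assumes "tr_arc 3 g"
  shows "continuous_on {0..1} (\<lambda>t. g t 0)" "continuous_on {0..1} (\<lambda>t. g t 1)" "continuous_on {0..1} (\<lambda>t. g t 2)"
    "\<And>t. t \<in> {0..1} \<Longrightarrow> conf 3 (g t)" "\<And>t. t \<in> {0..1} \<Longrightarrow> g t 2 - g t 0 \<noteq> 0"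
    "incr_real_conf 3 (g 0)" "real_conf 3 (g 1)"
proof -
  show c: "conf 3 (g t)" if "t \<in> {0..1}" for t using assms that by (simp add: tr_arc_def)
  show "g t 2 - g t 0 \<noteq> 0" if "t \<in> {0..1}" for t using c[OF that] by (auto simp: conf_3)
qed (use assms in \<open>auto simp: tr_arc_def all_less_3\<close>)

lemma wind_exists:
  assumes g: "tr_arc 3 g" "incr_real_conf 3 (g 1)"
  obtains n where "wind g n"
proof -
  note g' = tr_arc_3[OF g(1)]
  have cd: "continuous_on {0..1} (\<lambda>t. g t 2 - g t 0)" by (intro continuous_intros g')
  obtain l where l: "continuous_on {0..1} l" "\<And>t. t \<in> {0..1} \<Longrightarrow> g t 2 - g t 0 = exp (l t)"
    using continuous_logarithm_on_contractible[OF cd convex_imp_contractible[OF convex_real_interval(5)] g'(5)] by blast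
  obtain d0 where d0: "g 0 2 - g 0 0 = of_real d0" "0 < d0" using incr_difference[OF g'(6)] by metis
  obtain d1 where d1: "g 1 2 - g 1 0 = of_real d1" "0 < d1" using incr_difference[OF g(2)] by metis
  obtain a where a: "Im (l 0) = 2 * pi * of_int a" using exp_eq_pos_real[of "l 0" d0] l(2)[of 0] d0 by auto
  obtain b where b: "Im (l 1) = 2 * pi * of_int b" using exp_eq_pos_real[of "l 1" d1] l(2)[of 1] d1 by auto
  let ?l = "\<lambda>t. l t - complex_of_real (of_int (2 * a) * pi) * \<i>"
  have "exp (?l t) = exp (l t)" for t unfolding exp_eq by (intro exI[of _ "- a"]) simp
  then have "wind g (b - a)"
    unfolding wind_def using l a b
    by (intro exI[of _ ?l]) (auto intro!: continuous_intros simp: algebra_simps)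
  then show ?thesis by (rule that)
qed

text \<open>Three independent coordinates are interpolated: the point 0 linearly, the logarithm of
  the difference of points 2 and 0 linearly, and the lifted ratio by \<open>mix\<close>. Equal
  winding keeps the difference positive at the end, and \<open>mix\<close> keeps the lifts on the
  axis and on the geodesic.\<close>

lemma tr_homotopic_if:
  assumes g: "tr_arc 3 g" "incr_real_conf 3 (g 1)" and h: "tr_arc 3 h" "incr_real_conf 3 (h 1)"
    and gam: "gam p q r s" and e: "ends_in g p q r s" "ends_in h p q r s" and w: "wind g n" "wind h n"
  shows "tr_homotopic 3 g h"
proof -
  note g' = tr_arc_3[OF g(1)] and h' = tr_arc_3[OF h(1)]
  obtain c where c: "continuous_on {0..1} c" "\<And>t. t \<in> {0..1} \<Longrightarrow> c t \<in> uhp \<and> lam (c t) = ratio (g t)"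
     "Re (c 0) = 0" "geo p q r s (c 1)" using e(1) unfolding ends_in_def by blast
  obtain d where d: "continuous_on {0..1} d" "\<And>t. t \<in> {0..1} \<Longrightarrow> d t \<in> uhp \<and> lam (d t) = ratio (h t)"
     "Re (d 0) = 0" "geo p q r s (d 1)" using e(2) unfolding ends_in_def by blast
  obtain l where l: "continuous_on {0..1} l" "\<And>t. t \<in> {0..1} \<Longrightarrow> g t 2 - g t 0 = exp (l t)"
     "Im (l 0) = 0" "Im (l 1) = 2 * pi * of_int n" using w(1) unfolding wind_def by blast
  obtain m where m: "continuous_on {0..1} m" "\<And>t. t \<in> {0..1} \<Longrightarrow> h t 2 - h t 0 = exp (m t)"
     "Im (m 0) = 0" "Im (m 1) = 2 * pi * of_int n" using w(2) unfolding wind_def by blast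
  let ?Q = "{0..1} \<times> {0..1} :: (real \<times> real) set"
  define B where "B x = of_real (1 - fst x) * g (snd x) 0 + of_real (fst x) * h (snd x) 0" for x :: "real \<times> real"
  define k where "k x = of_real (1 - fst x) * l (snd x) + of_real (fst x) * m (snd x)" for x :: "real \<times> real"
  define M where "M x = mix (fst x) (c (snd x)) (d (snd x))" for x :: "real \<times> real"
  define H where "H x j = B x + exp (k x) * (if j = 0 then 0 else if j = 1 then lam (M x) else 1)"
    for x :: "real \<times> real" and j :: nat
  have c2: "continuous_on ?Q (\<lambda>x. f (snd x))" if "continuous_on {0..1} f" for f :: "real \<Rightarrow> complex"
    by (rule continuous_on_compose2[OF that]) (auto intro!: continuous_intros)
  have Mu: "M x \<in> uhp" if "x \<in> ?Q" for x
    unfolding M_def using that c(2)[of "snd x"] d(2)[of "snd x"] by (intro mix_uhp) auto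
  have Mc: "continuous_on ?Q M"
    unfolding M_def by (intro continuous_on_mix c2 c(1) d(1) continuous_intros) (use c(2) d(2) in auto)
  have lM: "continuous_on ?Q (\<lambda>x. lam (M x))"
    by (rule continuous_on_compose2[OF holomorphic_on_imp_continuous_on[OF lam_holomorphic] Mc]) (use Mu in auto)
  have kc: "continuous_on ?Q k" unfolding k_def by (intro continuous_intros c2 l(1) m(1))
  have Bc: "continuous_on ?Q B" unfolding B_def by (intro continuous_intros c2 g'(1) h'(1))
  have "continuous_on ?Q (\<lambda>x. H x j)" for j
    unfolding H_def by (cases "j = 0"; cases "j = 1") (auto intro!: continuous_intros lM kc Bc)
  moreover have "conf 3 (H x)" if "x \<in> ?Q" for x
    using lam_omits[OF Mu[OF that]] by (auto simp: conf_3 H_def)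
  moreover have "incr_real_conf 3 (H (u, 0))" "incr_real_conf 3 (H (u, 1))" if u: "u \<in> {0..1}" for u
  proof -
    have "Re (M (u, 0)) = 0"
      unfolding M_def using u c(2)[of 0] d(2)[of 0] c(3) d(3) by (simp add: mix_Re_0)
    then have u0: "unit_real (lam (M (u, 0)))"
      using Mu[of "(u, 0)"] u by (intro lam_axis_unit) (simp add: on_axis_def)
    have "geo p q r s (M (u, 1))"
      unfolding M_def using u c(2)[of 1] d(2)[of 1] c(4) d(4) by (simp add: mix_geo)
    then have u1: "unit_real (lam (M (u, 1)))"
      using Mu[of "(u, 1)"] u by (intro geo_unit_real[OF gam]) auto
    have k0: "exp (k (u, 0)) = of_real (exp (Re (k (u, 0))))"
      using l(3) m(3) by (simp add: k_def complex_eq_iff Re_exp Im_exp)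
    have "Im (k (u, 1)) = 2 * pi * of_int n" using l(4) m(4) by (simp add: k_def algebra_simps)
    then have k1: "exp (k (u, 1)) = of_real (exp (Re (k (u, 1))))"
      by (simp add: complex_eq_iff Re_exp Im_exp)
    have B: "B (u, 0) \<in> \<real>" "B (u, 1) \<in> \<real>"
      using g'(6) h'(6) g(2) h(2) unfolding B_def incr_real_conf_3 real_conf_3 by auto
    have H: "H x 0 = B x" "H x 1 = H x 0 + exp (k x) * lam (M x)" "H x 2 = H x 0 + exp (k x)" for x
      by (simp_all add: H_def)
    show "incr_real_conf 3 (H (u, 0))"
      by (rule unit_real_incr[OF _ u0 _ _ H(2,3)]) (unfold H(1) k0, use B in simp_all)
    show "incr_real_conf 3 (H (u, 1))"
      by (rule unit_real_incr[OF _ u1 _ _ H(2,3)]) (unfold H(1) k1, use B in simp_all)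
  qed
  moreover have "H (0, t) j = g t j \<and> H (1, t) j = h t j" if t: "t \<in> {0..1}" and j: "j < 3" for t j
  proof -
    have M: "lam (M (0, t)) = ratio (g t)" "lam (M (1, t)) = ratio (h t)"
      using c(2)[OF t] d(2)[OF t] by (simp_all add: M_def mix_0 mix_1)
    have k: "exp (k (0, t)) = g t 2 - g t 0" "exp (k (1, t)) = h t 2 - h t 0"
      using l(2)[OF t] m(2)[OF t] by (simp_all add: k_def)
    have "\<forall>j<3. H (0, t) j = g t j \<and> H (1, t) j = h t j"
      unfolding all_less_3 using g'(5)[OF t] h'(5)[OF t]
      by (simp add: H_def B_def M k ratio_def)
    then show ?thesis using j by blast
  qed
  ultimately show ?thesis
    unfolding tr_homotopic_def by (intro exI[of _ H]) (auto simp: incr_real_conf_def)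
qed

context
  fixes g :: "real \<Rightarrow> nat \<Rightarrow> complex" and k :: int
  assumes g: "tr_arc 3 g" "incr_real_conf 3 (g 1)"
begin

text \<open>Clamping both time parameters gives one formula for the two halves: the rotation factor
  is 1 up to time 1/2, and \<open>g\<close> rests at its end point afterwards.\<close>

lemma twist_eq:
  "(g +++ full_twist k (g 1)) t j = exp (2 * pi * \<i> * of_int k * of_real (max 0 (2 * t - 1))) * g (min 1 (2 * t)) j"
  by (cases "t \<le> 1 / 2") (auto simp: joinpaths_def full_twist_def)

lemma exp_full_twist: "exp (2 * of_real pi * \<i> * of_int k) = (1 :: complex)"
proof -
  have "exp (2 * of_real pi * \<i> * of_int k) = exp (0 :: complex)"
    unfolding exp_eq by (intro exI[of _ k]) (simp add: algebra_simps)
  then show ?thesis by simp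
qed

lemma twist_end: "(g +++ full_twist k (g 1)) 0 = g 0" "(g +++ full_twist k (g 1)) 1 = g 1"
  unfolding fun_eq_iff twist_eq by (simp_all add: exp_full_twist)

lemma continuous_twist:
  assumes "continuous_on {0..1} f"
  shows "continuous_on {0..1} (\<lambda>t::real. f (min 1 (2 * t)) :: complex)"
  by (rule continuous_on_compose2[OF assms]) (auto intro!: continuous_intros)

lemma twist_tr_arc: "tr_arc 3 (g +++ full_twist k (g 1))"
proof -
  note g' = tr_arc_3[OF g(1)]
  have "conf 3 ((g +++ full_twist k (g 1)) t)" if "t \<in> {0..1}" for t
    using g'(4)[of "min 1 (2 * t)"] that unfolding conf_3 twist_eq by auto
  moreover have "continuous_on {0..1} (\<lambda>t. (g +++ full_twist k (g 1)) t j)" if "j < 3" for j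
    unfolding twist_eq using that g(1) unfolding tr_arc_def
    by (intro continuous_intros continuous_twist) auto
  ultimately show ?thesis unfolding tr_arc_def twist_end using g by (auto simp: tr_arc_def)
qed

lemma twist_ends_in:
  assumes "ends_in g p q r s"
  shows "ends_in (g +++ full_twist k (g 1)) p q r s"
proof -
  obtain c where c: "continuous_on {0..1} c" "\<And>t. t \<in> {0..1} \<Longrightarrow> c t \<in> uhp \<and> lam (c t) = ratio (g t)"
     "Re (c 0) = 0" "geo p q r s (c 1)" using assms unfolding ends_in_def by blast
  have "ratio ((g +++ full_twist k (g 1)) t) = ratio (g (min 1 (2 * t)))" for t
    unfolding ratio_def twist_eq by (simp flip: right_diff_distrib)
  then show ?thesis
    unfolding ends_in_def using c continuous_twist[OF c(1)]
    by (intro exI[of _ "\<lambda>t. c (min 1 (2 * t))"]) auto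
qed

lemma twist_wind:
  assumes "wind g n"
  shows "wind (g +++ full_twist k (g 1)) (n + k)"
proof -
  obtain l where l: "continuous_on {0..1} l" "\<And>t. t \<in> {0..1} \<Longrightarrow> g t 2 - g t 0 = exp (l t)"
     "Im (l 0) = 0" "Im (l 1) = 2 * pi * of_int n" using assms unfolding wind_def by blast
  let ?l = "\<lambda>t. 2 * pi * \<i> * of_int k * of_real (max 0 (2 * t - 1)) + l (min 1 (2 * t))"
  have "continuous_on {0..1} ?l" by (intro continuous_intros continuous_twist l(1))
  moreover have "(g +++ full_twist k (g 1)) t 2 - (g +++ full_twist k (g 1)) t 0 = exp (?l t)" if "t \<in> {0..1}" for t
    using l(2)[of "min 1 (2 * t)"] that unfolding twist_eq
    by (auto simp: exp_add simp flip: right_diff_distrib)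
  ultimately show ?thesis
    unfolding wind_def using l(3,4) by (intro exI[of _ ?l]) (auto simp: algebra_simps)
qed

end

text \<open>Distinct real points keep their order by the intermediate value theorem. Classes are
  formed among all arcs, so this is what keeps every member of a pure class pure.\<close>

lemma tr_homotopic_incr_end:
  assumes hom: "tr_homotopic 3 g h" and h: "incr_real_conf 3 (h 1)"
  shows "incr_real_conf 3 (g 1)"
proof -
  obtain H :: "real \<times> real \<Rightarrow> nat \<Rightarrow> complex" where H: "\<forall>j<3. continuous_on ({0..1} \<times> {0..1}) (\<lambda>p. H p j)"
    "\<forall>p\<in>{0..1} \<times> {0..1}. conf 3 (H p)"
    "\<forall>s\<in>{0..1}. incr_real_conf 3 (H (s, 0)) \<and> real_conf 3 (H (s, 1))"
    "\<forall>t\<in>{0..1}. \<forall>j<3. H (0, t) j = g t j \<and> H (1, t) j = h t j"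
    using hom unfolding tr_homotopic_def by (elim exE conjE) (rule that; assumption)
  have c: "continuous_on {0..1} (\<lambda>s. Re (H (s, 1) j))" if "j < 3" for j
  proof -
    have "continuous_on {0..1} (\<lambda>s. H (s, 1) j)"
      by (rule continuous_on_compose2[OF H(1)[rule_format, OF that]]) (auto intro!: continuous_intros)
    then show ?thesis by (intro continuous_intros)
  qed
  have pos: "Re (H (0, 1) i) < Re (H (0, 1) j)"
    if ij: "i < 3" "j < 3" "i \<noteq> j" and p: "Re (H (1, 1) i) < Re (H (1, 1) j)" for i j
  proof (rule ccontr)
    assume n: "\<not> ?thesis"
    have "\<exists>s\<ge>0. s \<le> 1 \<and> Re (H (s, 1) j) - Re (H (s, 1) i) = 0"
      by (rule IVT') (use n p in \<open>auto intro!: continuous_on_diff c ij\<close>)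
    then obtain s where s: "s \<in> {0..1}" "Re (H (s, 1) j) = Re (H (s, 1) i)" by auto
    then have "H (s, 1) j \<in> \<real>" "H (s, 1) i \<in> \<real>" "conf 3 (H (s, 1))" using H(3) ij by (auto simp: real_conf_def)
    then have "H (s, 1) i = H (s, 1) j" using s(2) by (auto simp: complex_eq_iff complex_is_Real_iff)
    then show False using \<open>conf 3 (H (s, 1))\<close> ij by (auto simp: conf_def)
  qed
  have H01: "H (0, 1) 0 = g 1 0" "H (0, 1) 1 = g 1 1" "H (0, 1) 2 = g 1 2"
    "H (1, 1) 0 = h 1 0" "H (1, 1) 1 = h 1 1" "H (1, 1) 2 = h 1 2"
    using H(4) unfolding all_less_3 by auto
  have "real_conf 3 (H (0, 1))" using H(3) by simp
  then show ?thesis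
    using pos[of 0 1] pos[of 1 2] h unfolding incr_real_conf_3 real_conf_3 conf_3 H01 by auto
qed

definition cls :: "int \<Rightarrow> int \<Rightarrow> int \<Rightarrow> int \<Rightarrow> (real \<Rightarrow> nat \<Rightarrow> complex) set" where
  "cls p q r s = {h. tr_arc 3 h \<and> incr_real_conf 3 (h 1) \<and> ends_in h p q r s}"

text \<open>Twisting does not change the end geodesic, so the class stays inside \<open>cls\<close>.
  Conversely two arcs with the same end geodesic differ by their winding numbers at most, and as
  many full twists as the difference make up for it.\<close>

lemma class_eq_cls:
  assumes g: "g \<in> cls p q r s" and gam: "gam p q r s"
  shows "{h. tr_arc 3 h \<and> center_equiv 3 g h} = cls p q r s"
proof -
  have g': "tr_arc 3 g" "incr_real_conf 3 (g 1)" "ends_in g p q r s" using g by (auto simp: cls_def)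
  have "h \<in> cls p q r s" if h: "tr_arc 3 h" "center_equiv 3 g h" for h
  proof -
    obtain k where k: "tr_homotopic 3 h (g +++ full_twist k (g 1))" using h(2) unfolding center_equiv_def by blast
    have "ends_in h p q r s"
      by (rule ends_in_homotopic[OF tr_homotopic_sym[OF k] gam twist_ends_in[OF g']])
    moreover have "incr_real_conf 3 (h 1)"
      by (rule tr_homotopic_incr_end[OF k]) (simp add: twist_end[OF g'(1,2)] g'(2))
    ultimately show ?thesis using h(1) by (simp add: cls_def)
  qed
  moreover have "center_equiv 3 g h" if h: "h \<in> cls p q r s" for h
  proof -
    have h': "tr_arc 3 h" "incr_real_conf 3 (h 1)" "ends_in h p q r s" using h by (auto simp: cls_def)
    obtain n m where n: "wind g n" "wind h m" using wind_exists g' h' by metis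
    let ?k = "m - n"
    have "tr_homotopic 3 h (g +++ full_twist ?k (g 1))"
      by (rule tr_homotopic_if[OF h'(1,2) twist_tr_arc[OF g'(1,2)] _ gam h'(3) twist_ends_in[OF g'] n(2)])
         (use twist_end[OF g'(1,2)] g'(2) twist_wind[OF g'(1,2) n(1), of ?k] in simp_all)
    then show ?thesis unfolding center_equiv_def by blast
  qed
  ultimately show ?thesis by (auto simp: cls_def)
qed

lemma PB_mod_Z_3:
  "C \<in> PB_mod_Z 3 \<longleftrightarrow> (\<exists>p q r s. gam p q r s \<and> C = cls p q r s \<and> C \<noteq> {})"
proof
  assume "C \<in> PB_mod_Z 3"
  then obtain g where g: "tr_arc 3 g" "incr_real_conf 3 (g 1)" "C = {h. tr_arc 3 h \<and> center_equiv 3 g h}"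
    unfolding PB_mod_Z_def by blast
  obtain p q r s where gam: "gam p q r s" and e: "ends_in g p q r s" using ends_in_exists[OF g(1,2)] by metis
  then have "g \<in> cls p q r s" using g by (simp add: cls_def)
  with class_eq_cls[OF this gam] gam show "\<exists>p q r s. gam p q r s \<and> C = cls p q r s \<and> C \<noteq> {}"
    unfolding g(3) by blast
next
  assume "\<exists>p q r s. gam p q r s \<and> C = cls p q r s \<and> C \<noteq> {}"
  then obtain p q r s g where "gam p q r s" "C = cls p q r s" "g \<in> cls p q r s" by blast
  then show "C \<in> PB_mod_Z 3"
    unfolding PB_mod_Z_def using class_eq_cls[of g p q r s] by (auto simp: cls_def)
qed

section \<open>Extremal length\<close>

lemma line_derivative:
  fixes Psi Phi :: "complex \<Rightarrow> complex"
  assumes d: "\<And>z. z \<in> S \<Longrightarrow> (Psi has_field_derivative Phi z) (at z within S)"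
    and S: "\<And>t. t \<in> {\<alpha>..\<beta>} \<Longrightarrow> z0 + of_real t * v \<in> S"
  shows "continuous_on {\<alpha>..\<beta>} (\<lambda>t. Re (Psi (z0 + of_real t * v)))"
    and "\<alpha> < t \<Longrightarrow> t < \<beta> \<Longrightarrow> ((\<lambda>t. Re (Psi (z0 + of_real t * v))) has_real_derivative Re (v * Phi (z0 + of_real t * v))) (at t)"
proof -
  let ?g = "\<lambda>t. z0 + of_real t * v"
  have vd: "((\<lambda>t. Psi (?g t)) has_vector_derivative v * Phi (?g t)) (at t within {\<alpha>..\<beta>})" if t: "t \<in> {\<alpha>..\<beta>}" for t
  proof -
    have "(?g has_vector_derivative v) (at t within {\<alpha>..\<beta>})"
      by (auto intro!: derivative_eq_intros simp: has_vector_derivative_def scaleR_conv_of_real)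
    moreover have "(Psi has_field_derivative Phi (?g t)) (at (?g t) within ?g ` {\<alpha>..\<beta>})"
      using d[OF S[OF t]] by (rule DERIV_subset) (use S in auto)
    ultimately show ?thesis using field_vector_diff_chain_within[of ?g v t "{\<alpha>..\<beta>}" Psi] by (simp add: o_def)
  qed
  have re: "((\<lambda>t. Re (Psi (?g t))) has_real_derivative Re (v * Phi (?g t))) (at t within {\<alpha>..\<beta>})" if t: "t \<in> {\<alpha>..\<beta>}" for t
    using bounded_linear.has_vector_derivative[OF bounded_linear_Re vd[OF t]]
    by (simp add: has_real_derivative_iff_has_vector_derivative)
  then show "continuous_on {\<alpha>..\<beta>} (\<lambda>t. Re (Psi (?g t)))" by (rule DERIV_continuous_on)
  show "((\<lambda>t. Re (Psi (?g t))) has_real_derivative Re (v * Phi (?g t))) (at t)" if "\<alpha> < t" "t < \<beta>"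
    using re[of t] that by (simp add: at_within_Icc_at)
qed

text \<open>The real part of the integral of \<open>Phi\<close> around the rectangle vanishes; its horizontal part is
  \<open>(u0 - u1) * b\<close> and its vertical part is at most \<open>pi * a\<close>.\<close>
lemma rectangle_strip:
  fixes Phi :: "complex \<Rightarrow> complex"
  assumes ab: "0 < a" "0 < b"
    and cont: "continuous_on (cbox (Complex x0 y0) (Complex (x0 + b) (y0 + a))) Phi"
    and hol: "Phi holomorphic_on box (Complex x0 y0) (Complex (x0 + b) (y0 + a))"
    and strip: "\<And>z. z \<in> cbox (Complex x0 y0) (Complex (x0 + b) (y0 + a)) \<Longrightarrow> 0 < Im (Phi z) \<and> Im (Phi z) < pi"
    and bottom: "\<And>x. x0 < x \<Longrightarrow> x < x0 + b \<Longrightarrow> Re (Phi (Complex x y0)) = u0"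
    and top: "\<And>x. x0 < x \<Longrightarrow> x < x0 + b \<Longrightarrow> Re (Phi (Complex x (y0 + a))) = u1"
  shows "\<bar>u1 - u0\<bar> * b \<le> pi * a"
proof -
  let ?S = "cbox (Complex x0 y0) (Complex (x0 + b) (y0 + a))"
  have "Phi field_differentiable at z" if "z \<in> interior ?S - {}" for z
    using holomorphic_on_imp_differentiable_at[OF hol open_box, of z] that by (simp add: interior_cbox)
  then obtain Psi where Psi: "\<And>z. z \<in> ?S \<Longrightarrow> (Psi has_field_derivative Phi z) (at z within ?S)"
    using holomorphic_convex_primitive[of ?S "{}" Phi] cont convex_box(1) by (metis finite.emptyI)
  have h: "Complex 0 y + of_real x * 1 = Complex x y" and v: "Complex x 0 + of_real y * \<i> = Complex x y" for x y
    by (simp_all add: complex_eq_iff)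
  have hs: "Complex 0 y + of_real t * 1 \<in> ?S" if "t \<in> {x0..x0 + b}" "y = y0 \<or> y = y0 + a" for t y
    unfolding h using that ab by (auto simp: in_cbox_complex_iff)
  have vs: "Complex x 0 + of_real t * \<i> \<in> ?S" if "t \<in> {y0..y0 + a}" "x = x0 \<or> x = x0 + b" for t x
    unfolding v using that ab by (auto simp: in_cbox_complex_iff)
  have H: "continuous_on {x0..x0 + b} (\<lambda>x. Re (Psi (Complex x y)))"
    "x0 < x \<Longrightarrow> x < x0 + b \<Longrightarrow> ((\<lambda>x. Re (Psi (Complex x y))) has_real_derivative Re (1 * Phi (Complex x y))) (at x)"
    if y: "y = y0 \<or> y = y0 + a" for x y
    using line_derivative[OF Psi hs[OF _ y], of x0 "x0 + b", unfolded h] by blast+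
  have V: "continuous_on {y0..y0 + a} (\<lambda>y. Re (Psi (Complex x y)))"
    "y0 < y \<Longrightarrow> y < y0 + a \<Longrightarrow> ((\<lambda>y. Re (Psi (Complex x y))) has_real_derivative Re (\<i> * Phi (Complex x y))) (at y)"
    if x: "x = x0 \<or> x = x0 + b" for x y
    using line_derivative[OF Psi vs[OF _ x], of y0 "y0 + a", unfolded v] by blast+
  \<comment> \<open>A primitive of \<open>Phi\<close> replaces the contour integral. The alternating
    sum of its real part over the four corners is computed twice by the mean value theorem, once
    from \<open>?D\<close> and once from \<open>?E\<close>.\<close>
  let ?D = "\<lambda>x. Re (Psi (Complex x (y0 + a))) - Re (Psi (Complex x y0))"
  let ?E = "\<lambda>y. Re (Psi (Complex (x0 + b) y)) - Re (Psi (Complex x0 y))"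
  have "\<exists>l z. x0 < z \<and> z < x0 + b \<and> DERIV ?D z :> l \<and> ?D (x0 + b) - ?D x0 = ((x0 + b) - x0) * l"
  proof (rule MVT)
    show "continuous_on {x0..x0 + b} ?D" by (intro continuous_on_diff H(1)) auto
    show "?D differentiable at x" if "x0 < x" "x < x0 + b" for x
      using DERIV_diff[OF H(2)[of "y0 + a", OF _ that] H(2)[of y0, OF _ that]] real_differentiable_def by blast
  qed (use ab in simp)
  then obtain l x where l: "x0 < x" "x < x0 + b" "DERIV ?D x :> l" "?D (x0 + b) - ?D x0 = b * l" by auto
  have "DERIV ?D x :> Re (1 * Phi (Complex x (y0 + a))) - Re (1 * Phi (Complex x y0))"
    by (intro DERIV_diff H(2)) (use l in auto)
  then have lu: "l = u1 - u0" using DERIV_unique[OF l(3)] bottom[OF l(1,2)] top[OF l(1,2)] by simp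
  have "\<exists>m z. y0 < z \<and> z < y0 + a \<and> DERIV ?E z :> m \<and> ?E (y0 + a) - ?E y0 = ((y0 + a) - y0) * m"
  proof (rule MVT)
    show "continuous_on {y0..y0 + a} ?E" by (intro continuous_on_diff V(1)) auto
    show "?E differentiable at y" if "y0 < y" "y < y0 + a" for y
      using DERIV_diff[OF V(2)[of "x0 + b", OF _ that] V(2)[of x0, OF _ that]] real_differentiable_def by blast
  qed (use ab in simp)
  then obtain m y where m: "y0 < y" "y < y0 + a" "DERIV ?E y :> m" "?E (y0 + a) - ?E y0 = a * m" by auto
  have "DERIV ?E y :> Re (\<i> * Phi (Complex (x0 + b) y)) - Re (\<i> * Phi (Complex x0 y))"
    by (intro DERIV_diff V(2)) (use m in auto)
  then have mu: "m = Im (Phi (Complex x0 y)) - Im (Phi (Complex (x0 + b) y))" using DERIV_unique[OF m(3)] by simp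
  have "Complex x0 y \<in> ?S" "Complex (x0 + b) y \<in> ?S" using m ab by (auto simp: in_cbox_complex_iff)
  from strip[OF this(1)] strip[OF this(2)] have "\<bar>m\<bar> \<le> pi" unfolding mu by linarith
  moreover have "b * l = a * m" using l(4) m(4) by linarith
  ultimately have "\<bar>b * l\<bar> \<le> a * pi" using ab by (simp add: abs_mult)
  then show ?thesis using ab by (simp add: abs_mult lu mult.commute)
qed

text \<open>Both q and r are even, so qr = 4m with m nonzero, ps = 1 + 4m and ps + qr = 1 + 8m. The
  sign condition says that the end points q/s and p/r lie on the same side of 0, so the geodesic
  does not cross the axis.\<close>

lemma gam_product_pos:
  assumes "gam p q r s" "q * r \<noteq> 0"
  shows "0 < (p * q) * (r * s)" "7 \<le> \<bar>p * s + q * r\<bar>"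
proof -
  have d: "p * s = 1 + q * r" "even q" "even r" using gam_det[OF assms(1)] by auto
  then obtain m where m: "q * r = 4 * m" by (auto elim!: evenE)
  have m0: "m \<noteq> 0" using assms(2) m by auto
  have "(p * q) * (r * s) = (1 + 4 * m) * (4 * m)" using d(1) m by (metis mult.assoc mult.commute mult.left_commute)
  moreover have "0 < (1 + 4 * m) * (4 * m)"
  proof (cases "m > 0")
    case False
    then have "1 + 4 * m < 0" "4 * m < 0" using m0 by auto
    then show ?thesis by (rule mult_neg_neg)
  qed auto
  ultimately show "0 < (p * q) * (r * s)" by simp
  show "7 \<le> \<bar>p * s + q * r\<bar>" using d(1) m m0 by linarith
qed

text \<open>The common perpendicular of the two geodesics is the semicircle of radius c =
  sqrt(pq/(rs)) about 0. The map \<open>w\<close> sends its ends c and -c to 0 and infinity, so both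
  geodesics become arcs of circles about 0, and the logarithm of \<open>w\<close> takes them to
  vertical cross-cuts of the strip 0 < Im < pi, where \<open>rectangle_strip\<close>
  applies.\<close>

lemma extremal_inequality:
  assumes ab: "0 < a" "0 < b"
    and cont: "continuous_on (cbox (Complex x0 y0) (Complex (x0 + b) (y0 + a))) L"
    and hol: "L holomorphic_on box (Complex x0 y0) (Complex (x0 + b) (y0 + a))"
    and L: "\<And>z. z \<in> cbox (Complex x0 y0) (Complex (x0 + b) (y0 + a)) \<Longrightarrow> L z \<in> uhp"
    and bottom: "\<And>x. x0 < x \<Longrightarrow> x < x0 + b \<Longrightarrow> Re (L (Complex x y0)) = 0"
    and top: "\<And>x. x0 < x \<Longrightarrow> x < x0 + b \<Longrightarrow> geo p q r s (L (Complex x (y0 + a)))"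
    and gam: "gam p q r s" "q * r \<noteq> 0"
  shows "of_int \<bar>p * s + q * r\<bar> \<le> exp (pi * (a / b))"
proof -
  let ?S = "cbox (Complex x0 y0) (Complex (x0 + b) (y0 + a))"
  let ?rs = "real_of_int (r * s)" and ?pq = "real_of_int (p * q)"
  define N where "N = real_of_int (p * s + q * r)"
  have "0 < real_of_int ((p * q) * (r * s))" using gam_product_pos(1)[OF gam] by (simp only: of_int_0_less_iff)
  then have pos: "0 < ?pq * ?rs" by (simp only: of_int_mult)
  then have rs0: "?rs \<noteq> 0" by auto
  have q0: "0 < ?pq / ?rs" using pos by (simp add: zero_less_divide_iff zero_less_mult_iff)
  define c where "c = sqrt (?pq / ?rs)"
  have c: "0 < c" "c\<^sup>2 = ?pq / ?rs" using q0 by (simp_all add: c_def)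
  define K where "K = N / ?rs"
  have "N\<^sup>2 - 4 * (?pq * ?rs) = (real_of_int (p * s - q * r))\<^sup>2"
    unfolding N_def by (simp add: power2_eq_square algebra_simps)
  then have N4: "N\<^sup>2 - 4 * (?pq * ?rs) = 1" using gam_det[OF gam(1)] by simp
  have Kc: "(K\<^sup>2 - 4 * c\<^sup>2) * ?rs\<^sup>2 = 1"
  proof -
    have "(K\<^sup>2 - 4 * c\<^sup>2) * ?rs\<^sup>2 = N\<^sup>2 - 4 * (?pq * ?rs)"
      unfolding K_def c(2) using rs0 by (simp add: power_divide left_diff_distrib power2_eq_square)
    then show ?thesis using N4 by simp
  qed
  have nz: "t + of_real c \<noteq> 0" "t - of_real c \<noteq> 0" if "t \<in> uhp" for t using that by (auto simp: uhp_def complex_eq_iff)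
  define w where "w t = (t - of_real c) / (t + of_real c)" for t :: complex
  have w0: "0 < Im (w t)" if "t \<in> uhp" for t
  proof -
    have "Im (w t) = 2 * c * Im t / (norm (t + of_real c))\<^sup>2"
      unfolding w_def Im_divide cmod_power2 by (simp add: algebra_simps)
    then show ?thesis using that c(1) nz(1)[OF that] by (simp add: uhp_def)
  qed
  have w_slit: "w t \<notin> \<real>\<^sub>\<le>\<^sub>0" if "t \<in> uhp" for t using w0[OF that] by (auto simp: complex_nonpos_Reals_iff)
  have w_nz: "w t \<noteq> 0" if "t \<in> uhp" for t using w0[OF that] by auto
  \<comment> \<open>On the second geodesic |t|^2 + c^2 = K Re t, which makes |w|^2 constant there;
    \<open>E\<close> is this constant.\<close>
  define E where "E = (K - 2 * c) / (K + 2 * c)"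
  have sq: "(norm (t - of_real c))\<^sup>2 = (norm t)\<^sup>2 + c\<^sup>2 - 2 * c * Re t"
    "(norm (t + of_real c))\<^sup>2 = (norm t)\<^sup>2 + c\<^sup>2 + 2 * c * Re t" for t :: complex
    unfolding cmod_power2 by (simp_all add: power2_eq_square algebra_simps)
  have top': "(norm (w t))\<^sup>2 = E \<and> 0 < E" if t: "t \<in> uhp" "geo p q r s t" for t
  proof -
    have "?rs * ((norm t)\<^sup>2 + c\<^sup>2) = N * Re t"
      using t(2) rs0 unfolding geo_def c(2) N_def by (simp add: distrib_left)
    then have e: "(norm t)\<^sup>2 + c\<^sup>2 = K * Re t" using rs0 by (simp add: K_def field_simps)
    have u: "(norm (t - of_real c))\<^sup>2 = Re t * (K - 2 * c)" "(norm (t + of_real c))\<^sup>2 = Re t * (K + 2 * c)"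
      unfolding sq e by (simp_all add: algebra_simps)
    have p: "0 < Re t * (K - 2 * c)" "0 < Re t * (K + 2 * c)"
      using nz[OF t(1)] unfolding u[symmetric] by auto
    have "(norm (w t))\<^sup>2 = (Re t * (K - 2 * c)) / (Re t * (K + 2 * c))"
      unfolding w_def norm_divide power_divide u ..
    then have "(norm (w t))\<^sup>2 = E" using p by (auto simp: E_def)
    moreover have "0 < (norm (w t))\<^sup>2" using w_nz[OF t(1)] by simp
    ultimately show ?thesis by simp
  qed
  define Phi where "Phi z = Ln (w (L z))" for z
  have wc: "continuous_on ?S (\<lambda>z. w (L z))"
    unfolding w_def using nz L by (intro continuous_intros cont) auto
  have sub: "box (Complex x0 y0) (Complex (x0 + b) (y0 + a)) \<subseteq> ?S" by (rule box_subset_cbox)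
  have wh: "(\<lambda>z. w (L z)) holomorphic_on box (Complex x0 y0) (Complex (x0 + b) (y0 + a))"
    unfolding w_def using nz L sub by (intro holomorphic_intros hol) auto
  have tin: "Complex x (y0 + a) \<in> ?S" "Complex x y0 \<in> ?S" if "x0 < x" "x < x0 + b" for x
    using that ab by (auto simp: in_cbox_complex_iff)
  have half: "ln (norm z) = ln ((norm z)\<^sup>2) / 2" if "z \<noteq> 0" for z :: complex
    using that by (simp add: ln_realpow)
  have "\<bar>ln E / 2 - 0\<bar> * b \<le> pi * a"
  proof (rule rectangle_strip[OF ab, of x0 y0 Phi])
    show "continuous_on ?S Phi" unfolding Phi_def using L w_slit by (intro continuous_on_Ln' wc) auto
    show "Phi holomorphic_on box (Complex x0 y0) (Complex (x0 + b) (y0 + a))"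
      unfolding Phi_def using L w_slit sub by (intro holomorphic_on_Ln' wh) auto
    show "0 < Im (Phi z) \<and> Im (Phi z) < pi" if "z \<in> ?S" for z
      unfolding Phi_def using w0[OF L[OF that]] by (rule Im_Ln_pos_lt_imp)
    show "Re (Phi (Complex x y0)) = 0" if x: "x0 < x" "x < x0 + b" for x
    proof -
      let ?t = "L (Complex x y0)"
      have "(norm (w ?t))\<^sup>2 = 1"
        unfolding w_def norm_divide power_divide sq bottom[OF x] using nz(1)[OF L[OF tin(2)[OF x]]] sq(2)[of ?t] bottom[OF x]
        by (metis (no_types, opaque_lifting) add.right_neutral diff_zero divide_self_if mult_zero_right norm_eq_zero zero_eq_power2)
      then show ?thesis using w_nz[OF L[OF tin(2)[OF x]]] half[of "w ?t"] by (simp add: Phi_def)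
    qed
    show "Re (Phi (Complex x (y0 + a))) = ln E / 2" if x: "x0 < x" "x < x0 + b" for x
      using w_nz[OF L[OF tin(1)[OF x]]] half top'[OF L[OF tin(1)[OF x]] top[OF x]] by (simp add: Phi_def)
  qed
  then have dd: "\<bar>ln E\<bar> \<le> 2 * (pi * (a / b))" using ab by (simp add: field_simps)
  have E0: "0 < E" using top'[OF L[OF tin(1)] top, of "x0 + b / 2"] ab by simp
  have "E \<le> exp \<bar>ln E\<bar>" "1 / E \<le> exp \<bar>ln E\<bar>" "1 \<le> exp \<bar>ln E\<bar>"
    using E0 abs_ge_self[of "ln E"] abs_ge_minus_self[of "ln E"]
    by (metis exp_ln exp_le_cancel_iff, metis exp_ln exp_le_cancel_iff exp_minus inverse_eq_divide, simp)
  then have "E + 1 / E + 2 \<le> 4 * exp \<bar>ln E\<bar>" by linarith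
  \<comment> \<open>If d is the distance, then E is exp(2d) or exp(-2d), so this says |N| = cosh d.
    Determinant 1 enters through K^2 - 4c^2 = 1/(rs)^2.\<close>
  moreover have "E + 1 / E + 2 = 4 * N\<^sup>2"
  proof -
    have n: "K - 2 * c \<noteq> 0" "K + 2 * c \<noteq> 0" using E0 by (auto simp: E_def)
    have "E + 1 / E + 2 = 4 * K\<^sup>2 / ((K - 2 * c) * (K + 2 * c))"
      unfolding E_def using n by (simp add: divide_simps) (simp add: power2_eq_square algebra_simps)
    also have "(K - 2 * c) * (K + 2 * c) = K\<^sup>2 - 4 * c\<^sup>2" by (simp add: power2_eq_square algebra_simps)
    also have "\<dots> = 1 / ?rs\<^sup>2" using Kc rs0 by (simp add: eq_divide_eq)
    finally show ?thesis using rs0 by (simp add: K_def power_divide)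
  qed
  ultimately have "N\<^sup>2 \<le> exp \<bar>ln E\<bar>" by simp
  also have "\<dots> \<le> exp (2 * (pi * (a / b)))" using dd by simp
  also have "\<dots> = (exp (pi * (a / b)))\<^sup>2" by (simp only: exp_double)
  finally have "\<bar>N\<bar> \<le> exp (pi * (a / b))" using abs_le_square_iff[of N "exp (pi * (a / b))"] by simp
  then show ?thesis by (simp add: N_def)
qed

text \<open>The ratio of a representative is lifted over the closed rectangle, starting on the axis.
  Along the bottom the lift stays on the axis. Each vertical segment represents the class, so its
  own lift from the axis ends on the geodesic, and lifts from the axis are unique; this places the
  top.\<close>

lemma Lambda_tr_lower:
  assumes h: "h \<in> cls p q r s" and gam: "gam p q r s" "q * r \<noteq> 0"
  shows "ereal (ln (of_int \<bar>p * s + q * r\<bar>) / pi) \<le> Lambda_tr 3 h"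
  unfolding Lambda_tr_def
proof (rule Inf_greatest)
  fix v assume "v \<in> {ereal (a / b) | a b. a > 0 \<and> b > 0 \<and> (\<exists>x0 y0 F. represents_tr 3 h x0 y0 b a F)}"
  then obtain a b x0 y0 F where v: "v = ereal (a / b)" and ab: "0 < a" "0 < b" and F: "represents_tr 3 h x0 y0 b a F"
    by blast
  let ?S = "cbox (Complex x0 y0) (Complex (x0 + b) (y0 + a))" and ?O = "box (Complex x0 y0) (Complex (x0 + b) (y0 + a))"
  have Fc: "\<forall>j<3. continuous_on ?S (\<lambda>z. F z j)" and Fh: "\<forall>j<3. (\<lambda>z. F z j) holomorphic_on ?O"
    and Fconf: "\<And>z. z \<in> ?S \<Longrightarrow> conf 3 (F z)"
    and Freal: "\<And>x. x0 < x \<Longrightarrow> x < x0 + b \<Longrightarrow> incr_real_conf 3 (F (Complex x y0))"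
    and Fhom: "\<And>x. x0 < x \<Longrightarrow> x < x0 + b \<Longrightarrow> tr_homotopic 3 (\<lambda>t. F (Complex x (y0 + t * a))) h"
    using F unfolding represents_tr_def by blast+
  have eh: "ends_in h p q r s" using h by (simp add: cls_def)
  have ex: "ends_in (\<lambda>t. F (Complex x (y0 + t * a))) p q r s" if "x0 < x" "x < x0 + b" for x
    by (rule ends_in_homotopic[OF tr_homotopic_sym[OF Fhom[OF that]] gam(1) eh])
  have in_S: "Complex x (y0 + t * a) \<in> ?S" if "x0 < x" "x < x0 + b" "t \<in> {0..1}" for x t
    using that ab mult_right_mono[of t 1 a] by (auto simp: in_cbox_complex_iff)
  have sub: "?O \<subseteq> ?S" by (rule box_subset_cbox)
  have fc: "continuous_on ?S (\<lambda>z. ratio (F z))" by (rule continuous_on_ratio[OF Fc Fconf])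
  have fh: "(\<lambda>z. ratio (F z)) holomorphic_on ?O"
  proof -
    have "(\<lambda>z. F z 0) holomorphic_on ?O" "(\<lambda>z. F z 1) holomorphic_on ?O" "(\<lambda>z. F z 2) holomorphic_on ?O"
      using Fh unfolding all_less_3 by auto
    moreover have "F z 2 - F z 0 \<noteq> 0" if "z \<in> ?O" for z
      using Fconf[of z] sub that by (auto simp: conf_3)
    ultimately show ?thesis unfolding ratio_def by (intro holomorphic_intros) auto
  qed
  define x1 where "x1 = x0 + b / 2"
  have x1: "x0 < x1" "x1 < x0 + b" using ab by (auto simp: x1_def)
  obtain c where c: "continuous_on {0..1} c" "\<And>t. t \<in> {0..1} \<Longrightarrow> c t \<in> uhp \<and> lam (c t) = ratio (F (Complex x1 (y0 + t * a)))"
     "Re (c 0) = 0" using ex[OF x1] unfolding ends_in_def by blast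
  have cvx: "convex ?S" by (rule convex_box)
  obtain L where L: "continuous_on ?S L" "\<And>z. z \<in> ?S \<Longrightarrow> L z \<in> uhp \<and> lam (L z) = ratio (F z)" "L (Complex x1 y0) = c 0"
  proof (rule lam_lift[OF convex_imp_simply_connected[OF cvx] convex_imp_locally_path_connected[OF cvx] fc])
    show "ratio (F z) \<noteq> 0 \<and> ratio (F z) \<noteq> 1" if "z \<in> ?S" for z using Fconf[OF that] by (rule ratio_omits)
    show "Complex x1 y0 \<in> ?S" using in_S[OF x1, of 0] by simp
    show "c 0 \<in> uhp" "ratio (F (Complex x1 y0)) = lam (c 0)" using c(2)[of 0] by auto
  qed (rule that)
  have Lh: "L holomorphic_on ?O"
    by (rule lam_lift_holomorphic[OF open_box fh continuous_on_subset[OF L(1) sub]]) (use L(2) sub in blast)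
  have axis: "on_axis (L (Complex x y0))" if x: "x0 < x" "x < x0 + b" for x
  proof (rule lift_stays_on_axis[where X = "{x0<..<x0 + b}" and a = x1 and c = "\<lambda>x. L (Complex x y0)"])
    show "continuous_on {x0<..<x0 + b} (\<lambda>x. L (Complex x y0))"
    proof (rule continuous_on_compose2[OF L(1)])
      show "continuous_on {x0<..<x0 + b} (\<lambda>x. Complex x y0)" unfolding Complex_eq by (intro continuous_intros)
    qed (use in_S[of _ 0] in auto)
    show "unit_real (lam (L (Complex y y0)))" if "y \<in> {x0<..<x0 + b}" for y
      using L(2)[of "Complex y y0"] in_S[of y 0] ratio_unit_real[OF Freal[of y]] that by auto
    show "L (Complex y y0) \<in> uhp" if "y \<in> {x0<..<x0 + b}" for y
      using L(2)[of "Complex y y0"] in_S[of y 0] that by auto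
  qed (use x x1 L(3) c(3) in auto)
  have top: "geo p q r s (L (Complex x (y0 + a)))" if x: "x0 < x" "x < x0 + b" for x
  proof -
    obtain d where d: "continuous_on {0..1} d" "\<And>t. t \<in> {0..1} \<Longrightarrow> d t \<in> uhp \<and> lam (d t) = ratio (F (Complex x (y0 + t * a)))"
     "Re (d 0) = 0" "geo p q r s (d 1)" using ex[OF x] unfolding ends_in_def by blast
    have con: "connected {0..1::real}" by simp
    have "L (Complex x (y0 + 1 * a)) = d 1"
    proof (rule lam_sections_agree[OF con _ d(1), of "\<lambda>t. L (Complex x (y0 + t * a))" 0])
      show "continuous_on {0..1} (\<lambda>t. L (Complex x (y0 + t * a)))"
      proof (rule continuous_on_compose2[OF L(1)])
        show "continuous_on {0..1} (\<lambda>t. Complex x (y0 + t * a))" unfolding Complex_eq by (intro continuous_intros)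
      qed (use in_S[OF x] in auto)
      show "L (Complex x (y0 + 0 * a)) = d 0"
        by (rule lam_axis_inj)
           (use axis[OF x] d(2)[of 0] d(3) L(2)[OF in_S[OF x, of 0]] in \<open>auto simp: on_axis_def\<close>)
      show "lam (L (Complex x (y0 + t * a))) = lam (d t)" if "t \<in> {0..1}" for t
        using L(2)[OF in_S[OF x that]] d(2)[OF that] by simp
      show "L (Complex x (y0 + t * a)) \<in> uhp" if "t \<in> {0..1}" for t
        using L(2)[OF in_S[OF x that]] by simp
    qed (use d(2) in auto)
    then show ?thesis using d(4) by simp
  qed
  have "of_int \<bar>p * s + q * r\<bar> \<le> exp (pi * (a / b))"
    by (rule extremal_inequality[OF ab L(1) Lh _ _ top gam]) (use L(2) axis in \<open>auto simp: on_axis_def\<close>)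
  moreover have "0 < real_of_int \<bar>p * s + q * r\<bar>"
    using gam_product_pos(2)[OF gam] by (simp only: of_int_0_less_iff)
  ultimately have "ln (of_int \<bar>p * s + q * r\<bar>) \<le> ln (exp (pi * (a / b)))"
    by (simp only: ln_le_cancel_iff exp_gt_zero)
  then have "ln (of_int \<bar>p * s + q * r\<bar>) / pi \<le> a / b" by (simp add: field_simps)
  then show "ereal (ln (of_int \<bar>p * s + q * r\<bar>) / pi) \<le> v" unfolding v by simp
qed

text \<open>A map \<open>L\<close> with geodesic boundary values yields the representative (0, lam(L
  z), 1), multiplied by exp(k(z - i y0)) to give it the winding number n of \<open>h\<close>. As ka
  = 2 pi n, this factor is positive on both horizontal sides.\<close>

lemma Lambda_tr_le:
  assumes h: "h \<in> cls p q r s" and gam: "gam p q r s" and ab: "0 < a" "0 < b"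
    and cont: "continuous_on (cbox (Complex x0 y0) (Complex (x0 + b) (y0 + a))) L"
    and hol: "L holomorphic_on box (Complex x0 y0) (Complex (x0 + b) (y0 + a))"
    and L: "\<And>z. z \<in> cbox (Complex x0 y0) (Complex (x0 + b) (y0 + a)) \<Longrightarrow> L z \<in> uhp"
    and bottom: "\<And>x. x0 < x \<Longrightarrow> x < x0 + b \<Longrightarrow> Re (L (Complex x y0)) = 0"
    and top: "\<And>x. x0 < x \<Longrightarrow> x < x0 + b \<Longrightarrow> geo p q r s (L (Complex x (y0 + a)))"
  shows "Lambda_tr 3 h \<le> ereal (a / b)"
proof -
  let ?S = "cbox (Complex x0 y0) (Complex (x0 + b) (y0 + a))" and ?O = "box (Complex x0 y0) (Complex (x0 + b) (y0 + a))"
  have h': "tr_arc 3 h" "incr_real_conf 3 (h 1)" "ends_in h p q r s" using h by (auto simp: cls_def)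
  obtain n where n: "wind h n" using wind_exists[OF h'(1,2)] by metis
  define k where "k = 2 * pi * of_int n / a"
  define F where "F z j = exp (of_real k * (z - \<i> * of_real y0)) * (if j = 0 then 0 else if j = 1 then lam (L z) else 1)"
    for z and j :: nat
  have sub: "?O \<subseteq> ?S" by (rule box_subset_cbox)
  have lc: "continuous_on ?S (\<lambda>z. lam (L z))"
    by (rule continuous_on_compose2[OF holomorphic_on_imp_continuous_on[OF lam_holomorphic] cont]) (use L in auto)
  have lh: "(\<lambda>z. lam (L z)) holomorphic_on ?O"
    by (rule holomorphic_on_compose_gen[OF hol lam_holomorphic, unfolded o_def]) (use L sub in auto)
  have Fc: "continuous_on ?S (\<lambda>z. F z j)" for j
    unfolding F_def by (cases "j = 0"; cases "j = 1") (auto intro!: continuous_intros lc)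
  have Fh: "(\<lambda>z. F z j) holomorphic_on ?O" for j
    unfolding F_def by (cases "j = 0"; cases "j = 1") (auto intro!: holomorphic_intros lh)
  have Fconf: "conf 3 (F z)" if "z \<in> ?S" for z
    using lam_omits[OF L[OF that]] by (auto simp: conf_3 F_def)
  have in_S: "Complex x (y0 + t * a) \<in> ?S" if "x0 < x" "x < x0 + b" "t \<in> {0..1}" for x t
    using that ab mult_right_mono[of t 1 a] by (auto simp: in_cbox_complex_iff)
  have ek: "of_real k * (Complex x (y0 + t * a) - \<i> * of_real y0) = Complex (k * x) (2 * pi * of_int n * t)" for x t
    using ab by (simp add: complex_eq_iff k_def)
  have F3: "F z 0 = 0" "F z 1 = F z 0 + exp (of_real k * (z - \<i> * of_real y0)) * lam (L z)"
    "F z 2 = F z 0 + exp (of_real k * (z - \<i> * of_real y0))" for z by (simp_all add: F_def)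
  have e01: "exp (Complex (k * x) (2 * pi * of_int n * t)) = of_real (exp (k * x))" if "t = 0 \<or> t = 1" for x t
    using that by (auto simp: complex_eq_iff Re_exp Im_exp)
  have incr: "incr_real_conf 3 (F (Complex x (y0 + t * a)))" if x: "x0 < x" "x < x0 + b" and t: "t = 0 \<or> t = 1" for x t
  proof (rule unit_real_incr[OF _ _ _ _ F3(2,3)])
    show "F (Complex x (y0 + t * a)) 0 \<in> \<real>" by (simp add: F3)
    have "on_axis (L (Complex x y0))" "geo p q r s (L (Complex x (y0 + a)))" "L (Complex x (y0 + a)) \<in> uhp"
      using bottom[OF x] top[OF x] L[OF in_S[OF x, of 0]] L[OF in_S[OF x, of 1]] by (auto simp: on_axis_def)
    then show "unit_real (lam (L (Complex x (y0 + t * a))))"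
      using t lam_axis_unit geo_unit_real[OF gam] by auto
  qed (unfold ek e01[OF t], simp_all)
  have hom: "tr_homotopic 3 (\<lambda>t. F (Complex x (y0 + t * a))) h" if x: "x0 < x" "x < x0 + b" for x
  proof (rule tr_homotopic_if[OF _ _ h'(1,2) gam _ h'(3) _ n])
    let ?v = "\<lambda>t. F (Complex x (y0 + t * a))"
    have path: "continuous_on {0..1} (\<lambda>t. f (Complex x (y0 + t * a)))" if "continuous_on ?S f" for f :: "complex \<Rightarrow> complex"
    proof (rule continuous_on_compose2[OF that])
      show "continuous_on {0..1} (\<lambda>t. Complex x (y0 + t * a))" unfolding Complex_eq by (intro continuous_intros)
    qed (use in_S[OF x] in auto)
    show "incr_real_conf 3 (?v 1)" by (rule incr[OF x]) simp
    then show "tr_arc 3 ?v"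
      unfolding tr_arc_def using path[OF Fc] Fconf[OF in_S[OF x]] incr[OF x, of 0] by (auto simp: incr_real_conf_def)
    show "ends_in ?v p q r s"
      unfolding ends_in_def
    proof (intro exI[of _ "\<lambda>t. L (Complex x (y0 + t * a))"] conjI ballI path cont)
      show "L (Complex x (y0 + t * a)) \<in> uhp" if "t \<in> {0..1}" for t using L[OF in_S[OF x that]] .
      show "lam (L (Complex x (y0 + t * a))) = ratio (?v t)" for t
        by (simp add: ratio_def F_def)
    qed (use bottom[OF x] top[OF x] in auto)
    show "wind ?v n"
      unfolding wind_def
      by (intro exI[of _ "\<lambda>t. Complex (k * x) (2 * pi * of_int n * t)"])
         (auto simp: F3 ek[symmetric] simp del: of_real_add intro!: continuous_intros continuous_on_Complex)
  qed
  have "represents_tr 3 h x0 y0 b a F"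
    unfolding represents_tr_def using Fc Fh Fconf incr[of _ 0] incr[of _ 1] hom
    by (auto simp: incr_real_conf_def)
  then show ?thesis unfolding Lambda_tr_def using ab by (intro Inf_lower) blast
qed

text \<open>The axis and its image share the ideal point infinity (r = 0) or 0 (q = 0), and near
  that point they are joined by rectangles of width 1 and arbitrarily small height e.\<close>

lemma Lambda_tr_parabolic:
  assumes h: "h \<in> cls p q r s" and gam: "gam p q r s" and qr: "q * r = 0"
  shows "\<not> 0 < Lambda_tr 3 h"
proof
  assume "0 < Lambda_tr 3 h"
  then obtain e where e: "0 < ereal e" "ereal e < Lambda_tr 3 h" using ereal_dense2 by blast
  then have e0: "0 < e" by simp
  \<comment> \<open>\<open>L0\<close> takes the bottom to Re = 0 and the top to Re = m, and the
    added imaginary constant keeps it in the half-plane. For r = 0 the target geodesic is Re t = pq;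
    for q = 0 the inversion t -> -1/t turns it into the line Re = -rs.\<close>
  define m where "m = (if r = 0 then real_of_int (p * q) else - real_of_int (r * s))"
  define L0 where "L0 z = of_real (m / e) * (- \<i> * z) + \<i> * of_real (1 + \<bar>m\<bar> / e)" for z
  let ?S = "cbox (Complex 0 0) (Complex (0 + 1) (0 + e))"
  have L0: "Re (L0 z) = m / e * Im z" "Im (L0 z) = 1 + \<bar>m\<bar> / e - m / e * Re z" for z
    by (simp_all add: L0_def)
  have Lu: "L0 z \<in> uhp" if "z \<in> ?S" for z
  proof -
    have "0 \<le> Re z" "Re z \<le> 1" using that by (auto simp: in_cbox_complex_iff)
    then have "m / e * Re z \<le> \<bar>m\<bar> / e * 1" using e0 by (intro mult_mono divide_right_mono) auto
    then show ?thesis by (simp add: uhp_def L0)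
  qed
  have c0: "continuous_on ?S L0" "L0 holomorphic_on box (Complex 0 0) (Complex (0 + 1) (0 + e))"
    unfolding L0_def[abs_def] by (intro continuous_intros holomorphic_intros)+
  have d: "p * s - q * r = 1" using gam_det[OF gam] by simp
  have "Lambda_tr 3 h \<le> ereal (e / 1)"
  proof (cases "r = 0")
    case True
    then have ps: "p * s = 1" using d by simp
    show ?thesis
    proof (rule Lambda_tr_le[OF h gam e0, of 1 0 0 L0])
      show "geo p q r s (L0 (Complex x (0 + e)))" for x
        unfolding geo_def L0 using True ps e0 by (simp add: m_def)
      show "Re (L0 (Complex x 0)) = 0" for x by (simp add: L0)
    qed (use Lu c0 in auto)
  next
    case False
    then have q: "q = 0" using qr by simp
    then have ps: "p * s = 1" using d by simp
    have nz: "L0 z \<noteq> 0" if "z \<in> ?S" for z using Lu[OF that] by (auto simp: uhp_def)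
    show ?thesis
    proof (rule Lambda_tr_le[OF h gam e0, of 1 0 0 "\<lambda>z. - 1 / L0 z"])
      show "continuous_on ?S (\<lambda>z. - 1 / L0 z)" using nz by (intro continuous_intros c0) auto
      show "(\<lambda>z. - 1 / L0 z) holomorphic_on box (Complex 0 0) (Complex (0 + 1) (0 + e))"
        using nz box_subset_cbox[of "Complex 0 0" "Complex (0 + 1) (0 + e)"] by (intro holomorphic_intros c0) blast
      show "- 1 / L0 z \<in> uhp" if "z \<in> ?S" for z by (rule minus_inverse_uhp[OF Lu[OF that]])
      show "Re (- 1 / L0 (Complex x 0)) = 0" for x by (simp add: Re_divide L0)
      show "geo p q r s (- 1 / L0 (Complex x (0 + e)))" if "0 < x" "x < 0 + 1" for x
      proof -
        let ?t = "L0 (Complex x (0 + e))"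
        have "?t \<noteq> 0" by (rule nz) (use that e0 in \<open>auto simp: in_cbox_complex_iff\<close>)
        moreover have "Re (- 1 / ?t) = real_of_int (r * s) / (norm ?t)\<^sup>2"
          unfolding Re_divide cmod_power2 using False e0 by (simp add: L0 m_def)
        ultimately show ?thesis
          unfolding geo_def using q ps by (simp add: norm_divide power_divide)
      qed
    qed auto
  qed
  then show False using e(2) by simp
qed

section \<open>Counting\<close>

text \<open>The arc (0, lam, 1) along the segment from i to its image under the matrix. This segment
  is its only lift from the axis, so any other matrix attached to the arc must have its geodesic
  pass through the same end point, which separates classes.\<close>

lemma cls_witness:
  assumes gam: "gam p q r s"
  obtains g where "g \<in> cls p q r s" "\<And>p' q' r' s'. ends_in g p' q' r' s' \<Longrightarrow> geo p' q' r' s' (mob p q r s \<i>)"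
proof -
  have d: "p * s - q * r = 1" using gam_det[OF gam] by simp
  have i: "\<i> \<in> uhp" "on_axis \<i>" by (auto simp: uhp_def on_axis_def)
  let ?e = "mob p q r s \<i>"
  have e: "?e \<in> uhp" "geo p q r s ?e" using mob_uhp[OF d i(1)] geo_mob[OF gam i(2)] by auto
  let ?c = "linepath \<i> ?e"
  have c: "?c t \<in> uhp" if "t \<in> {0..1}" for t
    using convex_contains_segment[of uhp] convex_uhp i(1) e(1) that by (metis linepath_in_path subsetD)
  define g where "g t j = (if j = 0 then 0 else if j = 1 then lam (?c t) else 1)" for t :: real and j :: nat
  have cl: "continuous_on {0..1} (\<lambda>t. lam (?c t))"
    by (rule continuous_on_compose2[OF holomorphic_on_imp_continuous_on[OF lam_holomorphic] continuous_on_linepath])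
       (use c in auto)
  have g3: "g t 0 = 0" "g t 1 = g t 0 + 1 * lam (?c t)" "g t 2 = g t 0 + 1" for t by (simp_all add: g_def)
  have r: "ratio (g t) = lam (?c t)" for t by (simp add: ratio_def g_def)
  have incr: "incr_real_conf 3 (g 0)" "incr_real_conf 3 (g 1)"
    by (rule unit_real_incr[OF _ _ _ _ g3(2,3)];
        use lam_axis_unit[OF i(2)] geo_unit_real[OF gam e] in \<open>simp add: g3 linepath_0' linepath_1'\<close>)+
  have "continuous_on {0..1} (\<lambda>t. g t j)" for j
    unfolding g_def by (cases "j = 0"; cases "j = 1") (auto intro!: cl)
  moreover have "conf 3 (g t)" if "t \<in> {0..1}" for t
    using lam_omits[OF c[OF that]] by (auto simp: conf_3 g_def)
  ultimately have "tr_arc 3 g" using incr by (simp add: tr_arc_def incr_real_conf_def)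
  moreover have "ends_in g p q r s"
    unfolding ends_in_def by (intro exI[of _ ?c]) (use c r e in \<open>auto simp: linepath_0' linepath_1'\<close>)
  ultimately have "g \<in> cls p q r s" using incr by (simp add: cls_def)
  moreover have "geo p' q' r' s' ?e" if en: "ends_in g p' q' r' s'" for p' q' r' s'
  proof -
    obtain f where f: "continuous_on {0..1} f" "\<And>t. t \<in> {0..1} \<Longrightarrow> f t \<in> uhp \<and> lam (f t) = ratio (g t)"
     "Re (f 0) = 0" "geo p' q' r' s' (f 1)" using en unfolding ends_in_def by blast
    have "f 1 = ?c 1"
    proof (rule lam_sections_agree[of "{0..1::real}" f ?c 0])
      show "f 0 = ?c 0"
        by (rule lam_axis_inj) (use f(2)[of 0] f(3) r i in \<open>auto simp: on_axis_def linepath_0'\<close>)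
    qed (use f c r in \<open>auto intro!: continuous_on_linepath\<close>)
    then show ?thesis using f(4) by (simp add: linepath_1')
  qed
  ultimately show ?thesis by (rule that)
qed

lemma gam_family: "gam (1 + 4 * m) 2 (2 * m) 1"
  using gam_U[OF gam_T[OF gam_id, of 1], of m] by (simp add: algebra_simps)

text \<open>If the classes agree, the geodesic of n passes through the image of i under the matrix
  of m. Cleared of denominators, this condition is just 2(n - m) = 0.\<close>

lemma cls_family_inj:
  assumes eq: "cls (1 + 4 * m) 2 (2 * m) 1 = cls (1 + 4 * n) 2 (2 * n) 1"
  shows "m = n"
proof -
  obtain g where g: "g \<in> cls (1 + 4 * m) 2 (2 * m) 1"
    "\<And>p' q' r' s'. ends_in g p' q' r' s' \<Longrightarrow> geo p' q' r' s' (mob (1 + 4 * m) 2 (2 * m) 1 \<i>)"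
    using cls_witness[OF gam_family] by metis
  have "ends_in g (1 + 4 * n) 2 (2 * n) 1" using g(1) unfolding eq by (simp add: cls_def)
  then have geo: "geo (1 + 4 * n) 2 (2 * n) 1 (mob (1 + 4 * m) 2 (2 * m) 1 \<i>)" by (rule g(2))
  let ?t = "mob (1 + 4 * m) 2 (2 * m) 1 \<i>" and ?m = "real_of_int m" and ?n = "real_of_int n"
  define D where "D = 1 + 4 * ?m\<^sup>2"
  have D: "0 < D" unfolding D_def using zero_le_power2[of ?m] by linarith
  have re: "Re ?t = (2 + 2 * ?m + 8 * ?m\<^sup>2) / D"
    unfolding mob_def Re_divide D_def by (simp add: power2_eq_square algebra_simps)
  have "(norm ?t)\<^sup>2 = (4 + (1 + 4 * ?m)\<^sup>2) / D"
    unfolding mob_def norm_divide power_divide cmod_power2 D_def by (simp add: power2_eq_square algebra_simps)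
  with geo re have "2 * ?n * ((4 + (1 + 4 * ?m)\<^sup>2) / D) - (8 * ?n + 1) * ((2 + 2 * ?m + 8 * ?m\<^sup>2) / D) + (1 + 4 * ?n) * 2 = 0"
    by (simp add: geo_def)
  moreover have lin: "A * x - B * y + C * D = (A * (x / D) - B * (y / D) + C) * D" for A B C x y :: real
    using D by (simp add: field_simps)
  ultimately have "2 * ?n * (4 + (1 + 4 * ?m)\<^sup>2) - (8 * ?n + 1) * (2 + 2 * ?m + 8 * ?m\<^sup>2) + (1 + 4 * ?n) * 2 * D = 0"
    by (simp only: lin mult_zero_left)
  then have "?n = ?m" unfolding D_def by (simp add: power2_eq_square algebra_simps)
  then show ?thesis by simp
qed

text \<open>The map \<open>c (1 + w) / (1 - w)\<close> with \<open>w = exp (\<i> z)\<close> carries the concentric circles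
  \<open>|w| = 1\<close> and \<open>|w| = exp (- a)\<close> to the two geodesics.\<close>
lemma Lambda_tr_family:
  assumes m: "1 \<le> (m::int)" and h: "h \<in> cls (1 + 4 * m) 2 (2 * m) 1"
  shows "Lambda_tr 3 h \<le> ereal (ln (2 + 16 * of_int m))"
proof -
  let ?m = "real_of_int m"
  have m1: "1 \<le> ?m" using m by simp
  \<comment> \<open>Here N = ps + qr = cosh a and D = sinh a, so a = log(N + D) is the distance of
    the geodesics; c is the radius of their common perpendicular, as c^2 = (1 + 4m)/m.\<close>
  define N where "N = 8 * ?m + 1"
  define D where "D = sqrt (N\<^sup>2 - 1)"
  define c where "c = D / (4 * ?m)"
  have N1: "9 \<le> N" using m1 by (simp add: N_def)
  then have "1 < N\<^sup>2" by (simp add: one_less_power)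
  then have D: "0 < D" "D\<^sup>2 = N\<^sup>2 - 1" by (simp_all add: D_def)
  have DN: "D < N" using D N1 by (intro power2_less_imp_less[of D N]) auto
  have c0: "0 < c" using D m1 by (simp add: c_def)
  have c2: "c\<^sup>2 * ?m = 1 + 4 * ?m"
    unfolding c_def power_divide D(2) N_def using m1 by (simp add: field_simps power2_eq_square)
  define a where "a = ln (N + D)"
  have a0: "0 < a" using N1 D by (simp add: a_def)
  have ea: "exp (- a) = 1 / (N + D)" using N1 D by (simp add: a_def exp_minus inverse_eq_divide)
  define w where "w z = exp (\<i> * z)" for z :: complex
  have nw: "norm (w z) = exp (- Im z)" for z by (simp add: w_def)
  let ?S = "cbox (Complex (1/2) 0) (Complex (1/2 + 1) (0 + a))"
  have Imw: "0 < Im (w z)" if "z \<in> ?S" for z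
  proof -
    \<comment> \<open>The rectangle has width 1 and lies over [1/2, 3/2] inside (0, pi), so
      \<open>w\<close> stays in the upper half-plane. The optimal width would be pi; the lost factor
      is harmless.\<close>
    have "0 < Re z" "Re z < pi" using that pi_ge_two by (auto simp: in_cbox_complex_iff)
    then have "0 < sin (Re z)" by (rule sin_gt_zero)
    then show ?thesis by (simp add: w_def Im_exp)
  qed
  define L where "L z = of_real c * (1 + w z) / (1 - w z)" for z
  have nz: "1 - w z \<noteq> 0" if "z \<in> ?S" for z using Imw[OF that] by (auto simp: complex_eq_iff)
  have ReL: "Re (L z) = c * (1 - (norm (w z))\<^sup>2) / (norm (1 - w z))\<^sup>2"
    and ImL: "Im (L z) = 2 * c * Im (w z) / (norm (1 - w z))\<^sup>2" for z
    unfolding L_def Re_divide Im_divide cmod_power2 by (simp_all add: power2_eq_square algebra_simps)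
  have nL: "(norm (L z))\<^sup>2 = c\<^sup>2 * (norm (1 + w z))\<^sup>2 / (norm (1 - w z))\<^sup>2" for z
    by (simp add: L_def norm_mult norm_divide power_mult_distrib power_divide)
  have par: "(norm (1 + u))\<^sup>2 = 2 + 2 * (norm u)\<^sup>2 - (norm (1 - u))\<^sup>2" for u :: complex
    unfolding cmod_power2 by (simp add: power2_eq_square algebra_simps)
  have "Lambda_tr 3 h \<le> ereal (a / 1)"
  proof (rule Lambda_tr_le[OF h gam_family a0, of 1 "1/2" 0 L])
    show "continuous_on ?S L" unfolding L_def using nz by (intro continuous_intros) (auto simp: w_def[abs_def] intro!: continuous_intros)
    show "L holomorphic_on box (Complex (1/2) 0) (Complex (1/2 + 1) (0 + a))"
      unfolding L_def using nz box_subset_cbox[of "Complex (1/2) 0" "Complex (1/2 + 1) (0 + a)"]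
      by (intro holomorphic_intros) (auto simp: w_def[abs_def] intro!: holomorphic_intros)
    show "L z \<in> uhp" if "z \<in> ?S" for z
      using Imw[OF that] nz[OF that] c0 by (simp add: uhp_def ImL)
    show "Re (L (Complex x 0)) = 0" for x by (simp add: ReL nw)
    show "geo (1 + 4 * m) 2 (2 * m) 1 (L (Complex x (0 + a)))" if x: "1/2 < x" "x < 1/2 + 1" for x
    proof -
      let ?z = "Complex x (0 + a)"
      have zS: "?z \<in> ?S" using x a0 by (auto simp: in_cbox_complex_iff)
      define V where "V = (norm (1 - w ?z))\<^sup>2"
      have V: "V \<noteq> 0" using nz[OF zS] by (simp add: V_def)
      define e where "e = (norm (w ?z))\<^sup>2"
      have e: "e * (N + D)\<^sup>2 = 1"
        unfolding e_def nw using ea N1 D by (simp add: power_divide)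
      have eD: "D * (1 + e) = N * (1 - e)"
      proof -
        have "(D * (1 + e) - N * (1 - e)) * (N + D) = D\<^sup>2 - N\<^sup>2 + e * (N + D)\<^sup>2"
          by (simp add: power2_eq_square algebra_simps)
        also have "\<dots> = 0" using e D(2) by simp
        finally show ?thesis using N1 D by simp
      qed
      have "2 * ?m * (c\<^sup>2 * (2 + 2 * e - V) / V) - N * (c * (1 - e) / V) + (1 + 4 * ?m) * 2
        = (2 * ?m * c\<^sup>2 * (2 + 2 * e) - N * c * (1 - e)) / V + 2 * (1 + 4 * ?m - c\<^sup>2 * ?m)"
        using V by (simp add: field_simps)
      also have "\<dots> = c * (4 * ?m * c * (1 + e) - N * (1 - e)) / V"
        unfolding c2 by (simp add: power2_eq_square algebra_simps)
      also have "4 * ?m * c = D" using m1 by (simp add: c_def)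
      finally have "2 * ?m * (c\<^sup>2 * (2 + 2 * e - V) / V) - N * (c * (1 - e) / V) + (1 + 4 * ?m) * 2 = 0"
        using eD by simp
      then show ?thesis
        unfolding geo_def nL ReL par[of "w ?z"] V_def[symmetric] e_def[symmetric] by (simp add: N_def)
    qed
  qed auto
  also have "a \<le> ln (2 + 16 * ?m)"
    unfolding a_def using DN N1 D by (subst ln_le_cancel_iff) (auto simp: N_def)
  finally show ?thesis by simp
qed

text \<open>\<open>Lambda_tr_class\<close> is evaluated at a chosen member, and the lower estimate
  and the parabolic case hold for every member of the class. Positivity of the length excludes qr =
  0.\<close>

lemma N_Lambda_PB_3:
  assumes C: "C \<in> N_Lambda_PB 3 Y"
  obtains p q r s where "gam p q r s" "C = cls p q r s" "q * r \<noteq> 0" "of_int \<bar>p * s + q * r\<bar> \<le> exp (pi * Y)"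
proof -
  have C': "C \<in> PB_mod_Z 3" "0 < Lambda_tr_class 3 C" "Lambda_tr_class 3 C \<le> ereal Y"
    using C by (auto simp: N_Lambda_PB_def)
  obtain p q r s where gam: "gam p q r s" and Ce: "C = cls p q r s" and ne: "C \<noteq> {}"
    using C'(1) unfolding PB_mod_Z_3 by blast
  define h where "h = (SOME g. g \<in> C)"
  have "h \<in> C" unfolding h_def using ne by (simp add: some_in_eq)
  then have h: "h \<in> cls p q r s" by (simp add: Ce)
  have La: "0 < Lambda_tr 3 h" "Lambda_tr 3 h \<le> ereal Y" using C'(2,3) by (simp_all add: Lambda_tr_class_def h_def)
  have qr: "q * r \<noteq> 0" using Lambda_tr_parabolic[OF h gam] La(1) by blast
  have "ln (of_int \<bar>p * s + q * r\<bar>) / pi \<le> Y"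
    using order_trans[OF Lambda_tr_lower[OF h gam qr] La(2)] by simp
  then have "ln (of_int \<bar>p * s + q * r\<bar>) \<le> pi * Y" by (simp add: field_simps)
  then have "exp (ln (real_of_int \<bar>p * s + q * r\<bar>)) \<le> exp (pi * Y)" by (simp only: exp_le_cancel_iff)
  moreover have "0 < real_of_int \<bar>p * s + q * r\<bar>"
    using gam_product_pos(2)[OF gam qr] by (simp only: of_int_0_less_iff)
  ultimately have "of_int \<bar>p * s + q * r\<bar> \<le> exp (pi * Y)" by (simp only: exp_ln)
  then show ?thesis using that gam Ce qr by blast
qed

text \<open>As p is nonzero, p, q and r determine s. Since ps = 1 + qr and |ps + qr| <= M, both
  products, hence all the entries, have absolute value at most M, which leaves at most (2M + 1)^3
  classes.\<close>

lemma N_Lambda_PB_upper: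
  "finite (N_Lambda_PB 3 Y) \<and> real (card (N_Lambda_PB 3 Y)) \<le> exp (6 * pi * Y) / 2"
proof -
  define E where "E = exp (pi * Y)"
  define M where "M = \<lfloor>E\<rfloor>"
  have M: "of_int M \<le> E" "0 \<le> M" by (auto simp: M_def E_def)
  let ?B = "{- M..M} \<times> {- M..M} \<times> {- M..M}"
  let ?f = "\<lambda>(p, q, r). cls p q r ((1 + q * r) div p)"
  have sub: "N_Lambda_PB 3 Y \<subseteq> ?f ` ?B"
  proof
    fix C assume "C \<in> N_Lambda_PB 3 Y"
    then obtain p q r s where gam: "gam p q r s" and C: "C = cls p q r s" and qr: "q * r \<noteq> 0"
      and le: "of_int \<bar>p * s + q * r\<bar> \<le> E" using N_Lambda_PB_3 unfolding E_def by metis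
    have leM: "\<bar>p * s + q * r\<bar> \<le> M" using le by (simp add: M_def le_floor_iff)
    have d: "p * s = 1 + q * r" "even q" using gam_det[OF gam] by auto
    then have "odd (p * s)" by simp
    then have p0: "p \<noteq> 0" "s \<noteq> 0" by auto
    have abs_le: "\<bar>x\<bar> \<le> \<bar>x * y\<bar>" if "y \<noteq> 0" for x y :: int
      using that mult_left_mono[of 1 "\<bar>y\<bar>" "\<bar>x\<bar>"] by (simp add: abs_mult)
    have "\<bar>p\<bar> \<le> \<bar>p * s\<bar>" "\<bar>q\<bar> \<le> \<bar>q * r\<bar>" "\<bar>r\<bar> \<le> \<bar>r * q\<bar>"
      using abs_le p0 qr by auto
    moreover have "\<bar>p * s\<bar> \<le> M" "\<bar>q * r\<bar> \<le> M"
      using leM gam_product_pos(2)[OF gam qr] unfolding d(1) by linarith+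
    ultimately have "\<bar>p\<bar> \<le> M" "\<bar>q\<bar> \<le> M" "\<bar>r\<bar> \<le> M" by (simp_all add: mult.commute)
    then have "(p, q, r) \<in> ?B" by auto
    moreover have "s = (1 + q * r) div p" using d(1) p0 by (metis nonzero_mult_div_cancel_left)
    ultimately show "C \<in> ?f ` ?B" unfolding C by (intro image_eqI[of _ _ "(p, q, r)"]) auto
  qed
  have fin: "finite ?B" by simp
  have finN: "finite (N_Lambda_PB 3 Y)" using finite_subset[OF sub] by simp
  have E6: "exp (6 * pi * Y) = E ^ 6" unfolding E_def by (simp flip: exp_of_nat_mult)
  have "real (card (N_Lambda_PB 3 Y)) \<le> E ^ 6 / 2"
  \<comment> \<open>For small E the cubic bound is not below E^6/2. But a single member forces E >=
    7, and then (2M + 1)^3 <= 27 E^3 <= E^6/2.\<close>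
  proof (cases "N_Lambda_PB 3 Y = {}")
    case True
    then show ?thesis by (simp add: E_def)
  next
    case False
    then obtain p q r s where gam: "gam p q r s" "q * r \<noteq> 0" and le: "of_int \<bar>p * s + q * r\<bar> \<le> E"
      using N_Lambda_PB_3 unfolding E_def by (metis ex_in_conv)
    have "7 \<le> real_of_int \<bar>p * s + q * r\<bar>"
      using gam_product_pos(2)[OF gam] by (metis of_int_le_iff of_int_numeral)
    then have E7: "7 \<le> E" using le by linarith
    have "card (N_Lambda_PB 3 Y) \<le> card ?B"
      by (rule order_trans[OF card_mono[OF finite_imageI[OF fin] sub] card_image_le[OF fin]])
    also have "\<dots> = nat (2 * M + 1) ^ 3"
    proof -
      have "card {- M..M} = nat (2 * M + 1)" by simp
      then show ?thesis by (simp only: card_cartesian_product power3_eq_cube mult.assoc)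
    qed
    finally have "real (card (N_Lambda_PB 3 Y)) \<le> real (nat (2 * M + 1)) ^ 3" by (metis of_nat_le_iff of_nat_power)
    also have "real (nat (2 * M + 1)) = 2 * of_int M + 1" using M(2) by simp
    also have "(2 * of_int M + 1) ^ 3 \<le> (3 * E) ^ 3" using M E7 by (intro power_mono) auto
    also have "\<dots> = 27 * E ^ 3" by (simp add: power_mult_distrib)
    also have "\<dots> \<le> (E ^ 3 / 2) * E ^ 3"
    proof (rule mult_right_mono)
      have "(7::real) ^ 3 \<le> E ^ 3" using E7 by (intro power_mono) auto
      then show "27 \<le> E ^ 3 / 2" by simp
    qed (use E7 in simp)
    also have "\<dots> = E ^ 6 / 2" by (simp flip: power_add)
    finally show ?thesis .
  qed
  then show ?thesis using finN E6 by simp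
qed

text \<open>The classes of the family are distinct, and their length grows at most logarithmically
  in m, so those with m up to X/2, rounded up, lie below Y. Their length is positive because 8m + 1
  > 1.\<close>

lemma N_Lambda_PB_lower:
  assumes Y: "600 * ln 8 \<le> Y"
  shows "exp (Y / 900) / 2 \<le> real (card (N_Lambda_PB 3 Y))"
proof -
  define X where "X = exp (Y / 900)"
  have "exp 1 \<le> (8::real)" using exp_le by linarith
  then have "1 \<le> ln (8::real)" by (simp add: ln_ge_iff)
  then have Y600: "600 \<le> Y" using Y by linarith
  have X1: "1 \<le> X" using Y600 by (simp add: X_def)
  \<comment> \<open>For m < X/2 + 1 one has 2 + 16m < 18 + 8X <= 26X, the last step by X >=
    1.\<close>
  have big: "26 * X \<le> exp Y"
  proof -
    have "26 \<le> 1 + Y * (899 / 900)" using Y600 by simp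
    also have "\<dots> \<le> exp (Y * (899 / 900))" by (rule exp_ge_add_one_self)
    finally have "X * 26 \<le> X * exp (Y * (899 / 900))" using X1 by (intro mult_left_mono) auto
    also have "\<dots> = exp Y" by (simp add: X_def field_simps flip: exp_add)
    finally show ?thesis by simp
  qed
  define M where "M = \<lceil>X / 2\<rceil>"
  have M: "X / 2 \<le> of_int M" "of_int M < X / 2 + 1" "0 \<le> M"
    using X1 ceiling_correct[of "X / 2"] by (auto simp: M_def)
  let ?f = "\<lambda>m::int. cls (1 + 4 * m) 2 (2 * m) 1"
  have sub: "?f ` {1..M} \<subseteq> N_Lambda_PB 3 Y"
  proof (rule image_subsetI)
    fix m assume m: "m \<in> {1..M}"
    define h where "h = (SOME g. g \<in> ?f m)"
    obtain g where "g \<in> ?f m" by (rule cls_witness[OF gam_family[of m]])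
    then have ne: "?f m \<noteq> {}" by blast
    then have h: "h \<in> ?f m" unfolding h_def by (simp add: some_in_eq)
    have "?f m \<in> PB_mod_Z 3" unfolding PB_mod_Z_3 using gam_family ne by blast
    moreover have "0 < Lambda_tr 3 h"
    proof -
      have qr: "2 * (2 * m) \<noteq> 0" using m by auto
      have "1 < real_of_int \<bar>(1 + 4 * m) * 1 + 2 * (2 * m)\<bar>"
        using gam_product_pos(2)[OF gam_family qr] by (metis less_le_trans of_int_less_iff of_int_1 one_less_numeral_iff semiring_norm(77))
      then have "0 < ereal (ln (of_int \<bar>(1 + 4 * m) * 1 + 2 * (2 * m)\<bar>) / pi)" by (simp add: ln_gt_zero)
      also have "\<dots> \<le> Lambda_tr 3 h" by (rule Lambda_tr_lower[OF h gam_family qr])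
      finally show ?thesis .
    qed
    moreover have "Lambda_tr 3 h \<le> ereal Y"
    proof -
      have "real_of_int m \<le> of_int M" using m by simp
      then have "2 + 16 * real_of_int m \<le> exp Y" using M(2) big X1 by linarith
      moreover have "0 < 2 + 16 * real_of_int m" using m by auto
      ultimately have "ln (2 + 16 * real_of_int m) \<le> Y" using ln_le_cancel_iff[of _ "exp Y"] by simp
      moreover have "Lambda_tr 3 h \<le> ereal (ln (2 + 16 * of_int m))" by (rule Lambda_tr_family[OF _ h]) (use m in simp)
      ultimately show ?thesis using order_trans ereal_less_eq(3) by blast
    qed
    ultimately show "?f m \<in> N_Lambda_PB 3 Y"
      by (simp add: N_Lambda_PB_def Lambda_tr_class_def h_def)
  qed
  have "inj_on ?f {1..M}" using cls_family_inj by (auto intro!: inj_onI)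
  from card_image[OF this] card_mono[OF conjunct1[OF N_Lambda_PB_upper] sub]
  have "card {1..M} \<le> card (N_Lambda_PB 3 Y)" by (simp only:)
  then have "of_int M \<le> real (card (N_Lambda_PB 3 Y))" using M(3) by simp
  then show ?thesis using M(1) by (simp add: X_def)
qed

theorem theorem1:
  shows "(\<forall>Y::real. Y > 0 \<longrightarrow>
            finite (N_Lambda_PB 3 Y) \<and> real (card (N_Lambda_PB 3 Y)) \<le> exp (6 * pi * Y) / 2) \<and>
         (\<forall>Y::real. Y \<ge> 600 * ln 8 \<longrightarrow>
            exp (Y / 900) / 2 \<le> real (card (N_Lambda_PB 3 Y)))"
  using N_Lambda_PB_upper N_Lambda_PB_lower by blast

end
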